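(* Let $G$ be a compact connected metric graph and $\mathcal{C}\subset L^\infty(G)$ a class of real-valued potentials. For $q_*\in\mathcal{C}$, let $\lambda_2(q_* )$ have finite multiplicity $n\ge 1$, let $u_1$ be a real normalized eigenfunction for $\lambda_1(q_* )$, let $u_2^{(1)},\dots,u_2^{(n)}$ be a real orthonormal basis of the eigenspace of $\lambda_2(q_* )$, and for a real-valued function $P$ on $G$ let the $n\times n$ matrix $(P_{jk})$ be defined by $$P_{jk}:=\int_G P(x)\left(u_2^{(j)}(x)u_2^{(k)}(x)-\delta_{jk}\,(u_1(x))^2\right)dx .$$ Suppose that $q_*$ is a minimizing potential for the function $\lambda_2(q)-\lambda_1(q)$ within $\mathcal{C}$. (1) If $P$ is a bounded positively admissible perturbation, then $(P_{jk})$ is a non-negative (i.e. positive semidefinite) matrix. In particular, $P_{kk}\ge 0$ for each $k$. (2) If $P$ is a bounded admissible perturbation, then $(P_{jk})$ is the zero matrix. Suppose instead that $q_*$ is a maximizing potential for $\lambda_2(q)-\lambda_1(q)$ within $\mathcal{C}$. (3) If $P$ is a bounded positively admissible perturbation, then it is not possible for $(P_{jk})$ to be a strictly positive (i.e. positive definite) matrix; that is, at least one of its eigenvalues must be $\le 0$. (4) If $P$ is a bounded admissible perturbation, then it is not possible for either $(P_{jk})$ or $(-P_{jk})$ to be a strictly positive (positive definite) matrix.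
   Context: A compact metric graph $G$ consists of finitely many edges, each identified with a compact interval $[0,|e|]$, $|e|>0$, whose endpoints are partitioned into finitely many classes (vertices) and glued accordingly. For a real potential $q$ on $G$, $H u=-u''+qu$ is the self-adjoint Schrödinger operator on $L^2(G)$ with standard (Kirchhoff) vertex conditions: continuity at each vertex and, at each vertex, the sum of the normal derivatives along all incident edge ends equals $0$. Its spectrum is discrete; eigenvalues counted with multiplicity are $\lambda_1(q)<\lambda_2(q)\le\dots$ (the first is always simple). A perturbation $P$ of $q_*$ is positively admissible if $q_*+tP\in\mathcal{C}$ for all sufficiently small $t>0$; it is admissible if both $P$ and $-P$ are positively admissible. $\delta_{jk}$ is the Kronecker delta. *)

theory Defs
  imports "HOL-Analysis.Analysis" "HOL-Library.Function_Algebras" "HOL-Library.Disjoint_Sets"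
begin

section \<open>Compact metric graphs\<close>

text \<open>
  Edge \<open>e\<close> is identified with the interval \<open>[0, len G e]\<close>. Its two ends are \<open>(e, False)\<close>
  (the endpoint 0) and \<open>(e, True)\<close> (the endpoint \<open>len G e\<close>); a vertex is a class of ends.
  Loops and multiple edges are allowed.
\<close>

record 'e metric_graph =
  edges :: "'e set"
  len :: "'e \<Rightarrow> real"
  verts :: "('e \<times> bool) set set"

definition compact_metric_graph :: "'e metric_graph \<Rightarrow> bool" where
  "compact_metric_graph G \<longleftrightarrow>
     finite (edges G) \<and> (\<forall>e\<in>edges G. 0 < len G e) \<and>
     partition_on (edges G \<times> UNIV) (verts G)"

definition edge_points :: "'e metric_graph \<Rightarrow> ('e \<times> real) set" where
  "edge_points G = Sigma (edges G) (\<lambda>e. {0..len G e})"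

definition endpoint :: "'e metric_graph \<Rightarrow> 'e \<times> bool \<Rightarrow> 'e \<times> real" where
  "endpoint G a = (fst a, if snd a then len G (fst a) else 0)"

definition glue :: "'e metric_graph \<Rightarrow> (('e \<times> real) \<times> ('e \<times> real)) set" where
  "glue G = {(p, p'). p \<in> edge_points G \<and> p' \<in> edge_points G \<and>
     (p = p' \<or> (\<exists>v\<in>verts G. \<exists>a\<in>v. \<exists>b\<in>v. p = endpoint G a \<and> p' = endpoint G b))}"

definition edges_topology :: "'e metric_graph \<Rightarrow> ('e \<times> real) topology" where
  "edges_topology G = sum_topology (\<lambda>e. top_of_set {0..len G e}) (edges G)"

text \<open>The graph as a topological space: the quotient of the disjoint union of its edges.\<close>

definition graph_space :: "'e metric_graph \<Rightarrow> ('e \<times> real) set topology" where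
  "graph_space G = topology (\<lambda>U. U \<subseteq> edge_points G // glue G \<and>
     openin (edges_topology G) {p \<in> edge_points G. glue G `` {p} \<in> U})"

lemma topspace_edges_topology: "topspace (edges_topology G) = edge_points G"
  by (simp add: edges_topology_def edge_points_def topspace_sum_topology comp_def)

lemma openin_graph_space:
  "openin (graph_space G) U \<longleftrightarrow> U \<subseteq> edge_points G // glue G \<and>
     openin (edges_topology G) {p \<in> edge_points G. glue G `` {p} \<in> U}"
proof -
  have "istopology (\<lambda>U. U \<subseteq> edge_points G // glue G \<and>
     openin (edges_topology G) {p \<in> edge_points G. glue G `` {p} \<in> U})"
  proof -
    have 1: "{p \<in> edge_points G. glue G `` {p} \<in> S \<inter> T} =
      {p \<in> edge_points G. glue G `` {p} \<in> S} \<inter> {p \<in> edge_points G. glue G `` {p} \<in> T}" for S T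
      by auto
    have 2: "{p \<in> edge_points G. glue G `` {p} \<in> \<Union> \<K>} =
      (\<Union>K\<in>\<K>. {p \<in> edge_points G. glue G `` {p} \<in> K})" for \<K>
      by auto
    show ?thesis
      unfolding istopology_def 1 2 by blast
  qed
  then show ?thesis
    by (simp add: graph_space_def)
qed

lemma quotient_map_graph_space:
  "quotient_map (edges_topology G) (graph_space G) (\<lambda>p. glue G `` {p})"
proof -
  have im: "(\<lambda>p. glue G `` {p}) ` edge_points G = edge_points G // glue G"
    by (auto simp: quotient_def)
  have "{p \<in> edge_points G. glue G `` {p} \<in> edge_points G // glue G} = topspace (edges_topology G)"
    by (auto simp: quotient_def topspace_edges_topology)
  then have "openin (graph_space G) (edge_points G // glue G)"
    by (simp add: openin_graph_space)
  moreover have "topspace (graph_space G) \<subseteq> edge_points G // glue G"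
    using openin_graph_space[of G "topspace (graph_space G)"] by simp
  ultimately have "topspace (graph_space G) = edge_points G // glue G"
    by (simp add: openin_subset subset_antisym)
  then show ?thesis
    by (auto simp: quotient_map_def topspace_edges_topology im openin_graph_space)
qed

section \<open>Function spaces\<close>

text \<open>
  Functions on the graph are given edgewise; the vertices form a null set, and
  continuity across vertices is imposed where it is needed.
\<close>

definition graph_integral :: "'e metric_graph \<Rightarrow> ('e \<Rightarrow> real \<Rightarrow> real) \<Rightarrow> real" where
  "graph_integral G f = (\<Sum>e\<in>edges G. LINT x|lebesgue_on {0..len G e}. f e x)"

definition Linfty :: "'e metric_graph \<Rightarrow> ('e \<Rightarrow> real \<Rightarrow> real) set" where
  "Linfty G = {q. \<forall>e\<in>edges G. q e \<in> borel_measurable (lebesgue_on {0..len G e}) \<and>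
     (\<exists>B. AE x in lebesgue_on {0..len G e}. \<bar>q e x\<bar> \<le> B)}"

text \<open>
  \<open>H2_interval L u u' u''\<close>: the function \<open>u\<close> belongs to the Sobolev space \<open>H\<^sup>2(0,L)\<close>, with
  \<open>u\<close> and \<open>u'\<close> the continuous representatives of the function and its first derivative on
  \<open>[0,L]\<close> (one-sided derivative at the two endpoints), and \<open>u''\<close> a representative of the second
  weak derivative in \<open>L\<^sup>2(0,L)\<close>.
\<close>

definition H2_interval ::
  "real \<Rightarrow> (real \<Rightarrow> complex) \<Rightarrow> (real \<Rightarrow> complex) \<Rightarrow> (real \<Rightarrow> complex) \<Rightarrow> bool" where
  "H2_interval L u u' u'' \<longleftrightarrow>
     u'' \<in> borel_measurable (lebesgue_on {0..L}) \<and>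
     integrable (lebesgue_on {0..L}) (\<lambda>x. (cmod (u'' x))\<^sup>2) \<and>
     (\<forall>x\<in>{0..L}. (u has_vector_derivative u' x) (at x within {0..L})) \<and>
     (\<forall>x\<in>{0..L}. u' x = u' 0 + (LINT y|lebesgue_on {0..x}. u'' y))"

section \<open>The Schroedinger operator with standard vertex conditions\<close>

definition end_value :: "'e metric_graph \<Rightarrow> ('e \<Rightarrow> real \<Rightarrow> complex) \<Rightarrow> 'e \<times> bool \<Rightarrow> complex" where
  "end_value G u a = u (fst a) (if snd a then len G (fst a) else 0)"

text \<open>Derivative at an end in the direction pointing into the edge; \<open>u'\<close> is the edgewise derivative.\<close>

definition end_normal_deriv ::
  "'e metric_graph \<Rightarrow> ('e \<Rightarrow> real \<Rightarrow> complex) \<Rightarrow> 'e \<times> bool \<Rightarrow> complex" where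
  "end_normal_deriv G u' a = (if snd a then - u' (fst a) (len G (fst a)) else u' (fst a) 0)"

text \<open>
  \<open>schroedinger G q u f\<close>: \<open>u\<close> lies in the domain of \<open>H = -d\<^sup>2/dx\<^sup>2 + q\<close> on the complex space
  \<open>L\<^sup>2(G)\<close>, and \<open>H u = f\<close> almost everywhere. Elements of the domain are represented by their
  edgewise continuous representative, extended by 0 off the graph, so that functions equal in
  \<open>L\<^sup>2(G)\<close> are equal.
\<close>

definition schroedinger ::
  "'e metric_graph \<Rightarrow> ('e \<Rightarrow> real \<Rightarrow> real) \<Rightarrow>
   ('e \<Rightarrow> real \<Rightarrow> complex) \<Rightarrow> ('e \<Rightarrow> real \<Rightarrow> complex) \<Rightarrow> bool" where
  "schroedinger G q u f \<longleftrightarrow>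
     (\<forall>e x. (e, x) \<notin> edge_points G \<longrightarrow> u e x = 0) \<and>
     (\<exists>u' u''. (\<forall>e\<in>edges G. H2_interval (len G e) (u e) (u' e) (u'' e)) \<and>
        (\<forall>v\<in>verts G. \<forall>a\<in>v. \<forall>b\<in>v. end_value G u a = end_value G u b) \<and>
        (\<forall>v\<in>verts G. (\<Sum>a\<in>v. end_normal_deriv G u' a) = 0) \<and>
        (\<forall>e\<in>edges G. AE x in lebesgue_on {0..len G e}.
            f e x = - u'' e x + complex_of_real (q e x) * u e x))"

section \<open>Eigenvalues\<close>

definition cscale :: "complex \<Rightarrow> ('e \<Rightarrow> real \<Rightarrow> complex) \<Rightarrow> 'e \<Rightarrow> real \<Rightarrow> complex" where
  "cscale c u = (\<lambda>e x. c * u e x)"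

interpretation cfun: vector_space cscale
  by unfold_locales (auto simp: cscale_def fun_eq_iff algebra_simps)

definition eigenspace ::
  "'e metric_graph \<Rightarrow> ('e \<Rightarrow> real \<Rightarrow> real) \<Rightarrow> real \<Rightarrow> ('e \<Rightarrow> real \<Rightarrow> complex) set" where
  "eigenspace G q \<mu> = {u. schroedinger G q u (cscale (complex_of_real \<mu>) u)}"

definition eig_multiplicity :: "'e metric_graph \<Rightarrow> ('e \<Rightarrow> real \<Rightarrow> real) \<Rightarrow> real \<Rightarrow> nat" where
  "eig_multiplicity G q \<mu> = cfun.dim (eigenspace G q \<mu>)"

text \<open>
  Number of eigenvalues \<open>\<le> \<mu>\<close>, counted with multiplicity. The operator is self-adjoint,
  bounded below and has discrete spectrum, so all eigenvalues are real and the sum is finite.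
\<close>

definition eigenvalue_count :: "'e metric_graph \<Rightarrow> ('e \<Rightarrow> real \<Rightarrow> real) \<Rightarrow> real \<Rightarrow> nat" where
  "eigenvalue_count G q \<mu> =
     (\<Sum>\<nu>\<in>{\<nu>. \<nu> \<le> \<mu> \<and> (\<exists>u\<in>eigenspace G q \<nu>. u \<noteq> 0)}. eig_multiplicity G q \<nu>)"

text \<open>The \<open>k\<close>-th eigenvalue in nondecreasing order counted with multiplicity, \<open>k \<ge> 1\<close>.\<close>

definition eigval :: "'e metric_graph \<Rightarrow> ('e \<Rightarrow> real \<Rightarrow> real) \<Rightarrow> nat \<Rightarrow> real" where
  "eigval G q k = Inf {\<mu>. k \<le> eigenvalue_count G q \<mu>}"

definition gap :: "'e metric_graph \<Rightarrow> ('e \<Rightarrow> real \<Rightarrow> real) \<Rightarrow> real" where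
  "gap G q = eigval G q 2 - eigval G q 1"

section \<open>Optimal potentials and perturbations\<close>

definition minimizing_potential ::
  "'e metric_graph \<Rightarrow> ('e \<Rightarrow> real \<Rightarrow> real) set \<Rightarrow> ('e \<Rightarrow> real \<Rightarrow> real) \<Rightarrow> bool" where
  "minimizing_potential G C q \<longleftrightarrow> q \<in> C \<and> (\<forall>p\<in>C. gap G q \<le> gap G p)"

definition maximizing_potential ::
  "'e metric_graph \<Rightarrow> ('e \<Rightarrow> real \<Rightarrow> real) set \<Rightarrow> ('e \<Rightarrow> real \<Rightarrow> real) \<Rightarrow> bool" where
  "maximizing_potential G C q \<longleftrightarrow> q \<in> C \<and> (\<forall>p\<in>C. gap G p \<le> gap G q)"

definition positively_admissible ::
  "('e \<Rightarrow> real \<Rightarrow> real) set \<Rightarrow> ('e \<Rightarrow> real \<Rightarrow> real) \<Rightarrow> ('e \<Rightarrow> real \<Rightarrow> real) \<Rightarrow> bool" where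
  "positively_admissible C q P \<longleftrightarrow> (\<forall>\<^sub>F t in at_right (0::real). (\<lambda>e x. q e x + t * P e x) \<in> C)"

definition admissible ::
  "('e \<Rightarrow> real \<Rightarrow> real) set \<Rightarrow> ('e \<Rightarrow> real \<Rightarrow> real) \<Rightarrow> ('e \<Rightarrow> real \<Rightarrow> real) \<Rightarrow> bool" where
  "admissible C q P \<longleftrightarrow>
     positively_admissible C q P \<and> positively_admissible C q (\<lambda>e x. - P e x)"

definition complexify :: "('e \<Rightarrow> real \<Rightarrow> real) \<Rightarrow> 'e \<Rightarrow> real \<Rightarrow> complex" where
  "complexify u = (\<lambda>e x. complex_of_real (u e x))"

definition orthonormal_basis_of_eigenspace ::
  "'e metric_graph \<Rightarrow> ('e \<Rightarrow> real \<Rightarrow> real) \<Rightarrow> real \<Rightarrow> ('n \<Rightarrow> 'e \<Rightarrow> real \<Rightarrow> real) \<Rightarrow> bool" where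
  "orthonormal_basis_of_eigenspace G q \<mu> u \<longleftrightarrow>
     (\<forall>j k. graph_integral G (\<lambda>e x. u j e x * u k e x) = (if j = k then 1 else 0)) \<and>
     cfun.span (range (\<lambda>j. complexify (u j))) = eigenspace G q \<mu>"

definition pert_matrix ::
  "'e metric_graph \<Rightarrow> ('e \<Rightarrow> real \<Rightarrow> real) \<Rightarrow> ('n \<Rightarrow> 'e \<Rightarrow> real \<Rightarrow> real) \<Rightarrow>
   ('e \<Rightarrow> real \<Rightarrow> real) \<Rightarrow> real ^ 'n ^ 'n" where
  "pert_matrix G u1 u2 P = (\<chi> j k. graph_integral G
     (\<lambda>e x. P e x * (u2 j e x * u2 k e x - (if j = k then 1 else 0) * (u1 e x)\<^sup>2)))"

definition pos_semidef :: "real ^ 'n ^ 'n \<Rightarrow> bool" where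
  "pos_semidef A \<longleftrightarrow> transpose A = A \<and> (\<forall>x. 0 \<le> x \<bullet> (A *v x))"

definition pos_def :: "real ^ 'n ^ 'n \<Rightarrow> bool" where
  "pos_def A \<longleftrightarrow> transpose A = A \<and> (\<forall>x. x \<noteq> 0 \<longrightarrow> 0 < x \<bullet> (A *v x))"

end

theory Submission
  imports Defs "HOL-Complex_Analysis.Great_Picard"
begin

text \<open>
  On the functions that are edgewise \<open>C\<^sup>1\<close> and continuous at the vertices, a minimizing sequence of
  the quadratic form of \<open>H\<close>, constrained to be orthogonal to finitely many eigenfunctions, has a
  uniformly convergent subsequence (Arzela--Ascoli). Its limit solves the eigenvalue equation weakly
  and hence, by the lemma of du Bois-Reymond, classically. This gives min-max bounds for
  \<open>\<lambda>\<^sub>1\<close> and \<open>\<lambda>\<^sub>2\<close>. Since \<open>|u\<^sub>1|\<close> is a limit of a minimizing sequence as well, it is an eigenfunction,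
  and by uniqueness for the initial value problem and connectedness it has no zeros; so \<open>\<lambda>\<^sub>1 < \<lambda>\<^sub>2\<close>.

  Now perturb \<open>q\<close> to \<open>q + t P\<close>. Testing with the span of \<open>u\<^sub>1\<close> and a normalized \<open>w\<close> in the eigenspace of
  \<open>\<lambda>\<^sub>2\<close> bounds the second eigenvalue by \<open>\<lambda>\<^sub>2 + t \<integral> P w\<^sup>2 + O(t\<^sup>2)\<close>. Conversely, after splitting a function
  into its component in an eigenspace and the rest, the cross term is of order \<open>t\<close> and is absorbed by
  the spectral gap at the cost of \<open>O(t\<^sup>2)\<close>; this gives the lower bounds for both eigenvalues. Hence the
  first order change of the gap is governed by the quadratic form of \<open>(P\<^sub>j\<^sub>k)\<close>, and the claims follow
  by letting \<open>t\<close> tend to \<open>0\<close> from above.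
\<close>

section \<open>Essentially bounded functions on an interval\<close>

text \<open>Edgewise C1 functions avoid weak derivatives, but they are not complete in the energy
  norm: the uniform limit of a minimizing sequence is a priori only continuous, and the derivatives
  need not converge pointwise. The weak equation is therefore moved entirely onto twice
  differentiable test functions before the limit is taken. Constraints are imposed only against
  eigenfunctions, which keeps Lagrange multipliers out of the equation for the minimizer.

  \<open>eigval\<close> is an infimum over a count built from complex dimensions and a sum over
  eigenvalues. Both take default values on infinite objects, so discreteness of the spectrum has to
  be derived from the same compactness before the count can be used.

  The second eigenvalue may be degenerate, and its branches under perturbation are not followed. One
  unit vector of the eigenspace bounds the perturbed eigenvalue from above; a bound from below needs
  the form of \<open>P\<close> to exceed a constant on the whole eigenspace. Hence the asymmetry of
  the result: minimality controls every direction, maximality only the lowest one.\<close>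

definition ess_bounded :: "real \<Rightarrow> real \<Rightarrow> (real \<Rightarrow> real) \<Rightarrow> bool" where
  "ess_bounded a b k \<longleftrightarrow> k \<in> borel_measurable (lebesgue_on {a..b}) \<and>
     (\<exists>B. AE x in lebesgue_on {a..b}. \<bar>k x\<bar> \<le> B)"

lemma AE_lebesgue_on_mono:
  assumes "AE x in lebesgue_on {a..b::real}. P x" "{c..d} \<subseteq> {a..b}"
  shows "AE x in lebesgue_on {c..d}. P x"
proof -
  have "AE x in lebesgue. x \<in> {a..b} \<longrightarrow> P x"
    using assms(1) by (simp add: AE_restrict_space_iff)
  then have "AE x in lebesgue. x \<in> {c..d} \<longrightarrow> P x"
    by eventually_elim (use assms(2) in auto)
  then show ?thesis by (simp add: AE_restrict_space_iff)
qed

lemma ess_bounded_subinterval: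
  assumes "ess_bounded a b k" "{c..d} \<subseteq> {a..b}"
  shows "ess_bounded c d k"
  unfolding ess_bounded_def
proof (intro conjI)
  show "k \<in> borel_measurable (lebesgue_on {c..d})"
    using assms by (intro measurable_restrict_mono[OF _ assms(2)]) (auto simp only: ess_bounded_def)
  obtain B where "AE x in lebesgue_on {a..b}. \<bar>k x\<bar> \<le> B"
    using assms(1) by (auto simp: ess_bounded_def)
  from AE_lebesgue_on_mono[OF this assms(2)]
  show "\<exists>B. AE x in lebesgue_on {c..d}. \<bar>k x\<bar> \<le> B" by blast
qed

lemma ess_bounded_bound:
  assumes "ess_bounded a b k"
  obtains B where "B > 0" "AE x in lebesgue_on {a..b}. \<bar>k x\<bar> \<le> B"
proof -
  from assms obtain B where B: "AE x in lebesgue_on {a..b}. \<bar>k x\<bar> \<le> B"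
    by (auto simp: ess_bounded_def)
  from B have "AE x in lebesgue_on {a..b}. \<bar>k x\<bar> \<le> max B 1"
    by eventually_elim auto
  then show ?thesis by (intro that[of "max B 1"]) auto
qed

lemma integrable_ess_bounded:
  assumes "ess_bounded a b k"
  shows "integrable (lebesgue_on {a..b}) k"
proof -
  obtain B where "AE x in lebesgue_on {a..b}. \<bar>k x\<bar> \<le> B"
    using assms by (auto simp: ess_bounded_def)
  then show ?thesis
    using assms unfolding ess_bounded_def
    by (intro Bochner_Integration.integrable_bound[where f = "\<lambda>x. B" and g = k]) auto
qed

lemma ess_bounded_continuous:
  assumes "continuous_on {a..b} f"
  shows "ess_bounded a b f"
proof -
  have "bounded (f ` {a..b})"
    using assms by (intro compact_imp_bounded compact_continuous_image) auto
  then obtain B where "\<forall>x\<in>{a..b}. \<bar>f x\<bar> \<le> B"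
    by (auto simp: bounded_iff)
  then have "AE x in lebesgue_on {a..b}. \<bar>f x\<bar> \<le> B"
    by (intro AE_I2) auto
  then show ?thesis
    using continuous_imp_measurable_on_sets_lebesgue[OF assms] unfolding ess_bounded_def by auto
qed

lemma ess_bounded_mult:
  assumes "ess_bounded a b f" "ess_bounded a b g"
  shows "ess_bounded a b (\<lambda>x. f x * g x)"
proof -
  obtain B where B: "B > 0" "AE x in lebesgue_on {a..b}. \<bar>f x\<bar> \<le> B"
    using assms(1) ess_bounded_bound by blast
  obtain C where C: "C > 0" "AE x in lebesgue_on {a..b}. \<bar>g x\<bar> \<le> C"
    using assms(2) ess_bounded_bound by blast
  from B(2) C(2) have "AE x in lebesgue_on {a..b}. \<bar>f x * g x\<bar> \<le> B * C"
    by eventually_elim (auto simp: abs_mult intro!: mult_mono)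
  then show ?thesis using assms unfolding ess_bounded_def by auto
qed

lemma ess_bounded_add:
  assumes "ess_bounded a b f" "ess_bounded a b g"
  shows "ess_bounded a b (\<lambda>x. f x + g x)"
proof -
  obtain B where B: "B > 0" "AE x in lebesgue_on {a..b}. \<bar>f x\<bar> \<le> B"
    using assms(1) ess_bounded_bound by blast
  obtain C where C: "C > 0" "AE x in lebesgue_on {a..b}. \<bar>g x\<bar> \<le> C"
    using assms(2) ess_bounded_bound by blast
  from B(2) C(2) have "AE x in lebesgue_on {a..b}. \<bar>f x + g x\<bar> \<le> B + C"
    by eventually_elim auto
  then show ?thesis using assms unfolding ess_bounded_def by auto
qed

lemma ess_bounded_const: "ess_bounded a b (\<lambda>x. c)"
  by (intro ess_bounded_continuous continuous_intros)

lemma ess_bounded_cmult: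
  "ess_bounded a b f \<Longrightarrow> ess_bounded a b (\<lambda>x. c * f x)"
  by (intro ess_bounded_mult ess_bounded_const)

lemma ess_bounded_diff:
  assumes "ess_bounded a b f" "ess_bounded a b g"
  shows "ess_bounded a b (\<lambda>x. f x - g x)"
  using ess_bounded_add[OF assms(1) ess_bounded_cmult[OF assms(2), of "-1"]] by simp

lemmas ess_bounded_intros =
  ess_bounded_mult ess_bounded_add ess_bounded_diff ess_bounded_const

lemma integral_abs_le_AE:
  fixes f :: "real \<Rightarrow> real"
  assumes "AE x in lebesgue_on {a..b}. \<bar>f x\<bar> \<le> B" "a \<le> b" "B \<ge> 0"
  shows "\<bar>LINT x|lebesgue_on {a..b}. f x\<bar> \<le> B * (b - a)"
proof -
  have "\<bar>LINT x|lebesgue_on {a..b}. f x\<bar> \<le> (LINT x|lebesgue_on {a..b}. \<bar>f x\<bar>)"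
    by (rule integral_abs_bound)
  also have "\<dots> \<le> (LINT x|lebesgue_on {a..b}. B)"
    by (rule integral_mono_AE') (use assms in auto)
  also have "\<dots> = B * (b - a)"
    using assms(2) by (simp add: measure_restrict_space)
  finally show ?thesis .
qed

lemma integral_lebesgue_on_combine:
  fixes f :: "real \<Rightarrow> real"
  assumes "a \<le> c" "c \<le> b" "integrable (lebesgue_on {a..b}) f"
  shows "(LINT x|lebesgue_on {a..b}. f x) =
    (LINT x|lebesgue_on {a..c}. f x) + (LINT x|lebesgue_on {c..b}. f x)"
proof -
  have sub: "integrable (lebesgue_on {a..c}) f" "integrable (lebesgue_on {c..b}) f"
    by (rule Equivalence_Lebesgue_Henstock_Integration.integrable_subinterval[OF assms(3)],
        use assms in simp)+
  show ?thesis
    using Henstock_Kurzweil_Integration.integral_combine[OF assms(1,2), of f] assms sub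
    by (simp add: lebesgue_integral_eq_integral integrable_on_lebesgue_on)
qed

lemma integral_lebesgue_on_FTC:
  fixes F :: "real \<Rightarrow> real"
  assumes "a \<le> b" "continuous_on {a..b} f"
    and "\<And>x. x \<in> {a..b} \<Longrightarrow> (F has_real_derivative f x) (at x within {a..b})"
  shows "(LINT x|lebesgue_on {a..b}. f x) = F b - F a"
proof -
  have "(f has_integral (F b - F a)) {a..b}"
    using assms by (intro fundamental_theorem_of_calculus)
      (auto simp: has_real_derivative_iff_has_vector_derivative)
  then show ?thesis
    using assms(2) by (simp add: lebesgue_integral_eq_integral continuous_imp_integrable_real integral_unique)
qed

lemma has_real_derivative_indefinite_integral:
  fixes f :: "real \<Rightarrow> real"
  assumes "continuous_on {a..b} f" "x \<in> {a..b}"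
  shows "((\<lambda>x. LINT y|lebesgue_on {a..x}. f y) has_real_derivative f x) (at x within {a..b})"
proof -
  have eq: "(LINT y|lebesgue_on {a..t}. f y) = integral {a..t} f" if "t \<in> {a..b}" for t
    using that assms(1)
    by (intro lebesgue_integral_eq_integral continuous_imp_integrable_real)
       (auto intro: continuous_on_subset)
  show ?thesis
    by (rule has_field_derivative_transform_within[OF integral_has_real_derivative[OF assms], of 1])
       (use assms eq in auto)
qed

text \<open>The difference quotients are at most \<open>C * \<bar>y - x\<bar>\<close>, so the
  derivative is zero at every point, endpoints included. This makes it possible to compare functions
  of the upper limit of an integral without differentiating the integral almost everywhere.\<close>

lemma constant_of_quadratic_increments:
  fixes F :: "real \<Rightarrow> real"
  assumes "\<And>x y. a \<le> x \<Longrightarrow> x \<le> y \<Longrightarrow> y \<le> b \<Longrightarrow> \<bar>F y - F x\<bar> \<le> C * (y - x)\<^sup>2" "a \<le> b"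
  shows "F b = F a"
proof -
  have sym: "\<bar>F y - F x\<bar> \<le> C * (y - x)\<^sup>2" if "x \<in> {a..b}" "y \<in> {a..b}" for x y
    using assms(1)[of x y] assms(1)[of y x] that
    by (cases "x \<le> y") (auto simp: abs_minus_commute power2_commute)
  have "(F has_real_derivative 0) (at x within {a..b})" if x: "x \<in> {a..b}" for x
    unfolding has_field_derivative_iff
  proof (rule Lim_null_comparison)
    show "\<forall>\<^sub>F y in at x within {a..b}. norm ((F y - F x) / (y - x)) \<le> C * \<bar>y - x\<bar>"
      unfolding eventually_at
    proof (intro exI[of _ 1] conjI ballI impI)
      fix y assume y: "y \<in> {a..b}" "y \<noteq> x \<and> dist y x < 1"
      have "\<bar>F y - F x\<bar> \<le> C * \<bar>y - x\<bar> * \<bar>y - x\<bar>"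
        using sym[OF x y(1)] by (simp add: power2_eq_square mult.assoc flip: abs_mult)
      then show "norm ((F y - F x) / (y - x)) \<le> C * \<bar>y - x\<bar>"
        using y by (simp add: divide_le_eq)
    qed simp
    have "((\<lambda>y. C * \<bar>y - x\<bar>) \<longlongrightarrow> C * \<bar>x - x\<bar>) (at x within {a..b})"
      by (intro tendsto_intros)
    then show "((\<lambda>y. C * \<bar>y - x\<bar>) \<longlongrightarrow> 0) (at x within {a..b})" by simp
  qed
  then obtain c where "\<forall>x\<in>{a..b}. F x = c"
    using has_field_derivative_zero_constant[of "{a..b}" F] by auto
  then show ?thesis using assms(2) by auto
qed

text \<open>The increment is the integral of \<open>k\<close> between the two points. The derivative
  of an eigenfunction is such a \<open>w\<close>, with density \<open>(q e y - M) * u e y\<close>; a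
  merely bounded potential allows no more regularity than this.\<close>

lemma indefinite_integral_lipschitz:
  fixes k w :: "real \<Rightarrow> real"
  assumes k: "integrable (lebesgue_on {a..b}) k" and B: "AE x in lebesgue_on {a..b}. \<bar>k x\<bar> \<le> B" "B \<ge> 0"
    and w: "\<And>x. x \<in> {a..b} \<Longrightarrow> w x = c + (LINT y|lebesgue_on {a..x}. k y)"
    and xy: "x \<in> {a..b}" "y \<in> {a..b}"
  shows "\<bar>w y - w x\<bar> \<le> B * \<bar>y - x\<bar>"
proof -
  have *: "\<bar>w y - w x\<bar> \<le> B * \<bar>y - x\<bar>" if "x \<le> y" "x \<in> {a..b}" "y \<in> {a..b}" for x y
  proof -
    have "(LINT t|lebesgue_on {a..y}. k t) =
        (LINT t|lebesgue_on {a..x}. k t) + (LINT t|lebesgue_on {x..y}. k t)"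
      by (rule integral_lebesgue_on_combine)
        (use that in \<open>auto intro: Equivalence_Lebesgue_Henstock_Integration.integrable_subinterval[OF k]\<close>)
    then have "w y - w x = (LINT t|lebesgue_on {x..y}. k t)"
      using w that by simp
    moreover have "AE t in lebesgue_on {x..y}. \<bar>k t\<bar> \<le> B"
      by (rule AE_lebesgue_on_mono[OF B(1)]) (use that in auto)
    ultimately show ?thesis
      using integral_abs_le_AE[where f = k and a = x and b = y and B = B] that B(2) by simp
  qed
  show ?thesis
    using *[of x y] *[of y x] xy by (cases "x \<le> y") (auto simp: abs_minus_commute)
qed

lemma lipschitz_continuous_on_real:
  fixes w :: "real \<Rightarrow> real"
  assumes "\<And>x y. x \<in> S \<Longrightarrow> y \<in> S \<Longrightarrow> \<bar>w y - w x\<bar> \<le> B * \<bar>y - x\<bar>"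
  shows "continuous_on S w"
  unfolding continuous_on_def
proof
  fix x assume x: "x \<in> S"
  have "((\<lambda>y. w y - w x) \<longlongrightarrow> 0) (at x within S)"
  proof (rule Lim_null_comparison)
    show "\<forall>\<^sub>F y in at x within S. norm (w y - w x) \<le> B * \<bar>y - x\<bar>"
      using assms x by (auto simp: eventually_at intro!: exI[of _ 1])
    have "((\<lambda>y. B * \<bar>y - x\<bar>) \<longlongrightarrow> B * \<bar>x - x\<bar>) (at x within S)"
      by (intro tendsto_intros)
    then show "((\<lambda>y. B * \<bar>y - x\<bar>) \<longlongrightarrow> 0) (at x within S)" by simp
  qed
  then show "(w \<longlongrightarrow> w x) (at x within S)" by (simp add: LIM_zero_iff)
qed

lemma indefinite_integral_continuous:
  assumes "ess_bounded a b k"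
    and "\<And>x. x \<in> {a..b} \<Longrightarrow> w x = c + (LINT y|lebesgue_on {a..x}. k y)"
  shows "continuous_on {a..b} w"
proof -
  obtain B where "B > 0" "AE x in lebesgue_on {a..b}. \<bar>k x\<bar> \<le> B"
    using assms(1) ess_bounded_bound by blast
  then show ?thesis
    using indefinite_integral_lipschitz[OF integrable_ess_bounded[OF assms(1)], of B w c] assms(2)
    by (intro lipschitz_continuous_on_real[of _ _ B]) auto
qed

lemma C1_lipschitz:
  fixes \<phi> :: "real \<Rightarrow> real"
  assumes "continuous_on {a..b} \<phi>'"
    and "\<And>x. x \<in> {a..b} \<Longrightarrow> (\<phi> has_real_derivative \<phi>' x) (at x within {a..b})"
  obtains D where "D > 0" "\<And>x. x \<in> {a..b} \<Longrightarrow> \<bar>\<phi>' x\<bar> \<le> D"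
    "\<And>x y. x \<in> {a..b} \<Longrightarrow> y \<in> {a..b} \<Longrightarrow> \<bar>\<phi> y - \<phi> x\<bar> \<le> D * \<bar>y - x\<bar>"
proof -
  have "bounded (\<phi>' ` {a..b})"
    using assms(1) by (intro compact_imp_bounded compact_continuous_image) auto
  then obtain D where D: "D > 0" "\<forall>x\<in>{a..b}. \<bar>\<phi>' x\<bar> \<le> D"
    by (auto simp: bounded_pos)
  have "\<bar>\<phi> y - \<phi> x\<bar> \<le> D * \<bar>y - x\<bar>" if "x \<in> {a..b}" "y \<in> {a..b}" for x y
    using field_differentiable_bound[of "{a..b}" \<phi> \<phi>' D y x] assms(2) D that by auto
  with D that show ?thesis by blast
qed

lemma C1_continuous:
  fixes \<phi> :: "real \<Rightarrow> real"
  assumes "\<And>x. x \<in> S \<Longrightarrow> (\<phi> has_real_derivative \<phi>' x) (at x within S)"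
  shows "continuous_on S \<phi>"
  using assms DERIV_continuous continuous_on_eq_continuous_within by blast

text \<open>Since \<open>w\<close> is differentiable only almost everywhere, the two sides are compared as functions
  of the upper limit \<open>x\<close>: their difference has increments of order \<open>(y - x)\<^sup>2\<close>.\<close>

lemma integral_by_parts_indefinite:
  fixes \<phi> w :: "real \<Rightarrow> real"
  assumes ab: "a \<le> b" and k: "ess_bounded a b k"
    and w: "\<And>x. x \<in> {a..b} \<Longrightarrow> w x = c + (LINT y|lebesgue_on {a..x}. k y)"
    and \<phi>': "continuous_on {a..b} \<phi>'"
    and \<phi>: "\<And>x. x \<in> {a..b} \<Longrightarrow> (\<phi> has_real_derivative \<phi>' x) (at x within {a..b})"
  shows "(LINT x|lebesgue_on {a..b}. k x * \<phi> x) =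
    w b * \<phi> b - w a * \<phi> a - (LINT x|lebesgue_on {a..b}. w x * \<phi>' x)"
proof -
  obtain B where B: "B > 0" "AE x in lebesgue_on {a..b}. \<bar>k x\<bar> \<le> B"
    using k ess_bounded_bound by blast
  have lip: "\<bar>w y - w x\<bar> \<le> B * \<bar>y - x\<bar>" if "x \<in> {a..b}" "y \<in> {a..b}" for x y
    by (rule indefinite_integral_lipschitz[OF integrable_ess_bounded[OF k] B(2) _ w])
      (use that B in auto)
  obtain D where D: "D > 0" "\<And>x. x \<in> {a..b} \<Longrightarrow> \<bar>\<phi>' x\<bar> \<le> D"
      "\<And>x y. x \<in> {a..b} \<Longrightarrow> y \<in> {a..b} \<Longrightarrow> \<bar>\<phi> y - \<phi> x\<bar> \<le> D * \<bar>y - x\<bar>"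
    using C1_lipschitz[OF \<phi>' \<phi>] by blast
  have wc: "continuous_on {a..b} w" by (rule indefinite_integral_continuous[OF k w])
  have \<phi>c: "continuous_on {a..b} \<phi>" by (rule C1_continuous[OF \<phi>])
  have eb: "ess_bounded a b w" "ess_bounded a b \<phi>" "ess_bounded a b \<phi>'"
    using wc \<phi>c \<phi>' by (auto intro: ess_bounded_continuous)
  define F where "F x = (LINT y|lebesgue_on {a..x}. k y * \<phi> y + w y * \<phi>' y) - w x * \<phi> x" for x
  have int: "ess_bounded a b (\<lambda>t. k t * \<phi> t + w t * \<phi>' t)"
    by (intro ess_bounded_intros k eb)
  have "F b = F a"
  proof (rule constant_of_quadratic_increments[OF _ ab])
    fix x y assume xy: "a \<le> x" "x \<le> y" "y \<le> b"
    have sub: "{x..y} \<subseteq> {a..b}" using xy by auto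
    note eb' = eb[THEN ess_bounded_subinterval, OF sub] k[THEN ess_bounded_subinterval, OF sub]
    have ik: "(LINT t|lebesgue_on {x..y}. k t) = w y - w x"
    proof -
      have "(LINT t|lebesgue_on {a..y}. k t) =
          (LINT t|lebesgue_on {a..x}. k t) + (LINT t|lebesgue_on {x..y}. k t)"
        by (rule integral_lebesgue_on_combine[OF xy(1,2)])
          (intro integrable_ess_bounded ess_bounded_subinterval[OF k], use xy in auto)
      then show ?thesis using w xy by simp
    qed
    have i\<phi>: "(LINT t|lebesgue_on {x..y}. \<phi>' t) = \<phi> y - \<phi> x"
      using xy by (intro integral_lebesgue_on_FTC continuous_on_subset[OF \<phi>'])
        (auto intro: DERIV_subset[OF \<phi>])
    have "(LINT t|lebesgue_on {a..y}. k t * \<phi> t + w t * \<phi>' t) =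
        (LINT t|lebesgue_on {a..x}. k t * \<phi> t + w t * \<phi>' t) +
        (LINT t|lebesgue_on {x..y}. k t * \<phi> t + w t * \<phi>' t)"
      by (rule integral_lebesgue_on_combine[OF xy(1,2)])
        (use xy in \<open>auto intro!: integrable_ess_bounded ess_bounded_subinterval[OF int]\<close>)
    then have "F y - F x =
        (LINT t|lebesgue_on {x..y}. k t * \<phi> t + w t * \<phi>' t) - (w y * \<phi> y - w x * \<phi> x)"
      by (simp add: F_def)
    \<comment> \<open>Freezing \<open>\<phi>\<close> at \<open>x\<close> and \<open>w\<close> at
      \<open>y\<close> leaves terms that integrate exactly to the increment of the product. Each
      remaining term contains a factor of size \<open>y - x\<close> and is integrated over an
      interval of that length, hence the quadratic bound.\<close>
    also have "(LINT t|lebesgue_on {x..y}. k t * \<phi> t + w t * \<phi>' t) =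
        (LINT t|lebesgue_on {x..y}. (k t * (\<phi> t - \<phi> x) + (w t - w y) * \<phi>' t)
           + (\<phi> x * k t + w y * \<phi>' t))"
      by (simp add: algebra_simps)
    also have "\<dots> = (LINT t|lebesgue_on {x..y}. k t * (\<phi> t - \<phi> x) + (w t - w y) * \<phi>' t)
        + (LINT t|lebesgue_on {x..y}. \<phi> x * k t + w y * \<phi>' t)"
      by (intro Bochner_Integration.integral_add integrable_ess_bounded ess_bounded_intros eb')
    also have "(LINT t|lebesgue_on {x..y}. \<phi> x * k t + w y * \<phi>' t) =
        \<phi> x * (w y - w x) + w y * (\<phi> y - \<phi> x)"
      using integrable_ess_bounded[OF eb'(4)] integrable_ess_bounded[OF eb'(3)]
      by (simp add: ik i\<phi>)
    finally have eq: "F y - F x =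
        (LINT t|lebesgue_on {x..y}. k t * (\<phi> t - \<phi> x) + (w t - w y) * \<phi>' t)"
      by (simp add: algebra_simps)
    have "AE t in lebesgue_on {x..y}. \<bar>k t\<bar> \<le> B"
      by (rule AE_lebesgue_on_mono[OF B(2) sub])
    moreover have "AE t in lebesgue_on {x..y}. t \<in> {x..y}"
      by (intro AE_I2) auto
    ultimately have "AE t in lebesgue_on {x..y}.
        \<bar>k t * (\<phi> t - \<phi> x) + (w t - w y) * \<phi>' t\<bar> \<le> 2 * B * D * (y - x)"
    proof eventually_elim
      case (elim t)
      have "\<bar>k t * (\<phi> t - \<phi> x)\<bar> \<le> B * (D * (y - x))"
        unfolding abs_mult using elim D(3)[of x t] xy B(1) D(1)
        by (intro mult_mono order_trans[OF D(3)]) (auto intro: mult_left_mono)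
      moreover have "\<bar>(w t - w y) * \<phi>' t\<bar> \<le> (B * (y - x)) * D"
        unfolding abs_mult using elim xy B(1) D(1)
        by (intro mult_mono order_trans[OF lip] D(2)) (auto intro: mult_left_mono)
      ultimately show ?case by (simp add: algebra_simps)
    qed
    then have "\<bar>F y - F x\<bar> \<le> 2 * B * D * (y - x) * (y - x)"
      unfolding eq by (rule integral_abs_le_AE) (use xy B D in auto)
    then show "\<bar>F y - F x\<bar> \<le> 2 * B * D * (y - x)\<^sup>2"
      by (simp add: power2_eq_square mult.assoc)
  qed
  moreover have "(LINT y|lebesgue_on {a..a}. k y * \<phi> y + w y * \<phi>' y) = 0"
    by (simp add: integral_eq_zero_null_sets)
  ultimately have "(LINT x|lebesgue_on {a..b}. k x * \<phi> x + w x * \<phi>' x) = w b * \<phi> b - w a * \<phi> a"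
    by (simp add: F_def)
  moreover have "(LINT x|lebesgue_on {a..b}. k x * \<phi> x + w x * \<phi>' x) =
      (LINT x|lebesgue_on {a..b}. k x * \<phi> x) + (LINT x|lebesgue_on {a..b}. w x * \<phi>' x)"
    by (intro Bochner_Integration.integral_add integrable_ess_bounded ess_bounded_intros k eb)
  ultimately show ?thesis by simp
qed

text \<open>With both factors C1 the product rule holds at every point, and the fundamental theorem
  of calculus applies directly.\<close>

lemma integral_by_parts_C1:
  fixes f g :: "real \<Rightarrow> real"
  assumes ab: "a \<le> b" and f': "continuous_on {a..b} f'" and g': "continuous_on {a..b} g'"
    and f: "\<And>x. x \<in> {a..b} \<Longrightarrow> (f has_real_derivative f' x) (at x within {a..b})"
    and g: "\<And>x. x \<in> {a..b} \<Longrightarrow> (g has_real_derivative g' x) (at x within {a..b})"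
  shows "(LINT x|lebesgue_on {a..b}. f' x * g x) =
    f b * g b - f a * g a - (LINT x|lebesgue_on {a..b}. f x * g' x)"
proof -
  note c = C1_continuous[OF f] C1_continuous[OF g] f' g'
  have "(LINT x|lebesgue_on {a..b}. f' x * g x + f x * g' x) = f b * g b - f a * g a"
    by (rule integral_lebesgue_on_FTC[OF ab])
       (auto intro!: continuous_intros c derivative_eq_intros f g)
  moreover have "(LINT x|lebesgue_on {a..b}. f' x * g x + f x * g' x) =
      (LINT x|lebesgue_on {a..b}. f' x * g x) + (LINT x|lebesgue_on {a..b}. f x * g' x)"
    by (intro Bochner_Integration.integral_add continuous_imp_integrable_real continuous_intros c)
  ultimately show ?thesis by simp
qed

section \<open>The lemma of du Bois-Reymond and regularity of weak solutions on an interval\<close>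

lemma integral_continuous_nonneg_eq_0:
  fixes f :: "real \<Rightarrow> real"
  assumes "a < b" "continuous_on {a..b} f" "\<And>x. x \<in> {a..b} \<Longrightarrow> 0 \<le> f x"
    and "(LINT x|lebesgue_on {a..b}. f x) = 0" "x \<in> {a..b}"
  shows "f x = 0"
proof -
  have "(f has_integral 0) {a..b}"
    using assms(4) has_integral_integral_lebesgue_on[OF continuous_imp_integrable_real[OF assms(2)]]
    by simp
  then have "(f has_integral 0) (cbox a b)" by simp
  then show ?thesis
    using has_integral_0_cbox_imp_0[of a b f x] assms by auto
qed

text \<open>The remainder \<open>\<psi>\<close> after subtracting an affine function has vanishing
  integral and vanishing first moment. This is exactly what makes its second primitive, together
  with the derivative of that primitive, vanish at both ends, so the primitive is an admissible test
  function; testing with it shows that the integral of the square of \<open>\<psi>\<close> is zero.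
  The factor 12 in \<open>b\<close> comes from the integral of the square of
  \<open>x - L / 2\<close>, which is one twelfth of the cube of \<open>L\<close>.\<close>

lemma du_bois_reymond:
  fixes g :: "real \<Rightarrow> real"
  assumes L: "0 < L" and g: "continuous_on {0..L} g"
    and test: "\<And>\<phi> \<phi>' \<phi>''. \<lbrakk>continuous_on {0..L} \<phi>'';
      \<And>x. x \<in> {0..L} \<Longrightarrow> (\<phi> has_real_derivative \<phi>' x) (at x within {0..L});
      \<And>x. x \<in> {0..L} \<Longrightarrow> (\<phi>' has_real_derivative \<phi>'' x) (at x within {0..L});
      \<phi> 0 = 0; \<phi> L = 0; \<phi>' 0 = 0; \<phi>' L = 0\<rbrakk> \<Longrightarrow> (LINT x|lebesgue_on {0..L}. g x * \<phi>'' x) = 0"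
  obtains a b where "\<And>x. x \<in> {0..L} \<Longrightarrow> g x = a + b * x"
proof -
  define A where "A = (LINT x|lebesgue_on {0..L}. g x)"
  define M where "M = (LINT x|lebesgue_on {0..L}. x * g x)"
  text \<open>\<open>a + b x\<close> is the orthogonal projection of \<open>g\<close> to the affine functions in \<open>L\<^sup>2(0,L)\<close>.\<close>
  define b where "b = 12 * (M - A * L / 2) / L^3"
  define a where "a = A / L - b * L / 2"
  define \<psi> where "\<psi> x = g x - (a + b * x)" for x
  define \<phi>' where "\<phi>' x = (LINT y|lebesgue_on {0..x}. \<psi> y)" for x
  define \<phi> where "\<phi> x = (LINT y|lebesgue_on {0..x}. \<phi>' y)" for x
  have \<psi>: "continuous_on {0..L} \<psi>"
    unfolding \<psi>_def by (intro continuous_intros g)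
  have d1: "(\<phi>' has_real_derivative \<psi> x) (at x within {0..L})" if "x \<in> {0..L}" for x
    unfolding \<phi>'_def by (rule has_real_derivative_indefinite_integral[OF \<psi> that])
  have c1: "continuous_on {0..L} \<phi>'" by (rule C1_continuous[OF d1])
  have d0: "(\<phi> has_real_derivative \<phi>' x) (at x within {0..L})" if "x \<in> {0..L}" for x
    unfolding \<phi>_def by (rule has_real_derivative_indefinite_integral[OF c1 that])
  have poly: "(LINT x|lebesgue_on {0..L}. a + b * x) = a * L + b * L\<^sup>2 / 2"
    using L by (subst integral_lebesgue_on_FTC[where F = "\<lambda>x. a * x + b * x\<^sup>2 / 2"])
      (auto intro!: continuous_intros derivative_eq_intros)
  have xpoly: "(LINT x|lebesgue_on {0..L}. x * (a + b * x)) = a * L\<^sup>2 / 2 + b * L^3 / 3"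
    using L by (subst integral_lebesgue_on_FTC[where F = "\<lambda>x. a * x\<^sup>2 / 2 + b * x^3 / 3"])
      (auto intro!: continuous_intros derivative_eq_intros simp: power2_eq_square algebra_simps)
  have int: "integrable (lebesgue_on {0..L}) h" if "continuous_on {0..L} h" for h :: "real \<Rightarrow> real"
    by (rule continuous_imp_integrable_real[OF that])
  have int\<psi>: "(LINT x|lebesgue_on {0..L}. \<psi> x) = 0"
  proof -
    have "(LINT x|lebesgue_on {0..L}. \<psi> x) = A - (a * L + b * L\<^sup>2 / 2)"
      unfolding \<psi>_def A_def poly[symmetric]
      by (intro Bochner_Integration.integral_diff int continuous_intros g)
    also have "\<dots> = 0" using L by (simp add: a_def field_simps power2_eq_square)
    finally show ?thesis .
  qed
  have intx\<psi>: "(LINT x|lebesgue_on {0..L}. x * \<psi> x) = 0"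
  proof -
    have "(LINT x|lebesgue_on {0..L}. x * \<psi> x) =
        (LINT x|lebesgue_on {0..L}. x * g x - x * (a + b * x))"
      by (simp add: \<psi>_def right_diff_distrib)
    also have "\<dots> = M - (a * L\<^sup>2 / 2 + b * L^3 / 3)"
      unfolding M_def xpoly[symmetric]
      by (intro Bochner_Integration.integral_diff int continuous_intros g)
    also have "\<dots> = M - A * L / 2 - b * L^3 / 12"
      using L by (simp add: a_def field_simps power2_eq_square power3_eq_cube)
    also have "\<dots> = 0" using L by (simp add: b_def)
    finally show ?thesis .
  qed
  have "\<phi> 0 = 0" "\<phi>' 0 = 0"
    by (simp_all add: \<phi>_def \<phi>'_def integral_eq_zero_null_sets)
  moreover have "\<phi>' L = 0" by (simp add: \<phi>'_def int\<psi>)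
  \<comment> \<open>Integration by parts against the function \<open>x\<close> turns the first
    moment of \<open>\<psi>\<close> into \<open>- \<phi> L\<close>.\<close>
  moreover have "\<phi> L = 0"
  proof -
    have "(LINT x|lebesgue_on {0..L}. \<psi> x * x) =
        \<phi>' L * L - \<phi>' 0 * 0 - (LINT x|lebesgue_on {0..L}. \<phi>' x * 1)"
      by (rule integral_by_parts_C1) (use L \<psi> d1 in auto)
    then show ?thesis
      using intx\<psi> \<open>\<phi>' L = 0\<close> by (simp add: \<phi>_def mult.commute)
  qed
  ultimately have g\<psi>: "(LINT x|lebesgue_on {0..L}. g x * \<psi> x) = 0"
    by (intro test[OF \<psi> d0 d1])
  \<comment> \<open>One factor \<open>\<psi>\<close> is written as \<open>g\<close> minus the affine
    part, which is orthogonal to \<open>\<psi>\<close> by the two moment conditions.\<close>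
  have "(LINT x|lebesgue_on {0..L}. \<psi> x * \<psi> x) =
      (LINT x|lebesgue_on {0..L}. g x * \<psi> x - (a * \<psi> x + b * (x * \<psi> x)))"
    by (simp add: \<psi>_def algebra_simps)
  also have "\<dots> = (LINT x|lebesgue_on {0..L}. g x * \<psi> x) - (LINT x|lebesgue_on {0..L}. a * \<psi> x + b * (x * \<psi> x))"
    by (intro Bochner_Integration.integral_diff int continuous_intros g \<psi>)
  also have "(LINT x|lebesgue_on {0..L}. a * \<psi> x + b * (x * \<psi> x)) =
      (LINT x|lebesgue_on {0..L}. a * \<psi> x) + (LINT x|lebesgue_on {0..L}. b * (x * \<psi> x))"
    by (intro Bochner_Integration.integral_add int continuous_intros g \<psi>)
  finally have sq: "(LINT x|lebesgue_on {0..L}. \<psi> x * \<psi> x) = 0"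
    by (simp add: g\<psi> int\<psi> intx\<psi>)
  have "\<psi> x * \<psi> x = 0" if "x \<in> {0..L}" for x
    by (rule integral_continuous_nonneg_eq_0[OF L _ _ sq that]) (auto intro!: continuous_intros \<psi>)
  then have "\<psi> x = 0" if "x \<in> {0..L}" for x
    using that by simp
  then show ?thesis
    by (intro that[of a b]) (auto simp: \<psi>_def)
qed

text \<open>The second primitive \<open>w\<close> of \<open>k\<close> satisfies the same weak
  equation, so \<open>u - w\<close> is annihilated by all \<open>\<phi>''\<close> and is affine by
  \<open>du_bois_reymond\<close>. Because the test functions vanish at both ends together with their
  first derivatives, no boundary values of \<open>u\<close> enter.\<close>

lemma weak_solution_regular:
  fixes u k :: "real \<Rightarrow> real"
  assumes L: "0 < L" and u: "continuous_on {0..L} u" and k: "ess_bounded 0 L k"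
    and weak: "\<And>\<phi> \<phi>' \<phi>''. \<lbrakk>continuous_on {0..L} \<phi>'';
      \<And>x. x \<in> {0..L} \<Longrightarrow> (\<phi> has_real_derivative \<phi>' x) (at x within {0..L});
      \<And>x. x \<in> {0..L} \<Longrightarrow> (\<phi>' has_real_derivative \<phi>'' x) (at x within {0..L});
      \<phi> 0 = 0; \<phi> L = 0; \<phi>' 0 = 0; \<phi>' L = 0\<rbrakk> \<Longrightarrow>
      (LINT x|lebesgue_on {0..L}. u x * \<phi>'' x) = (LINT x|lebesgue_on {0..L}. k x * \<phi> x)"
  obtains u' where "\<And>x. x \<in> {0..L} \<Longrightarrow> (u has_real_derivative u' x) (at x within {0..L})"
    "\<And>x. x \<in> {0..L} \<Longrightarrow> u' x = u' 0 + (LINT y|lebesgue_on {0..x}. k y)"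
proof -
  define w' where "w' x = (LINT y|lebesgue_on {0..x}. k y)" for x
  define w where "w x = (LINT y|lebesgue_on {0..x}. w' y)" for x
  have c1: "continuous_on {0..L} w'"
    by (rule indefinite_integral_continuous[OF k, where c = 0]) (simp add: w'_def)
  have d0: "(w has_real_derivative w' x) (at x within {0..L})" if "x \<in> {0..L}" for x
    unfolding w_def by (rule has_real_derivative_indefinite_integral[OF c1 that])
  have c0: "continuous_on {0..L} w" by (rule C1_continuous[OF d0])
  obtain a b where ab: "\<And>x. x \<in> {0..L} \<Longrightarrow> u x - w x = a + b * x"
  proof (rule du_bois_reymond[OF L, of "\<lambda>x. u x - w x"])
    show "continuous_on {0..L} (\<lambda>x. u x - w x)" by (intro continuous_intros u c0)
    fix \<phi> \<phi>' \<phi>'' :: "real \<Rightarrow> real"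
    assume \<phi>: "continuous_on {0..L} \<phi>''"
      "\<And>x. x \<in> {0..L} \<Longrightarrow> (\<phi> has_real_derivative \<phi>' x) (at x within {0..L})"
      "\<And>x. x \<in> {0..L} \<Longrightarrow> (\<phi>' has_real_derivative \<phi>'' x) (at x within {0..L})"
      "\<phi> 0 = 0" "\<phi> L = 0" "\<phi>' 0 = 0" "\<phi>' L = 0"
    have c\<phi>': "continuous_on {0..L} \<phi>'" by (rule C1_continuous[OF \<phi>(3)])
    have "(LINT x|lebesgue_on {0..L}. u x * \<phi>'' x) = (LINT x|lebesgue_on {0..L}. k x * \<phi> x)"
      by (rule weak[OF \<phi>])
    also have "\<dots> = - (LINT x|lebesgue_on {0..L}. w' x * \<phi>' x)"
      using integral_by_parts_indefinite[of 0 L k w' 0 \<phi>' \<phi>] L k c\<phi>' \<phi> by (simp add: w'_def)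
    also have "\<dots> = (LINT x|lebesgue_on {0..L}. w x * \<phi>'' x)"
      using integral_by_parts_C1[of 0 L w' \<phi>'' w \<phi>'] L c1 \<phi> d0 by simp
    finally have "(LINT x|lebesgue_on {0..L}. u x * \<phi>'' x) = (LINT x|lebesgue_on {0..L}. w x * \<phi>'' x)" .
    moreover have "(LINT x|lebesgue_on {0..L}. u x * \<phi>'' x - w x * \<phi>'' x) =
        (LINT x|lebesgue_on {0..L}. u x * \<phi>'' x) - (LINT x|lebesgue_on {0..L}. w x * \<phi>'' x)"
      by (intro Bochner_Integration.integral_diff continuous_imp_integrable_real continuous_intros u c0 \<phi>)
    ultimately show "(LINT x|lebesgue_on {0..L}. (u x - w x) * \<phi>'' x) = 0"
      by (simp add: left_diff_distrib)
  qed blast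
  have ueq: "u x = w x + (a + b * x)" if "x \<in> {0..L}" for x
    using ab[OF that] by simp
  show ?thesis
  proof (rule that[of "\<lambda>x. w' x + b"])
    fix x assume x: "x \<in> {0..L}"
    have "((\<lambda>x. w x + (a + b * x)) has_real_derivative w' x + b) (at x within {0..L})"
      by (auto intro!: derivative_eq_intros d0[OF x])
    then show "(u has_real_derivative w' x + b) (at x within {0..L})"
      by (rule has_field_derivative_transform_within[of _ _ _ _ 1]) (use x ueq in auto)
    show "w' x + b = (w' 0 + b) + (LINT y|lebesgue_on {0..x}. k y)"
      by (simp add: w'_def integral_eq_zero_null_sets)
  qed
qed

text \<open>Uniqueness for the initial value problem \<open>u'' = k\<close> with \<open>|k| \<le> K |u|\<close>: on intervals of length
  \<open>\<delta>\<close> with \<open>K \<delta>\<^sup>2 < 1\<close> the maximum of \<open>|u|\<close> is bounded by \<open>K \<delta>\<^sup>2\<close> times itself.\<close>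

lemma ode_unique_zero:
  fixes u u' k :: "real \<Rightarrow> real"
  assumes d: "\<And>x. x \<in> {0..L} \<Longrightarrow> (u has_real_derivative u' x) (at x within {0..L})"
    and u': "\<And>x. x \<in> {0..L} \<Longrightarrow> u' x = c + (LINT y|lebesgue_on {0..x}. k y)"
    and k: "integrable (lebesgue_on {0..L}) k"
    and K: "AE x in lebesgue_on {0..L}. \<bar>k x\<bar> \<le> K * \<bar>u x\<bar>" "K > 0"
    and x0: "x0 \<in> {0..L}" "u x0 = 0" "u' x0 = 0"
    and x: "x \<in> {0..L}"
  shows "u x = 0"
proof -
  \<comment> \<open>With this choice \<open>K * \<delta>\<^sup>2\<close> equals
    \<open>K / (K + 1)\<^sup>2\<close>, which is below 1 for every positive
    \<open>K\<close>.\<close>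
  define \<delta> where "\<delta> = 1 / (K + 1)"
  have \<delta>: "\<delta> > 0" "K * \<delta>\<^sup>2 < 1"
  proof -
    show "\<delta> > 0" using K(2) by (simp add: \<delta>_def)
    have "K < (K + 1)\<^sup>2" using K(2) by (simp add: power2_eq_square algebra_simps) (use K(2) in \<open>simp add: add_pos_pos\<close>)
    then show "K * \<delta>\<^sup>2 < 1" using K(2) by (simp add: \<delta>_def power_divide divide_less_eq)
  qed
  have uc: "continuous_on {0..L} u" by (rule C1_continuous[OF d])
  have step: "u z = 0 \<and> u' z = 0"
    if y: "y \<in> {0..L}" "u y = 0" "u' y = 0" and z: "z \<in> {0..L}" "\<bar>z - y\<bar> \<le> \<delta>" for y z
  proof -
    define a b where "a = max 0 (y - \<delta>)" and "b = min L (y + \<delta>)"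
    have ab: "y \<in> {a..b}" "z \<in> {a..b}" "{a..b} \<subseteq> {0..L}" "\<And>t. t \<in> {a..b} \<Longrightarrow> \<bar>t - y\<bar> \<le> \<delta>"
      using y z \<delta>(1) by (auto simp: a_def b_def)
    have "continuous_on {a..b} (\<lambda>x. \<bar>u x\<bar>)"
      by (intro continuous_intros continuous_on_subset[OF uc ab(3)])
    then obtain s where s: "s \<in> {a..b}" "\<And>t. t \<in> {a..b} \<Longrightarrow> \<bar>u t\<bar> \<le> \<bar>u s\<bar>"
      using continuous_attains_sup[of "{a..b}" "\<lambda>x. \<bar>u x\<bar>"] ab(1) by auto
    have ka: "integrable (lebesgue_on {a..b}) k"
      by (rule Equivalence_Lebesgue_Henstock_Integration.integrable_subinterval[OF k ab(3)])
    have "AE x in lebesgue_on {a..b}. x \<in> {a..b}" by (intro AE_I2) auto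
    with AE_lebesgue_on_mono[OF K(1) ab(3)]
    have kb: "AE x in lebesgue_on {a..b}. \<bar>k x\<bar> \<le> K * \<bar>u s\<bar>"
      by eventually_elim (use s(2) K(2) in \<open>force intro: order_trans mult_left_mono\<close>)
    have u'a: "u' x = u' a + (LINT y|lebesgue_on {a..x}. k y)" if "x \<in> {a..b}" for x
    proof -
      have "0 \<le> a" "x \<le> L" "a \<le> x" using that ab(3) by (auto simp: a_def)
      then have "(LINT y|lebesgue_on {0..x}. k y) =
          (LINT y|lebesgue_on {0..a}. k y) + (LINT y|lebesgue_on {a..x}. k y)"
        by (intro integral_lebesgue_on_combine)
          (auto intro: Equivalence_Lebesgue_Henstock_Integration.integrable_subinterval[OF k])
      then show ?thesis using u'[of x] u'[of a] \<open>0 \<le> a\<close> \<open>x \<le> L\<close> \<open>a \<le> x\<close> by simp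
    qed
    have u'b: "\<bar>u' t\<bar> \<le> K * \<bar>u s\<bar> * \<delta>" if t: "t \<in> {a..b}" for t
    proof -
      have "\<bar>u' t - u' y\<bar> \<le> (K * \<bar>u s\<bar>) * \<bar>t - y\<bar>"
        by (rule indefinite_integral_lipschitz[OF ka kb _ u'a]) (use ab t K(2) in auto)
      also have "\<dots> \<le> (K * \<bar>u s\<bar>) * \<delta>"
        using ab(4)[OF t] K(2) by (intro mult_left_mono) auto
      finally show ?thesis using y by simp
    qed
    have "\<bar>u s - u y\<bar> \<le> (K * \<bar>u s\<bar> * \<delta>) * \<bar>s - y\<bar>"
    proof -
      have "(u has_real_derivative u' z) (at z within {a..b})" if "z \<in> {a..b}" for z
        by (rule DERIV_subset[OF d ab(3)]) (use that ab(3) in auto)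
      then show ?thesis
        using field_differentiable_bound[of "{a..b}" u u' "K * \<bar>u s\<bar> * \<delta>" s y] u'b s(1) ab(1)
        by auto
    qed
    also have "\<dots> \<le> (K * \<bar>u s\<bar> * \<delta>) * \<delta>"
      using ab(4)[OF s(1)] K(2) \<delta>(1) by (intro mult_left_mono) auto
    finally have "\<bar>u s\<bar> * (1 - K * \<delta>\<^sup>2) \<le> 0"
      using y by (simp add: power2_eq_square algebra_simps)
    then have "\<bar>u s\<bar> \<le> 0" using \<delta>(2) by (simp add: mult_le_0_iff)
    then show ?thesis using s(2)[OF ab(2)] u'b[OF ab(2)] by auto
  qed
  \<comment> \<open>The zero Cauchy data at \<open>x0\<close> are propagated in steps of length at
    most \<open>\<delta>\<close>; finitely many steps cover the interval.\<close>
  have "\<forall>x\<in>{0..L}. \<bar>x - x0\<bar> \<le> real n * \<delta> \<longrightarrow> u x = 0 \<and> u' x = 0" for n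
  proof (induction n)
    case 0 then show ?case using x0 by auto
  next
    case (Suc n)
    show ?case
    proof (intro ballI impI)
      fix x assume x: "x \<in> {0..L}" "\<bar>x - x0\<bar> \<le> real (Suc n) * \<delta>"
      \<comment> \<open>The point dividing the segment from \<open>x0\<close> to \<open>x\<close> in
        the ratio \<open>n\<close> to 1: it is within \<open>n * \<delta>\<close> of
        \<open>x0\<close> and within \<open>\<delta>\<close> of \<open>x\<close>, and convexity
        keeps it in the interval.\<close>
      define y where "y = x0 + (x - x0) * (n / Suc n)"
      have "(1 - n / Suc n) *\<^sub>R x0 + (n / Suc n) *\<^sub>R x \<in> {0..L}"
        by (rule convexD_alt) (use x x0(1) in auto)
      also have "(1 - n / Suc n) *\<^sub>R x0 + (n / Suc n) *\<^sub>R x = y"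
        unfolding y_def scaleR_conv_of_real of_real_eq_id id_def by algebra
      finally have 1: "y \<in> {0..L}" .
      have "\<bar>y - x0\<bar> = \<bar>x - x0\<bar> * (n / Suc n)" by (simp add: y_def abs_mult)
      also have "\<dots> \<le> real (Suc n) * \<delta> * (n / Suc n)"
        using x by (intro mult_right_mono) auto
      finally have 2: "\<bar>y - x0\<bar> \<le> n * \<delta>" by (simp add: mult.commute)
      have "x - y = (x - x0) / Suc n" by (simp add: y_def field_simps)
      then have 3: "\<bar>x - y\<bar> \<le> \<delta>" using x(2) by (simp add: abs_divide divide_le_eq mult.commute)
      show "u x = 0 \<and> u' x = 0"
        using step[of y x] Suc 1 2 3 x(1) by auto
    qed
  qed
  moreover obtain n where "\<bar>x - x0\<bar> / \<delta> \<le> real n" using real_arch_simple by blast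
  ultimately show ?thesis using x \<delta>(1) by (auto simp: divide_le_eq)
qed

section \<open>Energy estimates for C1 functions on an interval\<close>

lemma C1_increment_square_le:
  fixes u u' :: "real \<Rightarrow> real"
  assumes u': "continuous_on {a..b} u'"
    and d: "\<And>x. x \<in> {a..b} \<Longrightarrow> (u has_real_derivative u' x) (at x within {a..b})"
    and xy: "x \<in> {a..b}" "y \<in> {a..b}"
  shows "(u y - u x)\<^sup>2 \<le> \<bar>y - x\<bar> * (LINT t|lebesgue_on {a..b}. u' t * u' t)"
proof -
  have *: "(u y - u x)\<^sup>2 \<le> \<bar>y - x\<bar> * (LINT t|lebesgue_on {a..b}. u' t * u' t)"
    if xy: "a \<le> x" "x < y" "y \<le> b" for x y
  proof -
    define m where "m = (u y - u x) / (y - x)"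
    have sub: "{x..y} \<subseteq> {a..b}" using xy by auto
    note c = continuous_on_subset[OF u' sub]
    have i1: "(LINT t|lebesgue_on {x..y}. u' t) = m * (y - x)"
      unfolding m_def using xy
      by (subst integral_lebesgue_on_FTC[where F = u]) (auto intro: DERIV_subset[OF d] c)
    \<comment> \<open>Cauchy-Schwarz in the guise of a variance: \<open>m\<close> is the mean of
      \<open>u'\<close> on the interval, and the integral of the squared deviation from the mean is
      non-negative.\<close>
    have "0 \<le> (LINT t|lebesgue_on {x..y}. (u' t - m)\<^sup>2)" by simp
    also have "\<dots> = (LINT t|lebesgue_on {x..y}. u' t * u' t - (2 * m * u' t - m\<^sup>2))"
      by (simp add: power2_eq_square algebra_simps)
    also have "\<dots> = (LINT t|lebesgue_on {x..y}. u' t * u' t) - (LINT t|lebesgue_on {x..y}. 2 * m * u' t - m\<^sup>2)"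
      by (intro Bochner_Integration.integral_diff continuous_imp_integrable_real continuous_intros c)
    also have "(LINT t|lebesgue_on {x..y}. 2 * m * u' t - m\<^sup>2) =
        (LINT t|lebesgue_on {x..y}. 2 * m * u' t) - (LINT t|lebesgue_on {x..y}. m\<^sup>2)"
      by (intro Bochner_Integration.integral_diff continuous_imp_integrable_real continuous_intros c)
    also have "(LINT t|lebesgue_on {x..y}. 2 * m * u' t) - (LINT t|lebesgue_on {x..y}. m\<^sup>2) = m\<^sup>2 * (y - x)"
      using xy by (simp add: i1 measure_restrict_space power2_eq_square algebra_simps)
    finally have "m\<^sup>2 * (y - x) \<le> (LINT t|lebesgue_on {x..y}. u' t * u' t)" by simp
    also have "\<dots> \<le> (LINT t|lebesgue_on {a..b}. u' t * u' t)"
    proof -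
      have int: "integrable (lebesgue_on {a..b}) (\<lambda>t. u' t * u' t)"
        by (intro continuous_imp_integrable_real continuous_intros u')
      have "(LINT t|lebesgue_on {a..b}. u' t * u' t) =
          (LINT t|lebesgue_on {a..x}. u' t * u' t) + (LINT t|lebesgue_on {x..b}. u' t * u' t)"
        by (rule integral_lebesgue_on_combine[OF _ _ int]) (use xy in auto)
      moreover have "(LINT t|lebesgue_on {x..b}. u' t * u' t) =
          (LINT t|lebesgue_on {x..y}. u' t * u' t) + (LINT t|lebesgue_on {y..b}. u' t * u' t)"
        by (rule integral_lebesgue_on_combine)
          (use xy in \<open>auto intro: Equivalence_Lebesgue_Henstock_Integration.integrable_subinterval[OF int]\<close>)
      moreover have "0 \<le> (LINT t|lebesgue_on {a..x}. u' t * u' t)" "0 \<le> (LINT t|lebesgue_on {y..b}. u' t * u' t)"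
        by simp_all
      ultimately show ?thesis by linarith
    qed
    finally have "(y - x) * (m\<^sup>2 * (y - x)) \<le> (y - x) * (LINT t|lebesgue_on {a..b}. u' t * u' t)"
      using xy by (intro mult_left_mono) auto
    moreover have "(y - x) * (m\<^sup>2 * (y - x)) = (u y - u x)\<^sup>2"
      using xy by (simp add: m_def power_divide power2_eq_square)
    ultimately show ?thesis using xy by simp
  qed
  show ?thesis
    using *[of x y] *[of y x] xy
    by (cases x y rule: linorder_cases) (auto simp: power2_commute abs_minus_commute)
qed

text \<open>The bound \<open>(u x)\<^sup>2 \<le> 2 * (u y)\<^sup>2 + 2 * (u x - u y)\<^sup>2\<close>
  is averaged over \<open>y\<close>, and the increment is controlled by the energy. It supplies the
  uniform bound needed for Arzela-Ascoli, as the preceding lemma supplies the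
  equicontinuity.\<close>

lemma C1_square_le:
  fixes u u' :: "real \<Rightarrow> real"
  assumes L: "0 < L" and u': "continuous_on {0..L} u'"
    and d: "\<And>x. x \<in> {0..L} \<Longrightarrow> (u has_real_derivative u' x) (at x within {0..L})"
    and x: "x \<in> {0..L}"
  shows "(u x)\<^sup>2 \<le> 2 / L * (LINT t|lebesgue_on {0..L}. u t * u t) +
    2 * L * (LINT t|lebesgue_on {0..L}. u' t * u' t)"
proof -
  define D where "D = (LINT t|lebesgue_on {0..L}. u' t * u' t)"
  have D: "D \<ge> 0" by (simp add: D_def)
  note c = C1_continuous[OF d]
  have "(LINT y|lebesgue_on {0..L}. (u x)\<^sup>2) \<le> (LINT y|lebesgue_on {0..L}. 2 * (u y * u y) + 2 * L * D)"
  proof (rule integral_mono)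
    fix y assume "y \<in> space (lebesgue_on {0..L})"
    then have y: "y \<in> {0..L}" by simp
    have "(u x)\<^sup>2 \<le> 2 * (u y)\<^sup>2 + 2 * (u x - u y)\<^sup>2"
      using sum_squares_bound[of "2 * u y" "u x"] zero_le_power2[of "u x - 2 * u y"]
      by (simp add: power2_eq_square algebra_simps)
    also have "(u x - u y)\<^sup>2 \<le> \<bar>x - y\<bar> * D"
      unfolding D_def by (rule C1_increment_square_le[OF u' d y x])
    also have "\<dots> \<le> L * D" using x y D by (intro mult_right_mono) auto
    finally show "(u x)\<^sup>2 \<le> 2 * (u y * u y) + 2 * L * D" by (simp add: power2_eq_square)
  qed (intro continuous_imp_integrable_real continuous_intros c)+
  also have "\<dots> = (LINT y|lebesgue_on {0..L}. 2 * (u y * u y)) + (LINT y|lebesgue_on {0..L}. 2 * L * D)"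
    by (intro Bochner_Integration.integral_add continuous_imp_integrable_real continuous_intros c)
  also have "(LINT y|lebesgue_on {0..L}. 2 * (u y * u y)) = 2 * (LINT y|lebesgue_on {0..L}. u y * u y)"
    by (rule Bochner_Integration.integral_mult_right_zero)
  finally have "L * (u x)\<^sup>2 \<le> 2 * (LINT y|lebesgue_on {0..L}. u y * u y) + 2 * L\<^sup>2 * D"
    using L by (simp add: measure_restrict_space power2_eq_square mult_ac)
  then show ?thesis
    using L unfolding D_def[symmetric] by (simp add: field_simps power2_eq_square)
qed

section \<open>Bilinear forms on real function spaces\<close>

text \<open>Pointwise operations make edgewise functions, which are curried in edge and coordinate,
  real vectors, so that \<open>subspace\<close> and \<open>span\<close> apply to them. The complex
  structure is kept apart in \<open>cfun\<close>.\<close>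

instantiation "fun" :: (type, real_vector) real_vector
begin

definition "c *\<^sub>R f = (\<lambda>x. c *\<^sub>R f x)"

instance
  by standard (simp_all add: scaleR_fun_def fun_eq_iff scaleR_add_right scaleR_add_left)

end

lemma scaleR_fun_apply [simp]: "(c *\<^sub>R f) x = c *\<^sub>R f x"
  by (simp add: scaleR_fun_def)

text \<open>Bilinearity is required only on \<open>V\<close>, because an expression involving
  derivatives is additive only for differentiable functions. No sign is assumed: potentials and
  perturbations may be negative.\<close>

locale sym_form =
  fixes V :: "'a::real_vector set" and b :: "'a \<Rightarrow> 'a \<Rightarrow> real"
  assumes subspace_V: "subspace V"
    and comm: "u \<in> V \<Longrightarrow> v \<in> V \<Longrightarrow> b u v = b v u"
    and add_left: "u \<in> V \<Longrightarrow> v \<in> V \<Longrightarrow> w \<in> V \<Longrightarrow> b (u + v) w = b u w + b v w"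
    and scale_left: "u \<in> V \<Longrightarrow> w \<in> V \<Longrightarrow> b (c *\<^sub>R u) w = c * b u w"
begin

lemma add_in: "u \<in> V \<Longrightarrow> v \<in> V \<Longrightarrow> u + v \<in> V"
  and scale_in: "u \<in> V \<Longrightarrow> c *\<^sub>R u \<in> V"
  and diff_in: "u \<in> V \<Longrightarrow> v \<in> V \<Longrightarrow> u - v \<in> V"
  and sum_in: "(\<And>i. i \<in> I \<Longrightarrow> f i \<in> V) \<Longrightarrow> sum f I \<in> V"
  and zero_in: "0 \<in> V"
  using subspace_V by (auto intro: subspace_add subspace_scale subspace_diff subspace_sum subspace_0)

lemma add_right: "u \<in> V \<Longrightarrow> v \<in> V \<Longrightarrow> w \<in> V \<Longrightarrow> b w (u + v) = b w u + b w v"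
  using comm add_left add_in by metis

lemma scale_right: "u \<in> V \<Longrightarrow> w \<in> V \<Longrightarrow> b w (c *\<^sub>R u) = c * b w u"
  using comm scale_left scale_in by metis

lemma diff_left: "u \<in> V \<Longrightarrow> v \<in> V \<Longrightarrow> w \<in> V \<Longrightarrow> b (u - v) w = b u w - b v w"
  using add_left[of u "(-1) *\<^sub>R v" w] scale_left[of v w "-1"] scale_in[of v "-1"] by simp

lemma diff_right: "u \<in> V \<Longrightarrow> v \<in> V \<Longrightarrow> w \<in> V \<Longrightarrow> b w (u - v) = b w u - b w v"
  using comm diff_left diff_in by metis

lemma zero_left: "w \<in> V \<Longrightarrow> b 0 w = 0"
  using scale_left[of 0 w 0] zero_in by simp

lemma zero_right: "w \<in> V \<Longrightarrow> b w 0 = 0"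
  using comm zero_left zero_in by metis

lemma sum_left:
  assumes "\<And>i. i \<in> I \<Longrightarrow> f i \<in> V" "w \<in> V"
  shows "b (\<Sum>i\<in>I. f i) w = (\<Sum>i\<in>I. b (f i) w)"
  using assms(1)
  by (induction I rule: infinite_finite_induct) (auto simp: zero_left add_left sum_in assms(2))

lemma square_combination:
  assumes "u \<in> V" "v \<in> V"
  shows "b (s *\<^sub>R u + t *\<^sub>R v) (s *\<^sub>R u + t *\<^sub>R v) = s\<^sup>2 * b u u + 2 * s * t * b u v + t\<^sup>2 * b v v"
proof -
  have "b (s *\<^sub>R u + t *\<^sub>R v) (s *\<^sub>R u + t *\<^sub>R v) =
      s * (s * b u u) + s * (t * b v u) + (t * (s * b u v) + t * (t * b v v))"
    using assms by (simp add: add_left add_right scale_left scale_right add_in scale_in algebra_simps)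
  then show ?thesis using comm[OF assms] by (simp add: power2_eq_square algebra_simps)
qed

lemma square_add:
  assumes "u \<in> V" "v \<in> V"
  shows "b (u + v) (u + v) = b u u + 2 * b u v + b v v"
  using square_combination[OF assms, of 1 1] by simp

text \<open>Semidefiniteness is asked only on \<open>W\<close>, since \<open>qform G q\<close> minus
  a multiple of \<open>ip G\<close> is in general non-negative only on an orthogonal complement. The
  form may degenerate there, so vectors with \<open>b v v = 0\<close> need their own
  argument.\<close>

lemma cauchy_schwarz:
  assumes "subspace W" "W \<subseteq> V" "\<And>w. w \<in> W \<Longrightarrow> 0 \<le> b w w" "u \<in> W" "v \<in> W"
  shows "(b u v)\<^sup>2 \<le> b u u * b v v"
proof -
  have uv: "u \<in> V" "v \<in> V" using assms by auto
  have nn: "0 \<le> s\<^sup>2 * b u u + 2 * s * t * b u v + t\<^sup>2 * b v v" for s t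
    using assms(3)[of "s *\<^sub>R u + t *\<^sub>R v"] square_combination[OF uv] assms
    by (simp add: subspace_add subspace_scale)
  show ?thesis
  proof (cases "b v v = 0")
    case False
    then have "b v v > 0" using assms(3)[OF assms(5)] by simp
    \<comment> \<open>The form is evaluated at \<open>b v v\<close> times \<open>u\<close> minus
      \<open>b u v\<close> times \<open>v\<close>, a multiple of the component of \<open>u\<close>
      that is orthogonal to \<open>v\<close> with respect to \<open>b\<close>.\<close>
    have "0 \<le> (b v v)\<^sup>2 * b u u - b v v * (b u v)\<^sup>2"
      using nn[of "b v v" "- b u v"] by (simp add: power2_eq_square algebra_simps)
    then have "0 \<le> b v v * (b u u * b v v - (b u v)\<^sup>2)"
      by (simp add: power2_eq_square algebra_simps)
    with \<open>b v v > 0\<close> show ?thesis by (simp add: zero_le_mult_iff)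
  next
    case True
    have "b u v = 0"
    proof (rule ccontr)
      assume "b u v \<noteq> 0"
      have "0 \<le> b u u + 2 * t * b u v" for t using nn[of 1 t] True by simp
      \<comment> \<open>For this \<open>t\<close> the expression equals -1.\<close>
      from this[of "- (b u u + 1) / (2 * b u v)"] \<open>b u v \<noteq> 0\<close> show False by (simp add: field_simps)
    qed
    then show ?thesis using True by simp
  qed
qed

end

lemma sym_form_combination:
  assumes "sym_form V b" "sym_form V c"
  shows "sym_form V (\<lambda>u v. b u v + r * c u v)"
proof -
  interpret b: sym_form V b by fact
  interpret c: sym_form V c by fact
  show ?thesis
  proof
    show "subspace V" by (rule b.subspace_V)
    show "b u v + r * c u v = b v u + r * c v u" if "u \<in> V" "v \<in> V" for u v
      using b.comm[OF that] c.comm[OF that] by simp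
    show "b (u + v) w + r * c (u + v) w = b u w + r * c u w + (b v w + r * c v w)"
      if "u \<in> V" "v \<in> V" "w \<in> V" for u v w
      using b.add_left[OF that] c.add_left[OF that] by (simp add: algebra_simps)
    show "b (k *\<^sub>R u) w + r * c (k *\<^sub>R u) w = k * (b u w + r * c u w)"
      if "u \<in> V" "w \<in> V" for u w k
      using b.scale_left[OF that] c.scale_left[OF that] by (simp add: algebra_simps)
  qed
qed

section \<open>Integration on a graph\<close>

lemma Linfty_iff: "q \<in> Linfty G \<longleftrightarrow> (\<forall>e\<in>edges G. ess_bounded 0 (len G e) (q e))"
  by (simp add: Linfty_def ess_bounded_def)

lemma Linfty_D: "q \<in> Linfty G \<Longrightarrow> e \<in> edges G \<Longrightarrow> ess_bounded 0 (len G e) (q e)"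
  by (simp add: Linfty_iff)

lemma Linfty_mult: "f \<in> Linfty G \<Longrightarrow> g \<in> Linfty G \<Longrightarrow> (\<lambda>e x. f e x * g e x) \<in> Linfty G"
  and Linfty_add: "f \<in> Linfty G \<Longrightarrow> g \<in> Linfty G \<Longrightarrow> (\<lambda>e x. f e x + g e x) \<in> Linfty G"
  and Linfty_diff: "f \<in> Linfty G \<Longrightarrow> g \<in> Linfty G \<Longrightarrow> (\<lambda>e x. f e x - g e x) \<in> Linfty G"
  and Linfty_const: "(\<lambda>e x. c) \<in> Linfty G"
  by (auto simp: Linfty_iff intro!: ess_bounded_intros)

lemma Linfty_cmult: "f \<in> Linfty G \<Longrightarrow> (\<lambda>e x. c * f e x) \<in> Linfty G"
  by (intro Linfty_mult Linfty_const)

lemma Linfty_uminus: "f \<in> Linfty G \<Longrightarrow> (\<lambda>e x. - f e x) \<in> Linfty G"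
  using Linfty_cmult[of f G "-1"] by simp

lemmas Linfty_intros = Linfty_mult Linfty_add Linfty_diff Linfty_const Linfty_uminus

lemma graph_integral_add:
  "f \<in> Linfty G \<Longrightarrow> g \<in> Linfty G \<Longrightarrow>
    graph_integral G (\<lambda>e x. f e x + g e x) = graph_integral G f + graph_integral G g"
  unfolding graph_integral_def sum.distrib[symmetric]
  by (intro sum.cong refl Bochner_Integration.integral_add integrable_ess_bounded Linfty_D)

lemma graph_integral_diff:
  "f \<in> Linfty G \<Longrightarrow> g \<in> Linfty G \<Longrightarrow>
    graph_integral G (\<lambda>e x. f e x - g e x) = graph_integral G f - graph_integral G g"
  unfolding graph_integral_def sum_subtractf[symmetric]
  by (intro sum.cong refl Bochner_Integration.integral_diff integrable_ess_bounded Linfty_D)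

lemma graph_integral_cmult: "graph_integral G (\<lambda>e x. c * f e x) = c * graph_integral G f"
  by (simp add: graph_integral_def sum_distrib_left)

lemma graph_integral_cong:
  "(\<And>e x. e \<in> edges G \<Longrightarrow> x \<in> {0..len G e} \<Longrightarrow> f e x = g e x) \<Longrightarrow>
    graph_integral G f = graph_integral G g"
  unfolding graph_integral_def by (intro sum.cong refl Bochner_Integration.integral_cong) auto

lemma graph_integral_mono_AE:
  assumes "f \<in> Linfty G" "g \<in> Linfty G"
    and "\<And>e. e \<in> edges G \<Longrightarrow> AE x in lebesgue_on {0..len G e}. f e x \<le> g e x"
  shows "graph_integral G f \<le> graph_integral G g"
  unfolding graph_integral_def
  by (intro sum_mono integral_mono_AE integrable_ess_bounded Linfty_D assms)

lemma graph_integral_nonneg: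
  assumes "\<And>e x. e \<in> edges G \<Longrightarrow> x \<in> {0..len G e} \<Longrightarrow> 0 \<le> f e x"
  shows "0 \<le> graph_integral G f"
  unfolding graph_integral_def
  by (intro sum_nonneg Bochner_Integration.integral_nonneg) (use assms in auto)

lemma edge_integral_le_graph_integral:
  assumes "finite (edges G)" "e \<in> edges G"
    and "\<And>e x. e \<in> edges G \<Longrightarrow> x \<in> {0..len G e} \<Longrightarrow> 0 \<le> f e x"
  shows "(LINT x|lebesgue_on {0..len G e}. f e x) \<le> graph_integral G f"
  unfolding graph_integral_def
  by (intro member_le_sum Bochner_Integration.integral_nonneg) (use assms in auto)

section \<open>The quadratic form\<close>

definition ederiv :: "'e metric_graph \<Rightarrow> ('e \<Rightarrow> real \<Rightarrow> real) \<Rightarrow> 'e \<Rightarrow> real \<Rightarrow> real" where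
  "ederiv G u e x = vector_derivative (u e) (at x within {0..len G e})"

definition end_val :: "'e metric_graph \<Rightarrow> ('e \<Rightarrow> real \<Rightarrow> real) \<Rightarrow> 'e \<times> bool \<Rightarrow> real" where
  "end_val G u a = u (fst a) (if snd a then len G (fst a) else 0)"

definition end_slope :: "'e metric_graph \<Rightarrow> ('e \<Rightarrow> real \<Rightarrow> real) \<Rightarrow> 'e \<times> bool \<Rightarrow> real" where
  "end_slope G u' a = (if snd a then - u' (fst a) (len G (fst a)) else u' (fst a) 0)"

text \<open>Every eigenfunction is edgewise \<open>C\<^sup>1\<close>, so the variational arguments can be carried out on this
  space instead of the full form domain \<open>H\<^sup>1(G)\<close>.\<close>

definition C1_functions :: "'e metric_graph \<Rightarrow> ('e \<Rightarrow> real \<Rightarrow> real) set" where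
  "C1_functions G = {u. (\<forall>e x. (e, x) \<notin> edge_points G \<longrightarrow> u e x = 0) \<and>
     (\<forall>e\<in>edges G. \<exists>d. continuous_on {0..len G e} d \<and>
        (\<forall>x\<in>{0..len G e}. (u e has_real_derivative d x) (at x within {0..len G e}))) \<and>
     (\<forall>v\<in>verts G. \<forall>a\<in>v. \<forall>b\<in>v. end_val G u a = end_val G u b)}"

definition weighted_ip ::
  "'e metric_graph \<Rightarrow> ('e \<Rightarrow> real \<Rightarrow> real) \<Rightarrow> ('e \<Rightarrow> real \<Rightarrow> real) \<Rightarrow> ('e \<Rightarrow> real \<Rightarrow> real) \<Rightarrow> real" where
  "weighted_ip G P u v = graph_integral G (\<lambda>e x. P e x * (u e x * v e x))"

definition ip :: "'e metric_graph \<Rightarrow> ('e \<Rightarrow> real \<Rightarrow> real) \<Rightarrow> ('e \<Rightarrow> real \<Rightarrow> real) \<Rightarrow> real" where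
  "ip G u v = graph_integral G (\<lambda>e x. u e x * v e x)"

definition dirichlet :: "'e metric_graph \<Rightarrow> ('e \<Rightarrow> real \<Rightarrow> real) \<Rightarrow> ('e \<Rightarrow> real \<Rightarrow> real) \<Rightarrow> real" where
  "dirichlet G u v = graph_integral G (\<lambda>e x. ederiv G u e x * ederiv G v e x)"

text \<open>This is the form of \<open>H\<close> after integration by parts. Only continuity at the
  vertices is built into its domain; the Kirchhoff condition is the natural boundary condition and
  is recovered from the weak equation.\<close>

definition qform ::
  "'e metric_graph \<Rightarrow> ('e \<Rightarrow> real \<Rightarrow> real) \<Rightarrow> ('e \<Rightarrow> real \<Rightarrow> real) \<Rightarrow> ('e \<Rightarrow> real \<Rightarrow> real) \<Rightarrow> real" where
  "qform G q u v = dirichlet G u v + weighted_ip G q u v"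

locale compact_graph =
  fixes G :: "'e metric_graph"
  assumes compact_metric_graph: "compact_metric_graph G"
begin

abbreviation "V \<equiv> C1_functions G"

lemma finite_edges: "finite (edges G)"
  and len_pos: "e \<in> edges G \<Longrightarrow> 0 < len G e"
  and partition_verts: "partition_on (edges G \<times> UNIV) (verts G)"
  using compact_metric_graph by (auto simp: compact_metric_graph_def)

text \<open>The vertices partition the set of edge ends. Regrouping in this way turns the boundary
  terms of edgewise integrations by parts into sums at single vertices, where the Kirchhoff
  condition lives; loops contribute both of their ends to one vertex.\<close>

lemma sum_over_ends:
  fixes f :: "'e \<times> bool \<Rightarrow> real"
  shows "(\<Sum>e\<in>edges G. f (e, True) + f (e, False)) = (\<Sum>v\<in>verts G. \<Sum>a\<in>v. f a)"
proof -
  have fin: "finite (edges G \<times> (UNIV :: bool set))" using finite_edges by simp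
  have "(\<Sum>v\<in>verts G. \<Sum>a\<in>v. f a) = sum f (\<Union>(verts G))"
  proof (subst sum.Union_disjoint)
    show "\<forall>A\<in>verts G. finite A"
      using partition_verts fin by (auto simp: partition_on_def intro: finite_subset)
    show "\<forall>A\<in>verts G. \<forall>B\<in>verts G. A \<noteq> B \<longrightarrow> A \<inter> B = {}"
      using partition_verts by (auto simp: partition_on_def disjoint_def)
  qed simp
  also have "\<Union>(verts G) = edges G \<times> UNIV"
    using partition_verts by (simp add: partition_on_def)
  also have "sum f (edges G \<times> UNIV) = (\<Sum>e\<in>edges G. \<Sum>s\<in>UNIV. f (e, s))"
    by (simp add: sum.cartesian_product)
  finally show ?thesis by (simp add: UNIV_bool add.commute)
qed

lemma ederiv_eqI:
  assumes "e \<in> edges G" "x \<in> {0..len G e}"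
    and "(u e has_real_derivative d) (at x within {0..len G e})"
  shows "ederiv G u e x = d"
  unfolding ederiv_def
  by (rule vector_derivative_within_closed_interval)
    (use assms len_pos in \<open>auto simp: has_real_derivative_iff_has_vector_derivative\<close>)

lemma C1_ederiv:
  assumes "u \<in> V" "e \<in> edges G" "x \<in> {0..len G e}"
  shows "(u e has_real_derivative ederiv G u e x) (at x within {0..len G e})"
proof -
  obtain d where "(u e has_real_derivative d x) (at x within {0..len G e})"
    using assms unfolding C1_functions_def by blast
  then show ?thesis using ederiv_eqI[OF assms(2,3)] by simp
qed

lemma C1_ederiv_continuous:
  assumes "u \<in> V" "e \<in> edges G"
  shows "continuous_on {0..len G e} (ederiv G u e)"
proof -
  obtain d where d: "continuous_on {0..len G e} d"
      "\<forall>x\<in>{0..len G e}. (u e has_real_derivative d x) (at x within {0..len G e})"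
    using assms unfolding C1_functions_def by blast
  then show ?thesis
    by (subst continuous_on_cong[OF refl, of _ _ d]) (auto intro: ederiv_eqI[OF assms(2)])
qed

lemma C1_continuous_edge:
  assumes "u \<in> V" "e \<in> edges G"
  shows "continuous_on {0..len G e} (u e)"
  by (rule C1_continuous[OF C1_ederiv[OF assms]])

lemma C1_zero: "u \<in> V \<Longrightarrow> (e, x) \<notin> edge_points G \<Longrightarrow> u e x = 0"
  and C1_vertex: "u \<in> V \<Longrightarrow> v \<in> verts G \<Longrightarrow> a \<in> v \<Longrightarrow> b \<in> v \<Longrightarrow> end_val G u a = end_val G u b"
  unfolding C1_functions_def by blast+

lemma C1_I:
  assumes "\<And>e x. (e, x) \<notin> edge_points G \<Longrightarrow> u e x = 0"
    and "\<And>e. e \<in> edges G \<Longrightarrow> continuous_on {0..len G e} (u' e)"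
    and "\<And>e x. e \<in> edges G \<Longrightarrow> x \<in> {0..len G e} \<Longrightarrow>
      (u e has_real_derivative u' e x) (at x within {0..len G e})"
    and "\<And>v a b. v \<in> verts G \<Longrightarrow> a \<in> v \<Longrightarrow> b \<in> v \<Longrightarrow> end_val G u a = end_val G u b"
  shows "u \<in> V"
  unfolding C1_functions_def mem_Collect_eq
proof (intro conjI allI impI ballI)
  fix e assume "e \<in> edges G"
  then show "\<exists>d. continuous_on {0..len G e} d \<and>
      (\<forall>x\<in>{0..len G e}. (u e has_real_derivative d x) (at x within {0..len G e}))"
    using assms(2,3) by blast
qed (rule assms; assumption)+

lemma C1_Linfty: "u \<in> V \<Longrightarrow> u \<in> Linfty G"
  and ederiv_Linfty: "u \<in> V \<Longrightarrow> ederiv G u \<in> Linfty G"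
  by (auto simp: Linfty_iff intro!: ess_bounded_continuous C1_continuous_edge C1_ederiv_continuous)

lemma end_val_add: "end_val G (u + v) a = end_val G u a + end_val G v a"
  and end_val_scale: "end_val G (c *\<^sub>R u) a = c * end_val G u a"
  by (auto simp: end_val_def)

lemma subspace_C1: "subspace V"
proof (rule subspaceI)
  show "0 \<in> V" by (rule C1_I[where u' = "\<lambda>_ _. 0"]) (auto simp: zero_fun_def end_val_def)
next
  fix u v assume uv: "u \<in> V" "v \<in> V"
  show "u + v \<in> V"
  proof (rule C1_I[where u' = "\<lambda>e x. ederiv G u e x + ederiv G v e x"])
    fix e x assume e: "e \<in> edges G" "x \<in> {0..len G e}"
    show "((u + v) e has_real_derivative ederiv G u e x + ederiv G v e x) (at x within {0..len G e})"
      unfolding plus_fun_def by (intro DERIV_add C1_ederiv uv e)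
  next
    fix vt a b assume "vt \<in> verts G" "a \<in> vt" "b \<in> vt"
    then show "end_val G (u + v) a = end_val G (u + v) b"
      using C1_vertex[OF uv(1)] C1_vertex[OF uv(2)] unfolding end_val_add by (intro arg_cong2[of _ _ _ _ "(+)"])
  next
    fix e assume "e \<in> edges G"
    then show "continuous_on {0..len G e} (\<lambda>x. ederiv G u e x + ederiv G v e x)"
      by (intro continuous_on_add C1_ederiv_continuous uv)
  qed (simp add: C1_zero[OF uv(1)] C1_zero[OF uv(2)])
next
  fix u and c :: real assume u: "u \<in> V"
  show "c *\<^sub>R u \<in> V"
  proof (rule C1_I[where u' = "\<lambda>e x. c * ederiv G u e x"])
    fix e x assume e: "e \<in> edges G" "x \<in> {0..len G e}"
    show "((c *\<^sub>R u) e has_real_derivative c * ederiv G u e x) (at x within {0..len G e})"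
      unfolding scaleR_fun_def real_scaleR_def by (intro DERIV_cmult C1_ederiv u e)
  next
    fix vt a b assume "vt \<in> verts G" "a \<in> vt" "b \<in> vt"
    then show "end_val G (c *\<^sub>R u) a = end_val G (c *\<^sub>R u) b"
      using C1_vertex[OF u] unfolding end_val_scale by (intro arg_cong[of _ _ "(*) c"])
  next
    fix e assume "e \<in> edges G"
    then show "continuous_on {0..len G e} (\<lambda>x. c * ederiv G u e x)"
      by (intro continuous_on_mult_left C1_ederiv_continuous u)
  qed (simp add: C1_zero[OF u])
qed

lemma ederiv_add:
  assumes "u \<in> V" "v \<in> V" "e \<in> edges G" "x \<in> {0..len G e}"
  shows "ederiv G (u + v) e x = ederiv G u e x + ederiv G v e x"
proof (rule ederiv_eqI[OF assms(3,4)])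
  show "((u + v) e has_real_derivative ederiv G u e x + ederiv G v e x) (at x within {0..len G e})"
    unfolding plus_fun_def by (intro DERIV_add C1_ederiv assms)
qed

lemma ederiv_scale:
  assumes "u \<in> V" "e \<in> edges G" "x \<in> {0..len G e}"
  shows "ederiv G (c *\<^sub>R u) e x = c * ederiv G u e x"
proof (rule ederiv_eqI[OF assms(2,3)])
  show "((c *\<^sub>R u) e has_real_derivative c * ederiv G u e x) (at x within {0..len G e})"
    unfolding scaleR_fun_def real_scaleR_def by (intro DERIV_cmult C1_ederiv assms)
qed

lemma sym_form_weighted_ip:
  assumes "P \<in> Linfty G"
  shows "sym_form V (weighted_ip G P)"
proof
  show "subspace V" by (rule subspace_C1)
next
  fix u v show "weighted_ip G P u v = weighted_ip G P v u"
    by (simp add: weighted_ip_def mult.commute)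
next
  fix u v w assume uvw: "u \<in> V" "v \<in> V" "w \<in> V"
  have "weighted_ip G P (u + v) w = graph_integral G (\<lambda>e x. P e x * (u e x * w e x) + P e x * (v e x * w e x))"
    unfolding weighted_ip_def by (rule graph_integral_cong) (simp add: algebra_simps)
  also have "\<dots> = weighted_ip G P u w + weighted_ip G P v w"
    unfolding weighted_ip_def by (intro graph_integral_add Linfty_mult assms C1_Linfty uvw)
  finally show "weighted_ip G P (u + v) w = weighted_ip G P u w + weighted_ip G P v w" .
next
  fix u w :: "'e \<Rightarrow> real \<Rightarrow> real" and c
  show "weighted_ip G P (c *\<^sub>R u) w = c * weighted_ip G P u w"
    unfolding weighted_ip_def graph_integral_cmult[symmetric] by (simp add: algebra_simps)
qed

lemma ip_eq: "ip G = weighted_ip G (\<lambda>_ _. 1)"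
  unfolding ip_def[abs_def] weighted_ip_def[abs_def] by simp

lemma sym_form_ip: "sym_form V (ip G)"
  unfolding ip_eq by (rule sym_form_weighted_ip[OF Linfty_const])

lemma sym_form_dirichlet: "sym_form V (dirichlet G)"
proof
  show "subspace V" by (rule subspace_C1)
next
  fix u v show "dirichlet G u v = dirichlet G v u"
    by (simp add: dirichlet_def mult.commute)
next
  fix u v w assume uvw: "u \<in> V" "v \<in> V" "w \<in> V"
  have "dirichlet G (u + v) w = graph_integral G (\<lambda>e x. ederiv G u e x * ederiv G w e x + ederiv G v e x * ederiv G w e x)"
    unfolding dirichlet_def by (rule graph_integral_cong) (simp add: uvw ederiv_add algebra_simps)
  also have "\<dots> = dirichlet G u w + dirichlet G v w"
    unfolding dirichlet_def by (intro graph_integral_add Linfty_mult ederiv_Linfty uvw)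
  finally show "dirichlet G (u + v) w = dirichlet G u w + dirichlet G v w" .
next
  fix u w and c assume uw: "u \<in> V" "w \<in> V"
  have "dirichlet G (c *\<^sub>R u) w = graph_integral G (\<lambda>e x. c * (ederiv G u e x * ederiv G w e x))"
    unfolding dirichlet_def by (rule graph_integral_cong) (simp add: uw ederiv_scale)
  then show "dirichlet G (c *\<^sub>R u) w = c * dirichlet G u w"
    by (simp add: dirichlet_def graph_integral_cmult)
qed

lemma sym_form_qform: "q \<in> Linfty G \<Longrightarrow> sym_form V (qform G q)"
  using sym_form_combination[OF sym_form_dirichlet sym_form_weighted_ip[of q], of 1]
  by (simp add: qform_def[abs_def])

lemma ip_nonneg: "0 \<le> ip G u u"
  unfolding ip_def by (rule graph_integral_nonneg) simp

lemma dirichlet_nonneg: "0 \<le> dirichlet G u u"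
  unfolding dirichlet_def by (rule graph_integral_nonneg) simp

text \<open>Continuity on each edge upgrades vanishing almost everywhere to vanishing everywhere,
  and off the graph the functions are 0 by convention. So \<open>ip G\<close> is definite on actual
  functions, without passing to equivalence classes.\<close>

lemma ip_eq_0:
  assumes "u \<in> V" "ip G u u = 0"
  shows "u = 0"
proof (intro ext)
  fix e x
  show "u e x = 0 e x"
  proof (cases "(e, x) \<in> edge_points G")
    case True
    then have e: "e \<in> edges G" "x \<in> {0..len G e}" by (auto simp: edge_points_def)
    have "(LINT x|lebesgue_on {0..len G e}. u e x * u e x) \<le> ip G u u"
      unfolding ip_def by (rule edge_integral_le_graph_integral[OF finite_edges e(1)]) simp
    moreover have "0 \<le> (LINT x|lebesgue_on {0..len G e}. u e x * u e x)" by simp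
    ultimately have "(LINT x|lebesgue_on {0..len G e}. u e x * u e x) = 0" using assms(2) by linarith
    then have "u e x * u e x = 0"
      by (intro integral_continuous_nonneg_eq_0[OF len_pos[OF e(1)], of "\<lambda>x. u e x * u e x"])
        (use e in \<open>auto intro: continuous_on_mult C1_continuous_edge[OF assms(1)]\<close>)
    then show ?thesis by simp
  next
    case False then show ?thesis using C1_zero[OF assms(1)] by simp
  qed
qed

lemma Linfty_bound:
  assumes "P \<in> Linfty G"
  obtains K where "K > 0" "\<And>e. e \<in> edges G \<Longrightarrow> AE x in lebesgue_on {0..len G e}. \<bar>P e x\<bar> \<le> K"
proof -
  have "\<forall>e\<in>edges G. \<exists>B. AE x in lebesgue_on {0..len G e}. \<bar>P e x\<bar> \<le> B"
    using assms by (auto simp: Linfty_def)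
  then obtain B where B: "\<And>e. e \<in> edges G \<Longrightarrow> AE x in lebesgue_on {0..len G e}. \<bar>P e x\<bar> \<le> B e"
    by metis
  \<comment> \<open>Inserting 1 keeps the set nonempty and the bound positive.\<close>
  define K where "K = Max (insert 1 (B ` edges G))"
  have K: "1 \<le> K" "\<And>e. e \<in> edges G \<Longrightarrow> B e \<le> K"
    using finite_edges by (auto simp: K_def)
  have "AE x in lebesgue_on {0..len G e}. \<bar>P e x\<bar> \<le> K" if "e \<in> edges G" for e
    using B[OF that] by eventually_elim (use K(2)[OF that] in auto)
  then show ?thesis using K(1) by (intro that[of K]) auto
qed

text \<open>Young's inequality with a free weight \<open>s\<close>. The perturbation estimates
  choose \<open>s\<close> proportional to the perturbation parameter, which distributes the cross
  term unevenly between the two components.\<close>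

lemma weighted_ip_bound:
  assumes P: "P \<in> Linfty G" and K: "\<And>e. e \<in> edges G \<Longrightarrow> AE x in lebesgue_on {0..len G e}. \<bar>P e x\<bar> \<le> K"
    and u: "u \<in> V" "v \<in> V" and s: "s > 0"
  shows "2 * \<bar>weighted_ip G P u v\<bar> \<le> K * (s * ip G u u + ip G v v / s)"
proof -
  define h where "h = (\<lambda>e x. (K * s) * (u e x * u e x) + (K / s) * (v e x * v e x))"
  have h: "h \<in> Linfty G" unfolding h_def by (intro Linfty_intros C1_Linfty u)
  have gh: "graph_integral G h = K * (s * ip G u u + ip G v v / s)"
  proof -
    have "graph_integral G h = (K * s) * ip G u u + (K / s) * ip G v v"
      unfolding h_def ip_def graph_integral_cmult[symmetric]
      by (intro graph_integral_add Linfty_intros C1_Linfty u)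
    then show ?thesis by (simp add: algebra_simps)
  qed
  have bd: "AE x in lebesgue_on {0..len G e}. \<bar>2 * (P e x * (u e x * v e x))\<bar> \<le> h e x" if "e \<in> edges G" for e
    using K[OF that]
  proof eventually_elim
    case (elim x)
    have "2 * \<bar>u e x * v e x\<bar> \<le> s * (u e x * u e x) + (v e x * v e x) / s"
    proof -
      have "0 \<le> (s * \<bar>u e x\<bar> - \<bar>v e x\<bar>)\<^sup>2 / s" using s by simp
      also have "\<dots> = s * (u e x * u e x) + (v e x * v e x) / s - 2 * \<bar>u e x * v e x\<bar>"
        using s by (simp add: power2_eq_square field_simps abs_mult)
      finally show ?thesis by simp
    qed
    then have "\<bar>P e x\<bar> * (2 * \<bar>u e x * v e x\<bar>) \<le> K * (s * (u e x * u e x) + (v e x * v e x) / s)"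
      using elim by (intro mult_mono) auto
    then show ?case by (simp add: h_def abs_mult algebra_simps)
  qed
  have "graph_integral G (\<lambda>e x. 2 * (P e x * (u e x * v e x))) \<le> graph_integral G h"
  proof (rule graph_integral_mono_AE[OF _ h])
    show "(\<lambda>e x. 2 * (P e x * (u e x * v e x))) \<in> Linfty G"
      by (intro Linfty_cmult Linfty_mult P C1_Linfty u)
    fix e assume "e \<in> edges G"
    from bd[OF this] show "AE x in lebesgue_on {0..len G e}. 2 * (P e x * (u e x * v e x)) \<le> h e x"
      by eventually_elim simp
  qed
  moreover have "graph_integral G (\<lambda>e x. (-2) * (P e x * (u e x * v e x))) \<le> graph_integral G h"
  proof (rule graph_integral_mono_AE[OF _ h])
    show "(\<lambda>e x. (-2) * (P e x * (u e x * v e x))) \<in> Linfty G"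
      by (intro Linfty_cmult Linfty_mult P C1_Linfty u)
    fix e assume "e \<in> edges G"
    from bd[OF this] show "AE x in lebesgue_on {0..len G e}. (-2) * (P e x * (u e x * v e x)) \<le> h e x"
      by eventually_elim simp
  qed
  ultimately show ?thesis
    unfolding graph_integral_cmult gh weighted_ip_def[symmetric] by linarith
qed

lemma weighted_ip_abs_le:
  assumes P: "P \<in> Linfty G" and K: "\<And>e. e \<in> edges G \<Longrightarrow> AE x in lebesgue_on {0..len G e}. \<bar>P e x\<bar> \<le> K"
    and u: "u \<in> V"
  shows "\<bar>weighted_ip G P u u\<bar> \<le> K * ip G u u"
  using weighted_ip_bound[OF P K u u, of 1] by simp

end

section \<open>Real eigenfunctions\<close>

text \<open>The operator acts on complex functions, but potential and eigenvalue are real, so real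
  and imaginary parts of eigenfunctions are again eigenfunctions and the variational arguments can
  stay real.\<close>

definition real_eig :: "'e metric_graph \<Rightarrow> ('e \<Rightarrow> real \<Rightarrow> real) \<Rightarrow> real \<Rightarrow> ('e \<Rightarrow> real \<Rightarrow> real) \<Rightarrow> bool" where
  "real_eig G q M u \<longleftrightarrow> complexify u \<in> eigenspace G q M"

text \<open>On a bounded interval square integrability implies integrability, through the pointwise
  bound of the modulus by one plus its square.\<close>

lemma H2_interval_integrable:
  assumes "H2_interval L u u' u''"
  shows "integrable (lebesgue_on {0..L}) u''"
proof (rule Bochner_Integration.integrable_bound)
  show "integrable (lebesgue_on {0..L}) (\<lambda>x. 1 + (cmod (u'' x))\<^sup>2)"
    using assms by (intro Bochner_Integration.integrable_add integrable_const_ivl) (auto simp: H2_interval_def)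
  show "u'' \<in> borel_measurable (lebesgue_on {0..L})"
    using assms by (simp add: H2_interval_def)
  show "AE x in lebesgue_on {0..L}. norm (u'' x) \<le> norm (1 + (cmod (u'' x))\<^sup>2)"
  proof (intro AE_I2)
    fix x
    have "0 \<le> (cmod (u'' x) - 1)\<^sup>2" by simp
    then have "2 * cmod (u'' x) \<le> 1 + (cmod (u'' x))\<^sup>2"
      by (simp add: power2_diff)
    then show "norm (u'' x) \<le> norm (1 + (cmod (u'' x))\<^sup>2)"
      using norm_ge_zero[of "u'' x"] unfolding real_norm_def by linarith
  qed
qed

lemma measurable_complex_of_real:
  "f \<in> borel_measurable M \<Longrightarrow> (\<lambda>x. complex_of_real (f x)) \<in> borel_measurable M"
  by (erule measurable_compose) (intro borel_measurable_continuous_onI continuous_intros)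

text \<open>A bounded real-linear functional commutes with differentiation and integration. Keeping
  it abstract treats real and imaginary parts at once.\<close>

lemma H2_interval_real_part:
  fixes T :: "complex \<Rightarrow> real"
  assumes T: "bounded_linear T" "\<And>z. \<bar>T z\<bar> \<le> cmod z"
    and H2: "H2_interval L u u' u''" and L: "0 \<le> L"
  shows "H2_interval L (\<lambda>x. complex_of_real (T (u x))) (\<lambda>x. complex_of_real (T (u' x)))
    (\<lambda>x. complex_of_real (T (u'' x)))"
  unfolding H2_interval_def
proof (intro conjI ballI)
  have cT: "continuous_on UNIV T" using T(1) by (rule linear_continuous_on)
  have meas: "u'' \<in> borel_measurable (lebesgue_on {0..L})"
    and sq: "integrable (lebesgue_on {0..L}) (\<lambda>x. (cmod (u'' x))\<^sup>2)"
    using H2 by (simp_all add: H2_interval_def)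
  have measT: "(\<lambda>x. T (u'' x)) \<in> borel_measurable (lebesgue_on {0..L})"
    by (rule measurable_compose[OF meas borel_measurable_continuous_onI[OF cT]])
  then show "(\<lambda>x. complex_of_real (T (u'' x))) \<in> borel_measurable (lebesgue_on {0..L})"
    by (rule measurable_complex_of_real)
  show "integrable (lebesgue_on {0..L}) (\<lambda>x. (cmod (complex_of_real (T (u'' x))))\<^sup>2)"
  proof (rule Bochner_Integration.integrable_bound[OF sq])
    have "(\<lambda>x. (T (u'' x))\<^sup>2) \<in> borel_measurable (lebesgue_on {0..L})"
      using measT by (rule borel_measurable_power)
    then show "(\<lambda>x. (cmod (complex_of_real (T (u'' x))))\<^sup>2) \<in> borel_measurable (lebesgue_on {0..L})"
      by (simp only: norm_of_real power2_abs)
    show "AE x in lebesgue_on {0..L}. norm ((cmod (complex_of_real (T (u'' x))))\<^sup>2) \<le> norm ((cmod (u'' x))\<^sup>2)"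
      by (intro AE_I2) (use power_mono[OF T(2) abs_ge_zero, of _ 2] in simp)
  qed
next
  fix x assume x: "x \<in> {0..L}"
  have "(u has_vector_derivative u' x) (at x within {0..L})"
    using H2 x unfolding H2_interval_def by blast
  then have "((\<lambda>x. T (u x)) has_vector_derivative T (u' x)) (at x within {0..L})"
    by (rule bounded_linear.has_vector_derivative[OF T(1)])
  then show "((\<lambda>x. complex_of_real (T (u x))) has_vector_derivative complex_of_real (T (u' x))) (at x within {0..L})"
    by (rule bounded_linear.has_vector_derivative[OF bounded_linear_of_real])
next
  fix x assume x: "x \<in> {0..L}"
  have int: "integrable (lebesgue_on {0..x}) u''"
    by (rule Equivalence_Lebesgue_Henstock_Integration.integrable_subinterval[OF H2_interval_integrable[OF H2]])
      (use x in auto)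
  have "u' x = u' 0 + (LINT y|lebesgue_on {0..x}. u'' y)"
    using H2 x unfolding H2_interval_def by blast
  then have "T (u' x) = T (u' 0) + T (LINT y|lebesgue_on {0..x}. u'' y)"
    using linear_add[OF bounded_linear.linear[OF T(1)]] by simp
  also have "T (LINT y|lebesgue_on {0..x}. u'' y) = (LINT y|lebesgue_on {0..x}. T (u'' y))"
    by (rule integral_bounded_linear[OF T(1) int, symmetric])
  finally show "complex_of_real (T (u' x)) =
      complex_of_real (T (u' 0)) + (LINT y|lebesgue_on {0..x}. complex_of_real (T (u'' y)))"
    by simp
qed

lemma schroedinger_E:
  assumes "schroedinger G q u f"
  obtains u' u'' where "\<And>e x. (e, x) \<notin> edge_points G \<Longrightarrow> u e x = 0"
    "\<And>e. e \<in> edges G \<Longrightarrow> H2_interval (len G e) (u e) (u' e) (u'' e)"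
    "\<And>v a b. v \<in> verts G \<Longrightarrow> a \<in> v \<Longrightarrow> b \<in> v \<Longrightarrow> end_value G u a = end_value G u b"
    "\<And>v. v \<in> verts G \<Longrightarrow> (\<Sum>a\<in>v. end_normal_deriv G u' a) = 0"
    "\<And>e. e \<in> edges G \<Longrightarrow> AE x in lebesgue_on {0..len G e}.
      f e x = - u'' e x + complex_of_real (q e x) * u e x"
proof -
  obtain u' u'' where *: "\<forall>e x. (e, x) \<notin> edge_points G \<longrightarrow> u e x = 0"
    "\<forall>e\<in>edges G. H2_interval (len G e) (u e) (u' e) (u'' e)"
    "\<forall>v\<in>verts G. \<forall>a\<in>v. \<forall>b\<in>v. end_value G u a = end_value G u b"
    "\<forall>v\<in>verts G. (\<Sum>a\<in>v. end_normal_deriv G u' a) = 0"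
    "\<forall>e\<in>edges G. AE x in lebesgue_on {0..len G e}. f e x = - u'' e x + complex_of_real (q e x) * u e x"
    using assms unfolding schroedinger_def by (elim conjE exE)
  show ?thesis
  proof (rule that)
    show "\<And>e x. (e, x) \<notin> edge_points G \<Longrightarrow> u e x = 0" using *(1) by blast
    show "\<And>e. e \<in> edges G \<Longrightarrow> H2_interval (len G e) (u e) (u' e) (u'' e)" using *(2) by blast
    show "\<And>v a b. v \<in> verts G \<Longrightarrow> a \<in> v \<Longrightarrow> b \<in> v \<Longrightarrow> end_value G u a = end_value G u b"
      using *(3) by blast
    show "\<And>v. v \<in> verts G \<Longrightarrow> (\<Sum>a\<in>v. end_normal_deriv G u' a) = 0" using *(4) by blast
    show "\<And>e. e \<in> edges G \<Longrightarrow> AE x in lebesgue_on {0..len G e}.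
        f e x = - u'' e x + complex_of_real (q e x) * u e x" using *(5) by blast
  qed
qed

lemma schroedinger_I:
  assumes "\<And>e x. (e, x) \<notin> edge_points G \<Longrightarrow> u e x = 0"
    and "\<And>e. e \<in> edges G \<Longrightarrow> H2_interval (len G e) (u e) (u' e) (u'' e)"
    and "\<And>v a b. v \<in> verts G \<Longrightarrow> a \<in> v \<Longrightarrow> b \<in> v \<Longrightarrow> end_value G u a = end_value G u b"
    and "\<And>v. v \<in> verts G \<Longrightarrow> (\<Sum>a\<in>v. end_normal_deriv G u' a) = 0"
    and "\<And>e. e \<in> edges G \<Longrightarrow> AE x in lebesgue_on {0..len G e}.
      f e x = - u'' e x + complex_of_real (q e x) * u e x"
  shows "schroedinger G q u f"
  unfolding schroedinger_def
  by (rule conjI, intro allI impI, rule assms(1), assumption)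
    (rule exI[of _ u'], rule exI[of _ u''], intro conjI ballI, (rule assms; assumption)+)

context compact_graph
begin

lemma eigenspace_real_part:
  fixes T :: "complex \<Rightarrow> real"
  assumes T: "bounded_linear T" "\<And>z. \<bar>T z\<bar> \<le> cmod z" and w: "w \<in> eigenspace G q M"
  shows "real_eig G q M (\<lambda>e x. T (w e x))"
proof -
  have T0: "T 0 = 0" and Tadd: "T (x + y) = T x + T y" and Tmin: "T (- x) = - T x" for x y
    using bounded_linear.linear[OF T(1)] by (auto simp: linear_0 linear_add linear_neg)
  have Tre: "T (complex_of_real r * z) = r * T z" for r z
    using linear_cmul[OF bounded_linear.linear[OF T(1)], of r z] by (simp add: scaleR_conv_of_real)
  from w obtain u' u'' where
    zero: "\<And>e x. (e, x) \<notin> edge_points G \<Longrightarrow> w e x = 0" and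
    H2: "\<And>e. e \<in> edges G \<Longrightarrow> H2_interval (len G e) (w e) (u' e) (u'' e)" and
    vert: "\<And>v a b. v \<in> verts G \<Longrightarrow> a \<in> v \<Longrightarrow> b \<in> v \<Longrightarrow> end_value G w a = end_value G w b" and
    kir: "\<And>v. v \<in> verts G \<Longrightarrow> (\<Sum>a\<in>v. end_normal_deriv G u' a) = 0" and
    eq: "\<And>e. e \<in> edges G \<Longrightarrow> AE x in lebesgue_on {0..len G e}.
      cscale (complex_of_real M) w e x = - u'' e x + complex_of_real (q e x) * w e x"
    unfolding eigenspace_def mem_Collect_eq by (elim schroedinger_E) (rule that; assumption)
  show ?thesis
    unfolding real_eig_def eigenspace_def mem_Collect_eq
  proof (rule schroedinger_I[where u' = "\<lambda>e x. complex_of_real (T (u' e x))"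
      and u'' = "\<lambda>e x. complex_of_real (T (u'' e x))"])
    fix e x assume "(e, x) \<notin> edge_points G"
    then show "complexify (\<lambda>e x. T (w e x)) e x = 0" by (simp add: complexify_def zero T0)
  next
    fix e assume e: "e \<in> edges G"
    show "H2_interval (len G e) (complexify (\<lambda>e x. T (w e x)) e) (\<lambda>x. complex_of_real (T (u' e x)))
       (\<lambda>x. complex_of_real (T (u'' e x)))"
      unfolding complexify_def
      by (rule H2_interval_real_part[OF T H2[OF e]]) (use len_pos[OF e] in simp)
  next
    fix v a b assume "v \<in> verts G" "a \<in> v" "b \<in> v"
    from vert[OF this] show "end_value G (complexify (\<lambda>e x. T (w e x))) a = end_value G (complexify (\<lambda>e x. T (w e x))) b"
      by (simp add: end_value_def complexify_def)
  next
    fix v assume v: "v \<in> verts G"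
    have "end_normal_deriv G (\<lambda>e x. complex_of_real (T (u' e x))) a =
        complex_of_real (T (end_normal_deriv G u' a))" for a
      by (simp add: end_normal_deriv_def Tmin)
    then have "(\<Sum>a\<in>v. end_normal_deriv G (\<lambda>e x. complex_of_real (T (u' e x))) a) =
        complex_of_real (T (\<Sum>a\<in>v. end_normal_deriv G u' a))"
      by (simp add: linear_sum[OF bounded_linear.linear[OF T(1)]])
    then show "(\<Sum>a\<in>v. end_normal_deriv G (\<lambda>e x. complex_of_real (T (u' e x))) a) = 0"
      using kir[OF v] T0 by simp
  next
    fix e assume e: "e \<in> edges G"
    show "AE x in lebesgue_on {0..len G e}.
      cscale (complex_of_real M) (complexify (\<lambda>e x. T (w e x))) e x =
      - complex_of_real (T (u'' e x)) + complex_of_real (q e x) * complexify (\<lambda>e x. T (w e x)) e x"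
      using eq[OF e]
    proof eventually_elim
      case (elim x)
      then have "T (complex_of_real M * w e x) = T (- u'' e x + complex_of_real (q e x) * w e x)"
        by (simp add: cscale_def)
      then have "M * T (w e x) = - T (u'' e x) + q e x * T (w e x)"
        by (simp add: Tadd Tmin Tre del: add_uminus_conv_diff uminus_add_conv_diff)
      then have "complex_of_real (M * T (w e x)) = complex_of_real (- T (u'' e x) + q e x * T (w e x))"
        by (rule arg_cong)
      then show ?case by (simp add: cscale_def complexify_def)
    qed
  qed
qed

lemma eigenspace_Re: "w \<in> eigenspace G q M \<Longrightarrow> real_eig G q M (\<lambda>e x. Re (w e x))"
  by (rule eigenspace_real_part[OF bounded_linear_Re abs_Re_le_cmod])

lemma eigenspace_Im: "w \<in> eigenspace G q M \<Longrightarrow> real_eig G q M (\<lambda>e x. Im (w e x))"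
  by (rule eigenspace_real_part[OF bounded_linear_Im abs_Im_le_cmod])

text \<open>The equation expresses the second derivative as \<open>(q e y - M) * u e y\<close>
  almost everywhere, which is essentially bounded because \<open>q\<close> is bounded and
  \<open>u\<close> continuous. The square integrable second derivative can thus be replaced by this
  explicit density.\<close>

lemma real_eig_classical:
  assumes q: "q \<in> Linfty G" and u: "real_eig G q M u"
  obtains u' where "\<And>e x. (e, x) \<notin> edge_points G \<Longrightarrow> u e x = 0"
    "\<And>e x. e \<in> edges G \<Longrightarrow> x \<in> {0..len G e} \<Longrightarrow> (u e has_real_derivative u' e x) (at x within {0..len G e})"
    "\<And>e x. e \<in> edges G \<Longrightarrow> x \<in> {0..len G e} \<Longrightarrow>
      u' e x = u' e 0 + (LINT y|lebesgue_on {0..x}. (q e y - M) * u e y)"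
    "\<And>v a b. v \<in> verts G \<Longrightarrow> a \<in> v \<Longrightarrow> b \<in> v \<Longrightarrow> end_val G u a = end_val G u b"
    "\<And>v. v \<in> verts G \<Longrightarrow> (\<Sum>a\<in>v. end_slope G u' a) = 0"
proof -
  from u obtain u' u'' where
    zero: "\<And>e x. (e, x) \<notin> edge_points G \<Longrightarrow> complexify u e x = 0" and
    H2: "\<And>e. e \<in> edges G \<Longrightarrow> H2_interval (len G e) (complexify u e) (u' e) (u'' e)" and
    vert: "\<And>v a b. v \<in> verts G \<Longrightarrow> a \<in> v \<Longrightarrow> b \<in> v \<Longrightarrow> end_value G (complexify u) a = end_value G (complexify u) b" and
    kir: "\<And>v. v \<in> verts G \<Longrightarrow> (\<Sum>a\<in>v. end_normal_deriv G u' a) = 0" and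
    eq: "\<And>e. e \<in> edges G \<Longrightarrow> AE x in lebesgue_on {0..len G e}.
      cscale (complex_of_real M) (complexify u) e x = - u'' e x + complex_of_real (q e x) * complexify u e x"
    unfolding real_eig_def eigenspace_def mem_Collect_eq by (elim schroedinger_E) (rule that; assumption)
  have der: "(u e has_real_derivative Re (u' e x)) (at x within {0..len G e})"
    if "e \<in> edges G" "x \<in> {0..len G e}" for e x
  proof -
    have "(complexify u e has_vector_derivative u' e x) (at x within {0..len G e})"
      using H2[OF that(1)] that(2) unfolding H2_interval_def by blast
    from bounded_linear.has_vector_derivative[OF bounded_linear_Re this]
    show ?thesis by (simp add: complexify_def has_real_derivative_iff_has_vector_derivative)
  qed
  show ?thesis
  proof (rule that[of "\<lambda>e x. Re (u' e x)"])
    show "u e x = 0" if "(e, x) \<notin> edge_points G" for e x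
      using zero[OF that] by (simp add: complexify_def)
    show "end_val G u a = end_val G u b" if "v \<in> verts G" "a \<in> v" "b \<in> v" for v a b
      using vert[OF that] by (simp add: end_val_def end_value_def complexify_def)
    show "(\<Sum>a\<in>v. end_slope G (\<lambda>e x. Re (u' e x)) a) = 0" if "v \<in> verts G" for v
    proof -
      have "end_slope G (\<lambda>e x. Re (u' e x)) a = Re (end_normal_deriv G u' a)" for a
        by (simp add: end_slope_def end_normal_deriv_def)
      then have "(\<Sum>a\<in>v. end_slope G (\<lambda>e x. Re (u' e x)) a) = Re (\<Sum>a\<in>v. end_normal_deriv G u' a)"
        by simp
      then show ?thesis using kir[OF that] by simp
    qed
    show "(u e has_real_derivative Re (u' e x)) (at x within {0..len G e})"
      if "e \<in> edges G" "x \<in> {0..len G e}" for e x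
      by (rule der[OF that])
    show "Re (u' e x) = Re (u' e 0) + (LINT y|lebesgue_on {0..x}. (q e y - M) * u e y)"
      if e: "e \<in> edges G" and x: "x \<in> {0..len G e}" for e x
    proof -
      have sub: "{0..x} \<subseteq> {0..len G e}" using x by auto
      have eb: "ess_bounded 0 (len G e) (\<lambda>y. (q e y - M) * u e y)"
        by (intro ess_bounded_intros Linfty_D[OF q e] ess_bounded_continuous C1_continuous[OF der[OF e]])
      have int: "integrable (lebesgue_on {0..x}) (u'' e)"
        by (rule Equivalence_Lebesgue_Henstock_Integration.integrable_subinterval[OF H2_interval_integrable[OF H2[OF e]] sub])
      have "u' e x = u' e 0 + (LINT y|lebesgue_on {0..x}. u'' e y)"
        using H2[OF e] x unfolding H2_interval_def by blast
      then have "Re (u' e x) = Re (u' e 0) + Re (LINT y|lebesgue_on {0..x}. u'' e y)" by simp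
      also have "Re (LINT y|lebesgue_on {0..x}. u'' e y) = (LINT y|lebesgue_on {0..x}. Re (u'' e y))"
        by (rule integral_bounded_linear[OF bounded_linear_Re int, symmetric])
      also have "\<dots> = (LINT y|lebesgue_on {0..x}. (q e y - M) * u e y)"
      proof (rule integral_cong_AE)
        show "(\<lambda>y. Re (u'' e y)) \<in> borel_measurable (lebesgue_on {0..x})"
          using integrable_bounded_linear[OF bounded_linear_Re int] by (rule borel_measurable_integrable)
        show "(\<lambda>y. (q e y - M) * u e y) \<in> borel_measurable (lebesgue_on {0..x})"
          using integrable_ess_bounded[OF ess_bounded_subinterval[OF eb sub]] by (rule borel_measurable_integrable)
        from AE_lebesgue_on_mono[OF eq[OF e] sub]
        show "AE y in lebesgue_on {0..x}. Re (u'' e y) = (q e y - M) * u e y"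
        proof eventually_elim
          case (elim y)
          then have "u'' e y = complex_of_real ((q e y - M) * u e y)"
            by (simp add: cscale_def complexify_def algebra_simps)
          then show ?case by simp
        qed
      qed
      finally show ?thesis .
    qed
  qed
qed

text \<open>The bounded density \<open>(q e x - M) * u e x\<close> serves as the square integrable
  second derivative that membership in the operator domain asks for.\<close>

lemma real_eig_I:
  assumes q: "q \<in> Linfty G" and zero: "\<And>e x. (e, x) \<notin> edge_points G \<Longrightarrow> u e x = 0"
    and der: "\<And>e x. e \<in> edges G \<Longrightarrow> x \<in> {0..len G e} \<Longrightarrow>
      (u e has_real_derivative u' e x) (at x within {0..len G e})"
    and int: "\<And>e x. e \<in> edges G \<Longrightarrow> x \<in> {0..len G e} \<Longrightarrow>
      u' e x = u' e 0 + (LINT y|lebesgue_on {0..x}. (q e y - M) * u e y)"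
    and vert: "\<And>v a b. v \<in> verts G \<Longrightarrow> a \<in> v \<Longrightarrow> b \<in> v \<Longrightarrow> end_val G u a = end_val G u b"
    and kir: "\<And>v. v \<in> verts G \<Longrightarrow> (\<Sum>a\<in>v. end_slope G u' a) = 0"
  shows "real_eig G q M u"
  unfolding real_eig_def eigenspace_def mem_Collect_eq
proof (rule schroedinger_I[where u' = "\<lambda>e x. complex_of_real (u' e x)"
      and u'' = "\<lambda>e x. complex_of_real ((q e x - M) * u e x)"])
  fix e x assume "(e, x) \<notin> edge_points G"
  then show "complexify u e x = 0" by (simp add: complexify_def zero)
next
  fix e assume e: "e \<in> edges G"
  have eb: "ess_bounded 0 (len G e) (\<lambda>y. (q e y - M) * u e y)"
    by (intro ess_bounded_intros Linfty_D[OF q e] ess_bounded_continuous C1_continuous[OF der[OF e]])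
  show "H2_interval (len G e) (complexify u e) (\<lambda>x. complex_of_real (u' e x))
     (\<lambda>x. complex_of_real ((q e x - M) * u e x))"
    unfolding H2_interval_def
  proof (intro conjI ballI)
    show "(\<lambda>x. complex_of_real ((q e x - M) * u e x)) \<in> borel_measurable (lebesgue_on {0..len G e})"
      using borel_measurable_integrable[OF integrable_ess_bounded[OF eb]] by (rule measurable_complex_of_real)
    show "integrable (lebesgue_on {0..len G e}) (\<lambda>x. (cmod (complex_of_real ((q e x - M) * u e x)))\<^sup>2)"
      using integrable_ess_bounded[OF ess_bounded_mult[OF eb eb]]
      unfolding norm_of_real power2_abs unfolding power2_eq_square .
  next
    fix x assume x: "x \<in> {0..len G e}"
    show "(complexify u e has_vector_derivative complex_of_real (u' e x)) (at x within {0..len G e})"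
      using has_vector_derivative_of_real[OF der[OF e x]]
      by (simp add: complexify_def)
    show "complex_of_real (u' e x) = complex_of_real (u' e 0) +
        (LINT y|lebesgue_on {0..x}. complex_of_real ((q e y - M) * u e y))"
      unfolding integral_complex_of_real of_real_add[symmetric] by (rule arg_cong[OF int[OF e x]])
  qed
next
  fix v a b assume "v \<in> verts G" "a \<in> v" "b \<in> v"
  from vert[OF this] show "end_value G (complexify u) a = end_value G (complexify u) b"
    by (simp add: end_val_def end_value_def complexify_def)
next
  fix v assume v: "v \<in> verts G"
  have "end_normal_deriv G (\<lambda>e x. complex_of_real (u' e x)) a = complex_of_real (end_slope G u' a)" for a
    by (simp add: end_slope_def end_normal_deriv_def)
  then have "(\<Sum>a\<in>v. end_normal_deriv G (\<lambda>e x. complex_of_real (u' e x)) a) = complex_of_real (\<Sum>a\<in>v. end_slope G u' a)"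
    by simp
  then show "(\<Sum>a\<in>v. end_normal_deriv G (\<lambda>e x. complex_of_real (u' e x)) a) = 0" using kir[OF v] by simp
next
  fix e assume "e \<in> edges G"
  show "AE x in lebesgue_on {0..len G e}. cscale (complex_of_real M) (complexify u) e x =
      - complex_of_real ((q e x - M) * u e x) + complex_of_real (q e x) * complexify u e x"
    by (intro AE_I2) (simp add: cscale_def complexify_def algebra_simps)
qed

lemma real_eig_C1:
  assumes q: "q \<in> Linfty G" and u: "real_eig G q M u"
  shows "u \<in> V"
proof -
  obtain u' where zero: "\<And>e x. (e, x) \<notin> edge_points G \<Longrightarrow> u e x = 0"
    and der: "\<And>e x. e \<in> edges G \<Longrightarrow> x \<in> {0..len G e} \<Longrightarrow> (u e has_real_derivative u' e x) (at x within {0..len G e})"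
    and int: "\<And>e x. e \<in> edges G \<Longrightarrow> x \<in> {0..len G e} \<Longrightarrow>
      u' e x = u' e 0 + (LINT y|lebesgue_on {0..x}. (q e y - M) * u e y)"
    and vert: "\<And>v a b. v \<in> verts G \<Longrightarrow> a \<in> v \<Longrightarrow> b \<in> v \<Longrightarrow> end_val G u a = end_val G u b"
    by (rule real_eig_classical[OF q u]) (rule that; assumption)
  show ?thesis
  proof (rule C1_I[where u' = u'])
    fix e assume e: "e \<in> edges G"
    show "continuous_on {0..len G e} (u' e)"
      by (rule indefinite_integral_continuous[OF _ int[OF e]])
        (intro ess_bounded_intros Linfty_D[OF q e] ess_bounded_continuous C1_continuous[OF der[OF e]])
  qed (rule zero der vert; assumption)+
qed

text \<open>Green's identity: the vertex terms cancel by continuity of \<open>\<phi>\<close> and the Kirchhoff condition.\<close>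

lemma real_eig_weak:
  assumes q: "q \<in> Linfty G" and u: "real_eig G q M u" and \<phi>: "\<phi> \<in> V"
  shows "qform G q u \<phi> = M * ip G u \<phi>"
proof -
  obtain u' where
    der: "\<And>e x. e \<in> edges G \<Longrightarrow> x \<in> {0..len G e} \<Longrightarrow> (u e has_real_derivative u' e x) (at x within {0..len G e})"
    and int: "\<And>e x. e \<in> edges G \<Longrightarrow> x \<in> {0..len G e} \<Longrightarrow>
      u' e x = u' e 0 + (LINT y|lebesgue_on {0..x}. (q e y - M) * u e y)"
    and kir: "\<And>v. v \<in> verts G \<Longrightarrow> (\<Sum>a\<in>v. end_slope G u' a) = 0"
    by (rule real_eig_classical[OF q u]) (rule that; assumption)
  have uV: "u \<in> V" by (rule real_eig_C1[OF q u])
  have "dirichlet G u \<phi> = (\<Sum>e\<in>edges G. u' e (len G e) * \<phi> e (len G e) - u' e 0 * \<phi> e 0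
      - (LINT x|lebesgue_on {0..len G e}. (q e x - M) * u e x * \<phi> e x))"
    unfolding dirichlet_def graph_integral_def
  proof (rule sum.cong[OF refl])
    fix e assume e: "e \<in> edges G"
    have "(LINT x|lebesgue_on {0..len G e}. (q e x - M) * u e x * \<phi> e x) =
        u' e (len G e) * \<phi> e (len G e) - u' e 0 * \<phi> e 0 - (LINT x|lebesgue_on {0..len G e}. u' e x * ederiv G \<phi> e x)"
      by (rule integral_by_parts_indefinite[OF _ _ int[OF e]])
        (use len_pos[OF e] in \<open>auto intro!: C1_ederiv[OF \<phi> e] C1_ederiv_continuous[OF \<phi> e]
          ess_bounded_intros Linfty_D[OF q e] Linfty_D[OF C1_Linfty[OF uV] e]\<close>)
    moreover have "(LINT x|lebesgue_on {0..len G e}. u' e x * ederiv G \<phi> e x) =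
        (LINT x|lebesgue_on {0..len G e}. ederiv G u e x * ederiv G \<phi> e x)"
      by (intro Bochner_Integration.integral_cong refl) (simp add: ederiv_eqI[where u = u, OF e _ der[OF e]])
    ultimately show "(LINT x|lebesgue_on {0..len G e}. ederiv G u e x * ederiv G \<phi> e x) =
        u' e (len G e) * \<phi> e (len G e) - u' e 0 * \<phi> e 0
        - (LINT x|lebesgue_on {0..len G e}. (q e x - M) * u e x * \<phi> e x)"
      by simp
  qed
  also have "\<dots> = (\<Sum>e\<in>edges G. u' e (len G e) * \<phi> e (len G e) - u' e 0 * \<phi> e 0)
      - graph_integral G (\<lambda>e x. (q e x - M) * u e x * \<phi> e x)"
    by (simp add: sum_subtractf graph_integral_def)
  also have "(\<Sum>e\<in>edges G. u' e (len G e) * \<phi> e (len G e) - u' e 0 * \<phi> e 0) =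
      (\<Sum>e\<in>edges G. - (end_slope G u' (e, True) * end_val G \<phi> (e, True))
        + - (end_slope G u' (e, False) * end_val G \<phi> (e, False)))"
    by (simp add: end_slope_def end_val_def)
  also have "\<dots> = (\<Sum>v\<in>verts G. \<Sum>a\<in>v. - (end_slope G u' a * end_val G \<phi> a))"
    by (rule sum_over_ends)
  also have "\<dots> = 0"
  proof (rule sum.neutral, rule ballI)
    fix v assume v: "v \<in> verts G"
    obtain b where b: "b \<in> v"
      using v partition_verts by (metis partition_on_def ex_in_conv)
    have "(\<Sum>a\<in>v. - (end_slope G u' a * end_val G \<phi> a)) = (\<Sum>a\<in>v. end_slope G u' a * - end_val G \<phi> b)"
    proof (rule sum.cong[OF refl])
      fix a assume a: "a \<in> v"
      show "- (end_slope G u' a * end_val G \<phi> a) = end_slope G u' a * - end_val G \<phi> b"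
        using C1_vertex[OF \<phi> v a b] by simp
    qed
    also have "\<dots> = 0" using kir[OF v] by (simp flip: sum_distrib_right add: sum_negf)
    finally show "(\<Sum>a\<in>v. - (end_slope G u' a * end_val G \<phi> a)) = 0" .
  qed
  finally have "dirichlet G u \<phi> = - graph_integral G (\<lambda>e x. (q e x - M) * u e x * \<phi> e x)" by simp
  also have "graph_integral G (\<lambda>e x. (q e x - M) * u e x * \<phi> e x) =
      graph_integral G (\<lambda>e x. q e x * (u e x * \<phi> e x) - M * (u e x * \<phi> e x))"
    by (rule graph_integral_cong) (simp add: algebra_simps)
  also have "\<dots> = weighted_ip G q u \<phi> - M * ip G u \<phi>"
    unfolding weighted_ip_def ip_def graph_integral_cmult[symmetric]
    by (intro graph_integral_diff Linfty_mult Linfty_const C1_Linfty q uV \<phi>)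
  finally show ?thesis by (simp add: qform_def)
qed

end

section \<open>Edgewise uniform limits and the weak eigenvalue equation\<close>

lemma integral_uniform_limit:
  fixes f :: "nat \<Rightarrow> real \<Rightarrow> real"
  assumes k: "ess_bounded a b k" and ab: "a \<le> b"
    and f: "\<And>n. continuous_on {a..b} (f n)" and lim: "uniform_limit {a..b} f g sequentially"
  shows "(\<lambda>n. LINT x|lebesgue_on {a..b}. k x * f n x) \<longlonglongrightarrow> (LINT x|lebesgue_on {a..b}. k x * g x)"
proof -
  have g: "continuous_on {a..b} g"
    by (rule uniform_limit_theorem[OF _ lim]) (use f in auto)
  obtain B where B: "B > 0" "AE x in lebesgue_on {a..b}. \<bar>k x\<bar> \<le> B"
    using k ess_bounded_bound by blast
  show ?thesis
  proof (rule tendstoI)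
    fix r :: real assume r: "r > 0"
    \<comment> \<open>The added 1 keeps \<open>c\<close> positive when \<open>a = b\<close>, so that
      it may stand in a denominator.\<close>
    define c where "c = b - a + 1"
    define s where "s = r / (2 * B * c)"
    have c: "c > 0" using ab by (simp add: c_def)
    have s: "s > 0" using r B c by (simp add: s_def)
    have "\<forall>\<^sub>F n in sequentially. \<forall>x\<in>{a..b}. dist (f n x) (g x) < s"
      using lim s by (auto simp: uniform_limit_iff)
    then show "\<forall>\<^sub>F n in sequentially. dist (LINT x|lebesgue_on {a..b}. k x * f n x) (LINT x|lebesgue_on {a..b}. k x * g x) < r"
    proof eventually_elim
      case (elim n)
      have "(LINT x|lebesgue_on {a..b}. k x * f n x - k x * g x) =
          (LINT x|lebesgue_on {a..b}. k x * f n x) - (LINT x|lebesgue_on {a..b}. k x * g x)"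
        by (intro Bochner_Integration.integral_diff integrable_ess_bounded ess_bounded_mult k
            ess_bounded_continuous f g)
      moreover have "AE x in lebesgue_on {a..b}. \<bar>k x * f n x - k x * g x\<bar> \<le> B * s"
      proof -
        have "AE x in lebesgue_on {a..b}. x \<in> {a..b}" by (intro AE_I2) auto
        with B(2) show ?thesis
        proof eventually_elim
          case (elim x)
          have "\<bar>f n x - g x\<bar> \<le> s" using \<open>\<forall>x\<in>{a..b}. dist (f n x) (g x) < s\<close> elim(2)
            by (force simp: dist_real_def)
          then have "\<bar>k x\<bar> * \<bar>f n x - g x\<bar> \<le> B * s" using elim(1) B(1) by (intro mult_mono) auto
          then show ?case by (simp add: abs_mult flip: right_diff_distrib)
        qed
      qed
      ultimately have "\<bar>(LINT x|lebesgue_on {a..b}. k x * f n x) - (LINT x|lebesgue_on {a..b}. k x * g x)\<bar>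
          \<le> (B * s) * (b - a)"
        using integral_abs_le_AE[where f = "\<lambda>x. k x * f n x - k x * g x" and B = "B * s" and a = a and b = b] ab B s by simp
      also have "\<dots> \<le> (B * s) * c" using B s by (intro mult_left_mono) (auto simp: c_def)
      also have "\<dots> = r / 2" using B c by (simp add: s_def)
      also have "\<dots> < r" using r by simp
      finally show ?case by (simp add: dist_real_def)
    qed
  qed
qed

text \<open>Nothing is said about derivatives, since compactness gives no control of them. The
  clause off the graph matches the convention of \<open>C1_functions\<close>, so that a limit found
  to be smooth really lies in that space.\<close>

definition edgewise_limit ::
  "'e metric_graph \<Rightarrow> (nat \<Rightarrow> 'e \<Rightarrow> real \<Rightarrow> real) \<Rightarrow> ('e \<Rightarrow> real \<Rightarrow> real) \<Rightarrow> bool" where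
  "edgewise_limit G U u \<longleftrightarrow> (\<forall>e x. (e, x) \<notin> edge_points G \<longrightarrow> u e x = 0) \<and>
     (\<forall>e\<in>edges G. uniform_limit {0..len G e} (\<lambda>n. U n e) (u e) sequentially)"

context compact_graph
begin

lemma vert_edge:
  assumes "v \<in> verts G" "a \<in> v"
  shows "fst a \<in> edges G"
proof -
  have "\<Union>(verts G) = edges G \<times> UNIV" using partition_verts by (simp add: partition_on_def)
  then have "a \<in> edges G \<times> UNIV" using assms by blast
  then show ?thesis by (simp add: mem_Times_iff)
qed

lemma edgewise_limit_continuous:
  assumes "\<And>n. U n \<in> V" "edgewise_limit G U u" "e \<in> edges G"
  shows "continuous_on {0..len G e} (u e)"
  by (rule uniform_limit_theorem[where f = "\<lambda>n. U n e" and F = sequentially])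
    (use assms C1_continuous_edge in \<open>auto simp: edgewise_limit_def\<close>)

lemma edgewise_limit_vertex:
  assumes "\<And>n. U n \<in> V" "edgewise_limit G U u" "v \<in> verts G" "a \<in> v" "b \<in> v"
  shows "end_val G u a = end_val G u b"
proof -
  have conv: "(\<lambda>n. end_val G (U n) c) \<longlonglongrightarrow> end_val G u c" if "c \<in> v" for c
  proof -
    have e: "fst c \<in> edges G" by (rule vert_edge[OF assms(3) that])
    then have "uniform_limit {0..len G (fst c)} (\<lambda>n. U n (fst c)) (u (fst c)) sequentially"
      using assms(2) by (simp add: edgewise_limit_def)
    from tendsto_uniform_limitI[OF this, of "if snd c then len G (fst c) else 0"]
    show ?thesis using len_pos[OF e] by (auto simp: end_val_def)
  qed
  have "end_val G (U n) a = end_val G (U n) b" for n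
    by (rule C1_vertex[OF assms(1,3-5)])
  then show ?thesis
    using LIMSEQ_unique[OF conv[OF assms(4)]] conv[OF assms(5)] by simp
qed

lemma edgewise_limit_integral:
  assumes "\<And>n. U n \<in> V" "edgewise_limit G U u" "k \<in> Linfty G"
  shows "(\<lambda>n. graph_integral G (\<lambda>e x. k e x * U n e x)) \<longlonglongrightarrow> graph_integral G (\<lambda>e x. k e x * u e x)"
  unfolding graph_integral_def
proof (rule tendsto_sum)
  fix e assume e: "e \<in> edges G"
  show "(\<lambda>n. LINT x|lebesgue_on {0..len G e}. k e x * U n e x) \<longlonglongrightarrow> (LINT x|lebesgue_on {0..len G e}. k e x * u e x)"
    by (rule integral_uniform_limit)
      (use e len_pos[OF e] assms in \<open>auto simp: edgewise_limit_def intro: Linfty_D C1_continuous_edge\<close>)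
qed

lemma edgewise_limit_ip:
  assumes U: "\<And>n. U n \<in> V" and lim: "edgewise_limit G U u" and v: "v \<in> V"
  shows "(\<lambda>n. ip G (U n) v) \<longlonglongrightarrow> ip G u v"
  using edgewise_limit_integral[OF U lim C1_Linfty[OF v]] by (simp add: ip_def mult.commute)

text \<open>Both factors vary here, so the convergence is not an instance of integration against a
  fixed function; the products converge uniformly because the limit is bounded.\<close>

lemma edgewise_limit_ip_self:
  assumes U: "\<And>n. U n \<in> V" and lim: "edgewise_limit G U u"
  shows "(\<lambda>n. ip G (U n) (U n)) \<longlonglongrightarrow> ip G u u"
  unfolding ip_def graph_integral_def
proof (rule tendsto_sum)
  fix e assume e: "e \<in> edges G"
  have c: "continuous_on {0..len G e} (U n e)" for n by (rule C1_continuous_edge[OF U e])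
  have cu: "continuous_on {0..len G e} (u e)" by (rule edgewise_limit_continuous[OF U lim e])
  have "uniform_limit {0..len G e} (\<lambda>n. U n e) (u e) sequentially"
    using lim e by (simp add: edgewise_limit_def)
  moreover have "bounded (u e ` {0..len G e})"
    by (intro compact_imp_bounded compact_continuous_image cu) auto
  ultimately have ul: "uniform_limit {0..len G e} (\<lambda>n x. U n e x * U n e x) (\<lambda>x. u e x * u e x) sequentially"
    by (intro uniform_lim_mult)
  have "(\<lambda>n. LINT x|lebesgue_on {0..len G e}. 1 * (U n e x * U n e x)) \<longlonglongrightarrow> (LINT x|lebesgue_on {0..len G e}. 1 * (u e x * u e x))"
    by (rule integral_uniform_limit[OF ess_bounded_const _ _ ul])
      (use len_pos[OF e] in \<open>auto intro: continuous_on_mult c\<close>)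
  then show "(\<lambda>n. LINT x|lebesgue_on {0..len G e}. U n e x * U n e x) \<longlonglongrightarrow> (LINT x|lebesgue_on {0..len G e}. u e x * u e x)"
    by simp
qed

text \<open>Only the values of \<open>U n\<close>, not those of its derivative, survive after integrating by parts
  against a twice differentiable \<open>\<phi>\<close>.\<close>

lemma weak_limit_identity:
  assumes q: "q \<in> Linfty G" and U: "\<And>n. U n \<in> V" and lim: "edgewise_limit G U u"
    and weak: "(\<lambda>n. qform G q (U n) \<phi> - M * ip G (U n) \<phi>) \<longlonglongrightarrow> 0"
    and \<phi>: "\<phi> \<in> V"
    and c2: "\<And>e. e \<in> edges G \<Longrightarrow> continuous_on {0..len G e} (\<phi>'' e)"
    and d1: "\<And>e x. e \<in> edges G \<Longrightarrow> x \<in> {0..len G e} \<Longrightarrow> (\<phi> e has_real_derivative \<phi>' e x) (at x within {0..len G e})"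
    and d2: "\<And>e x. e \<in> edges G \<Longrightarrow> x \<in> {0..len G e} \<Longrightarrow> (\<phi>' e has_real_derivative \<phi>'' e x) (at x within {0..len G e})"
  shows "(\<Sum>e\<in>edges G. u e (len G e) * \<phi>' e (len G e) - u e 0 * \<phi>' e 0
      - (LINT x|lebesgue_on {0..len G e}. u e x * \<phi>'' e x)
      + (LINT x|lebesgue_on {0..len G e}. (q e x - M) * u e x * \<phi> e x)) = 0"
proof -
  define T where "T w e = w e (len G e) * \<phi>' e (len G e) - w e 0 * \<phi>' e 0
      - (LINT x|lebesgue_on {0..len G e}. w e x * \<phi>'' e x)
      + (LINT x|lebesgue_on {0..len G e}. (q e x - M) * w e x * \<phi> e x)" for w e
  have eq: "qform G q w \<phi> - M * ip G w \<phi> = (\<Sum>e\<in>edges G. T w e)" if w: "w \<in> V" for w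
  proof -
    have "qform G q w \<phi> - M * ip G w \<phi> = dirichlet G w \<phi> + graph_integral G (\<lambda>e x. q e x * (w e x * \<phi> e x) - M * (w e x * \<phi> e x))"
      unfolding qform_def ip_def weighted_ip_def graph_integral_cmult[symmetric]
      by (subst graph_integral_diff) (simp_all add: Linfty_mult Linfty_const C1_Linfty q w \<phi>)
    also have "graph_integral G (\<lambda>e x. q e x * (w e x * \<phi> e x) - M * (w e x * \<phi> e x)) =
        graph_integral G (\<lambda>e x. (q e x - M) * w e x * \<phi> e x)"
      by (rule graph_integral_cong) (simp add: algebra_simps)
    also have "dirichlet G w \<phi> = (\<Sum>e\<in>edges G. w e (len G e) * \<phi>' e (len G e) - w e 0 * \<phi>' e 0
      - (LINT x|lebesgue_on {0..len G e}. w e x * \<phi>'' e x))"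
      unfolding dirichlet_def graph_integral_def
    proof (rule sum.cong[OF refl])
      fix e assume e: "e \<in> edges G"
      have "(LINT x|lebesgue_on {0..len G e}. ederiv G w e x * ederiv G \<phi> e x) =
          (LINT x|lebesgue_on {0..len G e}. ederiv G w e x * \<phi>' e x)"
        by (intro Bochner_Integration.integral_cong refl) (simp add: ederiv_eqI[where u = \<phi>, OF e _ d1[OF e]])
      also have "\<dots> = w e (len G e) * \<phi>' e (len G e) - w e 0 * \<phi>' e 0 - (LINT x|lebesgue_on {0..len G e}. w e x * \<phi>'' e x)"
        by (rule integral_by_parts_C1)
          (use len_pos[OF e] in \<open>auto intro: C1_ederiv_continuous[OF w e] c2[OF e] C1_ederiv[OF w e] d2[OF e]\<close>)
      finally show "(LINT x|lebesgue_on {0..len G e}. ederiv G w e x * ederiv G \<phi> e x) =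
          w e (len G e) * \<phi>' e (len G e) - w e 0 * \<phi>' e 0 - (LINT x|lebesgue_on {0..len G e}. w e x * \<phi>'' e x)" .
    qed
    finally show ?thesis by (simp add: T_def graph_integral_def sum.distrib)
  qed
  have "(\<lambda>n. \<Sum>e\<in>edges G. T (U n) e) \<longlonglongrightarrow> (\<Sum>e\<in>edges G. T u e)"
  proof (rule tendsto_sum)
    fix e assume e: "e \<in> edges G"
    have ul: "uniform_limit {0..len G e} (\<lambda>n. U n e) (u e) sequentially"
      using lim e by (simp add: edgewise_limit_def)
    note pt = tendsto_uniform_limitI[OF ul]
    have L: "0 \<le> len G e" using len_pos[OF e] by simp
    have c: "continuous_on {0..len G e} (U n e)" for n by (rule C1_continuous_edge[OF U e])
    have 1: "(\<lambda>n. LINT x|lebesgue_on {0..len G e}. \<phi>'' e x * U n e x) \<longlonglongrightarrow> (LINT x|lebesgue_on {0..len G e}. \<phi>'' e x * u e x)"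
      by (rule integral_uniform_limit[OF ess_bounded_continuous[OF c2[OF e]] L c ul])
    have 2: "(\<lambda>n. LINT x|lebesgue_on {0..len G e}. ((q e x - M) * \<phi> e x) * U n e x) \<longlonglongrightarrow>
        (LINT x|lebesgue_on {0..len G e}. ((q e x - M) * \<phi> e x) * u e x)"
      by (rule integral_uniform_limit[OF _ L c ul])
        (intro ess_bounded_intros Linfty_D[OF q e] Linfty_D[OF C1_Linfty[OF \<phi>] e])
    show "(\<lambda>n. T (U n) e) \<longlonglongrightarrow> T u e"
      unfolding T_def
      by (intro tendsto_add tendsto_diff tendsto_mult tendsto_const pt)
        (use 1 2 L in \<open>simp_all add: mult_ac\<close>)
  qed
  moreover have "(\<lambda>n. \<Sum>e\<in>edges G. T (U n) e) \<longlonglongrightarrow> 0"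
    using weak eq[OF U] by simp
  ultimately show ?thesis
    using LIMSEQ_unique unfolding T_def by blast
qed

text \<open>Two kinds of test functions suffice. Those living on one edge, with vanishing values and
  slopes at its ends, give the differential equation there. Once \<open>u'\<close> is known to be an
  indefinite integral, integrating back by parts against functions concentrated at one vertex leaves
  only the sum of slopes at that vertex.\<close>

theorem weak_limit_real_eig:
  assumes q: "q \<in> Linfty G" and U: "\<And>n. U n \<in> V" and lim: "edgewise_limit G U u"
    and weak: "\<And>\<phi>. \<phi> \<in> V \<Longrightarrow> (\<lambda>n. qform G q (U n) \<phi> - M * ip G (U n) \<phi>) \<longlonglongrightarrow> 0"
  shows "real_eig G q M u"
proof -
  have uc: "continuous_on {0..len G e} (u e)" if "e \<in> edges G" for e
    by (rule edgewise_limit_continuous[OF U lim that])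
  have kb: "ess_bounded 0 (len G e) (\<lambda>y. (q e y - M) * u e y)" if "e \<in> edges G" for e
    by (intro ess_bounded_intros Linfty_D[OF q that] ess_bounded_continuous uc that)
  have edge: "\<exists>d. (\<forall>x\<in>{0..len G e}. (u e has_real_derivative d x) (at x within {0..len G e})) \<and>
      (\<forall>x\<in>{0..len G e}. d x = d 0 + (LINT y|lebesgue_on {0..x}. (q e y - M) * u e y))"
    if e: "e \<in> edges G" for e
  proof (rule weak_solution_regular[OF len_pos[OF e] uc[OF e] kb[OF e]])
    fix \<psi> \<psi>' \<psi>'' :: "real \<Rightarrow> real"
    assume \<psi>: "continuous_on {0..len G e} \<psi>''"
      "\<And>x. x \<in> {0..len G e} \<Longrightarrow> (\<psi> has_real_derivative \<psi>' x) (at x within {0..len G e})"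
      "\<And>x. x \<in> {0..len G e} \<Longrightarrow> (\<psi>' has_real_derivative \<psi>'' x) (at x within {0..len G e})"
      "\<psi> 0 = 0" "\<psi> (len G e) = 0" "\<psi>' 0 = 0" "\<psi>' (len G e) = 0"
    \<comment> \<open>Only \<open>\<phi>\<close> has to be cut off outside the edge to meet the
      convention of \<open>C1_functions\<close>; the derivatives matter only on the interval
      itself.\<close>
    define \<phi> \<phi>' \<phi>'' where "\<phi> = (\<lambda>f x. if f = e \<and> x \<in> {0..len G e} then \<psi> x else 0)"
      and "\<phi>' = (\<lambda>f x. if f = e then \<psi>' x else 0)" and "\<phi>'' = (\<lambda>f x. if f = e then \<psi>'' x else 0)"
    have c1: "continuous_on {0..len G e} \<psi>'" by (rule C1_continuous[OF \<psi>(3)])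
    have d1: "(\<phi> f has_real_derivative \<phi>' f x) (at x within {0..len G f})"
      if "f \<in> edges G" "x \<in> {0..len G f}" for f x
    proof (cases "f = e")
      case True
      have "(\<phi> e has_real_derivative \<psi>' x) (at x within {0..len G e})"
        by (rule has_field_derivative_transform_within[OF \<psi>(2), of x 1]) (use that True in \<open>auto simp: \<phi>_def\<close>)
      then show ?thesis using True by (simp add: \<phi>'_def)
    qed (simp add: \<phi>_def \<phi>'_def)
    have d2: "(\<phi>' f has_real_derivative \<phi>'' f x) (at x within {0..len G f})"
      if "f \<in> edges G" "x \<in> {0..len G f}" for f x
      using \<psi>(3)[of x] that by (cases "f = e") (simp_all add: \<phi>'_def \<phi>''_def)
    have \<phi>V: "\<phi> \<in> V"
    proof (rule C1_I[where u' = \<phi>'])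
      fix f x assume "(f, x) \<notin> edge_points G"
      then show "\<phi> f x = 0" using e by (auto simp: \<phi>_def edge_points_def)
    next
      fix f assume "f \<in> edges G"
      show "continuous_on {0..len G f} (\<phi>' f)"
        using c1 by (cases "f = e") (simp_all add: \<phi>'_def)
    next
      fix v a b assume "v \<in> verts G" "a \<in> v" "b \<in> v"
      show "end_val G \<phi> a = end_val G \<phi> b" by (simp add: end_val_def \<phi>_def \<psi>)
    qed (rule d1)
    have "(\<Sum>f\<in>edges G. u f (len G f) * \<phi>' f (len G f) - u f 0 * \<phi>' f 0
      - (LINT x|lebesgue_on {0..len G f}. u f x * \<phi>'' f x)
      + (LINT x|lebesgue_on {0..len G f}. (q f x - M) * u f x * \<phi> f x)) = 0"
    proof (rule weak_limit_identity[OF q U lim weak[OF \<phi>V] \<phi>V _ d1 d2])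
      fix f assume "f \<in> edges G"
      show "continuous_on {0..len G f} (\<phi>'' f)"
        using \<psi>(1) by (cases "f = e") (simp_all add: \<phi>''_def)
    qed
    also have "(\<Sum>f\<in>edges G. u f (len G f) * \<phi>' f (len G f) - u f 0 * \<phi>' f 0
      - (LINT x|lebesgue_on {0..len G f}. u f x * \<phi>'' f x)
      + (LINT x|lebesgue_on {0..len G f}. (q f x - M) * u f x * \<phi> f x)) =
      (\<Sum>f\<in>{e}. u f (len G f) * \<phi>' f (len G f) - u f 0 * \<phi>' f 0
      - (LINT x|lebesgue_on {0..len G f}. u f x * \<phi>'' f x)
      + (LINT x|lebesgue_on {0..len G f}. (q f x - M) * u f x * \<phi> f x))"
      by (rule sum.mono_neutral_right) (use e finite_edges in \<open>auto simp: \<phi>_def \<phi>'_def \<phi>''_def\<close>)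
    finally have "(LINT x|lebesgue_on {0..len G e}. u e x * \<psi>'' x) = (LINT x|lebesgue_on {0..len G e}. (q e x - M) * u e x * \<phi> e x)"
      by (simp add: \<phi>'_def \<phi>''_def \<psi>)
    also have "\<dots> = (LINT x|lebesgue_on {0..len G e}. (q e x - M) * u e x * \<psi> x)"
      by (intro Bochner_Integration.integral_cong refl) (simp add: \<phi>_def)
    finally show "(LINT x|lebesgue_on {0..len G e}. u e x * \<psi>'' x) = (LINT x|lebesgue_on {0..len G e}. (q e x - M) * u e x * \<psi> x)" .
  qed blast
  have "\<exists>u'. \<forall>e\<in>edges G. (\<forall>x\<in>{0..len G e}. (u e has_real_derivative u' e x) (at x within {0..len G e})) \<and>
      (\<forall>x\<in>{0..len G e}. u' e x = u' e 0 + (LINT y|lebesgue_on {0..x}. (q e y - M) * u e y))"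
    by (rule bchoice, rule ballI, rule edge)
  then obtain u' where
    der: "\<And>e x. e \<in> edges G \<Longrightarrow> x \<in> {0..len G e} \<Longrightarrow> (u e has_real_derivative u' e x) (at x within {0..len G e})"
    and int: "\<And>e x. e \<in> edges G \<Longrightarrow> x \<in> {0..len G e} \<Longrightarrow> u' e x = u' e 0 + (LINT y|lebesgue_on {0..x}. (q e y - M) * u e y)"
    by blast
  have cu': "continuous_on {0..len G e} (u' e)" if "e \<in> edges G" for e
    by (rule indefinite_integral_continuous[OF kb[OF that] int[OF that]])
  show ?thesis
  proof (rule real_eig_I[OF q _ der int])
    show "u e x = 0" if "(e, x) \<notin> edge_points G" for e x
      using lim that by (simp add: edgewise_limit_def)
    show "end_val G u a = end_val G u b" if "v \<in> verts G" "a \<in> v" "b \<in> v" for v a b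
      by (rule edgewise_limit_vertex[OF U lim that])
    fix v assume v: "v \<in> verts G"
    text \<open>Test with the edgewise affine function that is 1 at \<open>v\<close> and 0 at the other vertices.\<close>
    define ind :: "'e \<times> bool \<Rightarrow> real" where "ind a = (if a \<in> v then 1 else 0)" for a
    define s where "s e = (ind (e, True) - ind (e, False)) / len G e" for e
    define \<phi> where "\<phi> = (\<lambda>e x. if (e, x) \<in> edge_points G then ind (e, False) + s e * x else 0)"
    have d1: "(\<phi> e has_real_derivative s e) (at x within {0..len G e})"
      if e: "e \<in> edges G" "x \<in> {0..len G e}" for e x
    proof -
      have "((\<lambda>x. ind (e, False) + s e * x) has_real_derivative s e) (at x within {0..len G e})"
        by (auto intro!: derivative_eq_intros)
      then show ?thesis
        by (rule has_field_derivative_transform_within[of _ _ _ _ 1]) (use e in \<open>auto simp: \<phi>_def edge_points_def\<close>)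
    qed
    have ends: "\<phi> e 0 = ind (e, False)" "\<phi> e (len G e) = ind (e, True)" if "e \<in> edges G" for e
      using len_pos[OF that] that by (auto simp: \<phi>_def s_def edge_points_def)
    have end_val: "end_val G \<phi> a = ind a" if "fst a \<in> edges G" for a
      using ends[OF that] by (cases a) (auto simp: end_val_def)
    have \<phi>V: "\<phi> \<in> V"
    proof (rule C1_I[where u' = "\<lambda>e x. s e"])
      fix w a b assume w: "w \<in> verts G" "a \<in> w" "b \<in> w"
      have "w = v \<or> w \<inter> v = {}"
        using w(1) v partition_verts by (auto simp: partition_on_def disjoint_def)
      then have "ind a = ind b" using w by (auto simp: ind_def)
      then show "end_val G \<phi> a = end_val G \<phi> b"
        using end_val[OF vert_edge[OF w(1,2)]] end_val[OF vert_edge[OF w(1,3)]] by simp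
    qed (auto simp: \<phi>_def intro: d1[unfolded \<phi>_def])
    have "(\<Sum>e\<in>edges G. u e (len G e) * s e - u e 0 * s e
      - (LINT x|lebesgue_on {0..len G e}. u e x * 0)
      + (LINT x|lebesgue_on {0..len G e}. (q e x - M) * u e x * \<phi> e x)) = 0"
      by (rule weak_limit_identity[OF q U lim weak[OF \<phi>V] \<phi>V _ d1]) auto
    moreover have "u e (len G e) * s e - u e 0 * s e - (LINT x|lebesgue_on {0..len G e}. u e x * 0)
      + (LINT x|lebesgue_on {0..len G e}. (q e x - M) * u e x * \<phi> e x) =
      - (end_slope G u' (e, True) * ind (e, True)) + - (end_slope G u' (e, False) * ind (e, False))"
      if e: "e \<in> edges G" for e
    proof -
      have "(LINT x|lebesgue_on {0..len G e}. (q e x - M) * u e x * \<phi> e x) =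
          u' e (len G e) * \<phi> e (len G e) - u' e 0 * \<phi> e 0 - (LINT x|lebesgue_on {0..len G e}. u' e x * s e)"
        by (rule integral_by_parts_indefinite[OF _ kb[OF e] int[OF e]])
          (use len_pos[OF e] d1[OF e] in auto)
      moreover have "(LINT x|lebesgue_on {0..len G e}. u' e x * s e) =
          u e (len G e) * s e - u e 0 * s e - (LINT x|lebesgue_on {0..len G e}. u e x * 0)"
        by (rule integral_by_parts_C1)
          (use len_pos[OF e] der[OF e] cu'[OF e] in auto)
      ultimately show ?thesis by (simp add: ends[OF e] end_slope_def)
    qed
    ultimately have "(\<Sum>e\<in>edges G. - (end_slope G u' (e, True) * ind (e, True)) + - (end_slope G u' (e, False) * ind (e, False))) = 0"
      by simp
    then have "(\<Sum>w\<in>verts G. \<Sum>a\<in>w. - (end_slope G u' a * ind a)) = 0"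
      using sum_over_ends[of "\<lambda>a. - (end_slope G u' a * ind a)"] by simp
    moreover have "finite (verts G)"
      using finite_elements[OF _ partition_verts] finite_edges by simp
    moreover have "(\<Sum>a\<in>w. - (end_slope G u' a * ind a)) = 0" if "w \<in> verts G - {v}" for w
    proof -
      have "w \<inter> v = {}"
        using that v partition_verts by (auto simp: partition_on_def disjoint_def)
      then show ?thesis by (intro sum.neutral) (auto simp: ind_def)
    qed
    ultimately have "(\<Sum>a\<in>v. - (end_slope G u' a * ind a)) = 0"
      using sum.remove[of "verts G" v "\<lambda>w. \<Sum>a\<in>w. - (end_slope G u' a * ind a)"] v
        sum.neutral[of "verts G - {v}" "\<lambda>w. \<Sum>a\<in>w. - (end_slope G u' a * ind a)"] by auto
    moreover have "(\<Sum>a\<in>v. - (end_slope G u' a * ind a)) = - (\<Sum>a\<in>v. end_slope G u' a)"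
      unfolding sum_negf[symmetric] by (rule sum.cong) (auto simp: ind_def)
    ultimately show "(\<Sum>a\<in>v. end_slope G u' a) = 0" by simp
  qed
qed

lemma edgewise_limit_const: "u \<in> V \<Longrightarrow> edgewise_limit G (\<lambda>n. u) u"
  by (auto simp: edgewise_limit_def C1_zero uniform_limit_iff)

text \<open>A function of the space is the limit of its own constant sequence, so the limit theorem
  contains the regularity of weak solutions. The weak form is visibly linear, which gives linear
  combinations of eigenfunctions without touching second derivatives.\<close>

lemma real_eig_iff_weak:
  assumes q: "q \<in> Linfty G"
  shows "real_eig G q M u \<longleftrightarrow> u \<in> V \<and> (\<forall>\<phi>\<in>V. qform G q u \<phi> = M * ip G u \<phi>)"
proof
  assume "u \<in> V \<and> (\<forall>\<phi>\<in>V. qform G q u \<phi> = M * ip G u \<phi>)"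
  then show "real_eig G q M u"
    by (intro weak_limit_real_eig[where U = "\<lambda>n. u", OF q _ edgewise_limit_const]) auto
qed (use real_eig_weak[OF q] real_eig_C1[OF q] in blast)

end

section \<open>Minimizers of the quadratic form\<close>

lemma uniform_limit_subseq:
  assumes "uniform_limit S f l sequentially" "strict_mono (r :: nat \<Rightarrow> nat)"
  shows "uniform_limit S (\<lambda>n. f (r n)) l sequentially"
  by (rule filterlim_compose[OF assms(1) filterlim_subseq[OF assms(2)]])

context compact_graph
begin

lemma qform_lower_bound:
  assumes "q \<in> Linfty G"
  obtains K where "K > 0" "\<And>u. u \<in> V \<Longrightarrow> dirichlet G u u - K * ip G u u \<le> qform G q u u"
proof -
  obtain K where K: "K > 0" "\<And>e. e \<in> edges G \<Longrightarrow> AE x in lebesgue_on {0..len G e}. \<bar>q e x\<bar> \<le> K"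
    using Linfty_bound[OF assms] by blast
  have "dirichlet G u u - K * ip G u u \<le> qform G q u u" if "u \<in> V" for u
    using weighted_ip_abs_le[OF assms K(2) that] by (simp add: qform_def abs_le_iff)
  with K(1) show ?thesis using that by blast
qed

lemma edge_dirichlet_le:
  "e \<in> edges G \<Longrightarrow> (LINT x|lebesgue_on {0..len G e}. ederiv G u e x * ederiv G u e x) \<le> dirichlet G u u"
  unfolding dirichlet_def by (rule edge_integral_le_graph_integral[OF finite_edges]) simp_all

lemma edge_ip_le:
  "e \<in> edges G \<Longrightarrow> (LINT x|lebesgue_on {0..len G e}. u e x * u e x) \<le> ip G u u"
  unfolding ip_def by (rule edge_integral_le_graph_integral[OF finite_edges]) simp_all

text \<open>Norm and energy together bound the functions uniformly, and the energy alone gives a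
  Hoelder bound of exponent one half, hence equicontinuity.\<close>

lemma edge_arzela_ascoli:
  assumes U: "\<And>n. U n \<in> V" and A: "\<And>n. ip G (U n) (U n) \<le> A" and D: "\<And>n. dirichlet G (U n) (U n) \<le> D"
    and e: "e \<in> edges G"
  obtains g and r :: "nat \<Rightarrow> nat" where "strict_mono r" "uniform_limit {0..len G e} (\<lambda>n. U (r n) e) g sequentially"
proof -
  let ?L = "len G e"
  have L: "0 < ?L" by (rule len_pos[OF e])
  have D0: "D \<ge> 0" using D[of 0] dirichlet_nonneg[of "U 0"] by linarith
  define M where "M = sqrt (2 / ?L * A + 2 * ?L * D)"
  have bound: "\<bar>U n e x\<bar> \<le> M" if x: "x \<in> {0..?L}" for n x
  proof -
    have "(U n e x)\<^sup>2 \<le> 2 / ?L * (LINT t|lebesgue_on {0..?L}. U n e t * U n e t) +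
        2 * ?L * (LINT t|lebesgue_on {0..?L}. ederiv G (U n) e t * ederiv G (U n) e t)"
      by (rule C1_square_le[OF L C1_ederiv_continuous[OF U e] C1_ederiv[OF U e] x])
    also have "\<dots> \<le> 2 / ?L * A + 2 * ?L * D"
      using L by (intro add_mono mult_left_mono order_trans[OF edge_ip_le[OF e] A]
          order_trans[OF edge_dirichlet_le[OF e] D]) auto
    finally have "sqrt ((U n e x)\<^sup>2) \<le> M" unfolding M_def by (rule real_sqrt_le_mono)
    then show ?thesis by simp
  qed
  have hoelder: "(U n e y - U n e x)\<^sup>2 \<le> \<bar>y - x\<bar> * D" if xy: "x \<in> {0..?L}" "y \<in> {0..?L}" for n x y
  proof -
    have "(U n e y - U n e x)\<^sup>2 \<le> \<bar>y - x\<bar> * (LINT t|lebesgue_on {0..?L}. ederiv G (U n) e t * ederiv G (U n) e t)"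
      by (rule C1_increment_square_le[OF C1_ederiv_continuous[OF U e] C1_ederiv[OF U e] xy])
    also have "\<dots> \<le> \<bar>y - x\<bar> * D"
      by (intro mult_left_mono order_trans[OF edge_dirichlet_le[OF e] D]) auto
    finally show ?thesis .
  qed
  obtain g k where "continuous_on {0..?L} g" "strict_mono (k :: nat \<Rightarrow> nat)"
    and lim: "\<And>s. 0 < s \<Longrightarrow> \<exists>N. \<forall>n x. n \<ge> N \<and> x \<in> {0..?L} \<longrightarrow> norm (U (k n) e x - g x) < s"
  proof (rule Arzela_Ascoli[of "{0..?L}" "\<lambda>n. U n e" M])
    fix x s :: real assume x: "x \<in> {0..?L}" and s: "0 < s"
    show "\<exists>d. 0 < d \<and> (\<forall>n y. y \<in> {0..?L} \<and> norm (x - y) < d \<longrightarrow> norm (U n e x - U n e y) < s)"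
    \<comment> \<open>The denominator \<open>D + 1\<close> avoids division by zero when the energies
      vanish.\<close>
    proof (intro exI[of _ "s\<^sup>2 / (D + 1)"] conjI allI impI)
      show "0 < s\<^sup>2 / (D + 1)" using s D0 by simp
      fix n y assume y: "y \<in> {0..?L} \<and> norm (x - y) < s\<^sup>2 / (D + 1)"
      have "(U n e x - U n e y)\<^sup>2 \<le> \<bar>x - y\<bar> * D" using y x hoelder by blast
      also have "\<dots> \<le> \<bar>x - y\<bar> * (D + 1)" by (intro mult_left_mono) auto
      also have "\<dots> < s\<^sup>2" using y D0 by (simp add: less_divide_eq)
      finally have "\<bar>U n e x - U n e y\<bar>\<^sup>2 < s\<^sup>2" by simp
      then show "norm (U n e x - U n e y) < s"
        using s power2_less_imp_less[of "\<bar>U n e x - U n e y\<bar>" s] by simp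
    qed
  qed (use bound in auto)
  have "uniform_limit {0..?L} (\<lambda>n. U (k n) e) g sequentially"
    unfolding uniform_limit_iff eventually_sequentially
  proof (intro allI impI)
    fix s :: real assume "0 < s"
    from lim[OF this] show "\<exists>N. \<forall>n\<ge>N. \<forall>x\<in>{0..?L}. dist (U (k n) e x) (g x) < s"
      unfolding dist_norm by blast
  qed
  with \<open>strict_mono k\<close> show ?thesis by (rule that)
qed

text \<open>Rellich-type compactness. With finitely many edges it is enough to refine the
  subsequence once per edge; no diagonal argument is involved.\<close>

theorem compact_embedding:
  assumes q: "q \<in> Linfty G" and U: "\<And>n. U n \<in> V"
    and A: "\<And>n. ip G (U n) (U n) \<le> A" and B: "\<And>n. qform G q (U n) (U n) \<le> B"
  obtains r :: "nat \<Rightarrow> nat" and u where "strict_mono r" "edgewise_limit G (\<lambda>n. U (r n)) u"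
proof -
  obtain K where K: "K > 0" "\<And>u. u \<in> V \<Longrightarrow> dirichlet G u u - K * ip G u u \<le> qform G q u u"
    using qform_lower_bound[OF q] by blast
  \<comment> \<open>The potential can lower the form by at most \<open>K\<close> times the squared
    norm, so bounds on form and norm bound the energy.\<close>
  have D: "dirichlet G (U n) (U n) \<le> B + K * A" for n
    using K(2)[OF U[of n]] B[of n] mult_left_mono[OF A[of n], of K] K(1) by linarith
  have "\<exists>r :: nat \<Rightarrow> nat. strict_mono r \<and> (\<forall>e\<in>F. \<exists>g. uniform_limit {0..len G e} (\<lambda>n. U (r n) e) g sequentially)"
    if "finite F" "F \<subseteq> edges G" for F
    using that
  proof (induction F rule: finite_induct)
    case empty
    show ?case by (intro exI[of _ id]) (auto simp: strict_mono_def)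
  next
    case (insert e F)
    then obtain r :: "nat \<Rightarrow> nat" where r: "strict_mono r"
      "\<forall>e\<in>F. \<exists>g. uniform_limit {0..len G e} (\<lambda>n. U (r n) e) g sequentially" by auto
    obtain g s where s: "strict_mono (s :: nat \<Rightarrow> nat)"
      "uniform_limit {0..len G e} (\<lambda>n. U (r (s n)) e) g sequentially"
    proof (rule edge_arzela_ascoli[where U = "\<lambda>n. U (r n)", OF U A D])
      show "e \<in> edges G" using insert.prems by simp
    qed blast
    show ?case
    proof (intro exI[of _ "r \<circ> s"] conjI ballI)
      show "strict_mono (r \<circ> s)" using r(1) s(1) by (rule strict_mono_o)
      fix f assume "f \<in> insert e F"
      then show "\<exists>g. uniform_limit {0..len G f} (\<lambda>n. U ((r \<circ> s) n) f) g sequentially"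
      proof
        assume "f \<in> F"
        then obtain h where "uniform_limit {0..len G f} (\<lambda>n. U (r n) f) h sequentially" using r(2) by blast
        from uniform_limit_subseq[OF this s(1)] show ?thesis by (intro exI[of _ h]) simp
      qed (use s(2) in auto)
    qed
  qed
  from this[OF finite_edges order_refl] obtain r :: "nat \<Rightarrow> nat" where r: "strict_mono r"
    "\<forall>e\<in>edges G. \<exists>g. uniform_limit {0..len G e} (\<lambda>n. U (r n) e) g sequentially" by blast
  from bchoice[OF r(2)] obtain g where
    g: "\<forall>e\<in>edges G. uniform_limit {0..len G e} (\<lambda>n. U (r n) e) (g e) sequentially" by blast
  define u where "u = (\<lambda>e x. if (e, x) \<in> edge_points G then g e x else 0)"
  have "edgewise_limit G (\<lambda>n. U (r n)) u"
    unfolding edgewise_limit_def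
  proof (intro conjI allI impI ballI)
    fix e assume e: "e \<in> edges G"
    have "uniform_limit {0..len G e} (\<lambda>n. U (r n) e) (g e) sequentially" using g e by blast
    then show "uniform_limit {0..len G e} (\<lambda>n. U (r n) e) (u e) sequentially"
      by (rule uniform_limit_cong'[THEN iffD1, rotated 2]) (use e in \<open>auto simp: u_def edge_points_def\<close>)
  qed (simp add: u_def)
  with r(1) show ?thesis by (rule that)
qed

text \<open>\<open>\<phi>\<close> may be replaced by a \<open>\<phi>\<^sub>0\<close> in \<open>W\<close>, and Cauchy--Schwarz on \<open>W\<close> shows that a minimizing
  sequence satisfies the eigenvalue equation asymptotically.\<close>

lemma minimizing_sequence_real_eig:
  assumes q: "q \<in> Linfty G" and W: "subspace W" "W \<subseteq> V"
    and psd: "\<And>w. w \<in> W \<Longrightarrow> M * ip G w w \<le> qform G q w w"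
    and U: "\<And>n. U n \<in> W" and lim: "edgewise_limit G U u"
    and conv: "(\<lambda>n. qform G q (U n) (U n) - M * ip G (U n) (U n)) \<longlonglongrightarrow> 0"
    and split: "\<And>\<phi>. \<phi> \<in> V \<Longrightarrow> \<exists>\<phi>0\<in>W. \<forall>w\<in>W. qform G q w \<phi> - M * ip G w \<phi> = qform G q w \<phi>0 - M * ip G w \<phi>0"
  shows "real_eig G q M u"
proof (rule weak_limit_real_eig[OF q _ lim])
  show "U n \<in> V" for n using U W(2) by blast
  fix \<phi> assume "\<phi> \<in> V"
  then obtain \<phi>0 where \<phi>0: "\<phi>0 \<in> W"
    "\<And>w. w \<in> W \<Longrightarrow> qform G q w \<phi> - M * ip G w \<phi> = qform G q w \<phi>0 - M * ip G w \<phi>0"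
    using split by blast
  define b where "b u v = qform G q u v + (- M) * ip G u v" for u v
  interpret b: sym_form V b
    unfolding b_def[abs_def] by (rule sym_form_combination[OF sym_form_qform[OF q] sym_form_ip])
  have cs: "(b (U n) \<phi>0)\<^sup>2 \<le> b (U n) (U n) * b \<phi>0 \<phi>0" for n
    by (rule b.cauchy_schwarz[OF W _ U \<phi>0(1)]) (use psd in \<open>auto simp: b_def\<close>)
  have "(\<lambda>n. b (U n) (U n) * b \<phi>0 \<phi>0) \<longlonglongrightarrow> 0 * b \<phi>0 \<phi>0"
    using conv by (intro tendsto_mult tendsto_const) (simp add: b_def)
  then have conv0: "(\<lambda>n. b (U n) (U n) * b \<phi>0 \<phi>0) \<longlonglongrightarrow> 0" by simp
  have "(\<lambda>n. (b (U n) \<phi>0)\<^sup>2) \<longlonglongrightarrow> 0"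
    by (rule Lim_null_comparison[OF _ conv0]) (simp add: cs)
  then have "(\<lambda>n. \<bar>b (U n) \<phi>0\<bar>) \<longlonglongrightarrow> 0"
    using tendsto_real_sqrt[of "\<lambda>n. (b (U n) \<phi>0)\<^sup>2" 0] by simp
  then have "(\<lambda>n. b (U n) \<phi>0) \<longlonglongrightarrow> 0" by (rule tendsto_rabs_zero_cancel)
  then show "(\<lambda>n. qform G q (U n) \<phi> - M * ip G (U n) \<phi>) \<longlonglongrightarrow> 0"
    using \<phi>0(2)[OF U] by (simp add: b_def)
qed

section \<open>Constrained minimization of the quadratic form\<close>

definition orthonormal :: "('e \<Rightarrow> real \<Rightarrow> real) set \<Rightarrow> bool" where
  "orthonormal F \<longleftrightarrow> F \<subseteq> V \<and> (\<forall>f\<in>F. \<forall>g\<in>F. ip G f g = (if f = g then 1 else 0))"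

definition orth_compl :: "('e \<Rightarrow> real \<Rightarrow> real) set \<Rightarrow> ('e \<Rightarrow> real \<Rightarrow> real) set" where
  "orth_compl F = {w \<in> V. \<forall>f\<in>F. ip G w f = 0}"

lemma subspace_orth_compl:
  assumes "F \<subseteq> V"
  shows "subspace (orth_compl F)"
proof -
  interpret i: sym_form V "ip G" by (rule sym_form_ip)
  show ?thesis
    unfolding orth_compl_def using assms
    by (intro subspaceI) (auto simp: i.add_left i.scale_left i.zero_left i.add_in i.scale_in i.zero_in subset_iff)
qed

lemma orth_projection:
  assumes F: "finite F" "orthonormal F" and u: "u \<in> V"
  shows "u - (\<Sum>f\<in>F. ip G u f *\<^sub>R f) \<in> orth_compl F"
proof -
  interpret i: sym_form V "ip G" by (rule sym_form_ip)
  have FV: "f \<in> V" if "f \<in> F" for f using F(2) that by (auto simp: orthonormal_def)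
  have s: "(\<Sum>f\<in>F. ip G u f *\<^sub>R f) \<in> V" by (intro i.sum_in i.scale_in FV)
  have "ip G (u - (\<Sum>f\<in>F. ip G u f *\<^sub>R f)) g = 0" if g: "g \<in> F" for g
  proof -
    have "ip G (\<Sum>f\<in>F. ip G u f *\<^sub>R f) g = (\<Sum>f\<in>F. ip G (ip G u f *\<^sub>R f) g)"
      by (rule i.sum_left[OF _ FV[OF g]]) (rule i.scale_in[OF FV])
    also have "\<dots> = (\<Sum>f\<in>F. ip G u f * ip G f g)"
      by (rule sum.cong[OF refl]) (rule i.scale_left[OF FV FV[OF g]])
    also have "\<dots> = (\<Sum>f\<in>F. if f = g then ip G u g else 0)"
      by (rule sum.cong) (use F(2) g in \<open>auto simp: orthonormal_def\<close>)
    also have "\<dots> = ip G u g" using F(1) g by simp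
    finally show ?thesis using i.diff_left[OF u s FV[OF g]] by simp
  qed
  then show ?thesis using i.diff_in[OF u s] by (simp add: orth_compl_def)
qed

lemma normalize:
  assumes "u \<in> V" "u \<noteq> 0"
  shows "ip G ((1 / sqrt (ip G u u)) *\<^sub>R u) ((1 / sqrt (ip G u u)) *\<^sub>R u) = 1"
proof -
  interpret i: sym_form V "ip G" by (rule sym_form_ip)
  have "ip G u u \<noteq> 0" using ip_eq_0 assms by blast
  then have "ip G u u > 0" using ip_nonneg[of u] by linarith
  then show ?thesis using assms(1) by (simp add: i.scale_left i.scale_right i.scale_in)
qed

text \<open>If \<open>f\<close> is an eigenfunction and \<open>w\<close> is orthogonal to it, then
  the form also vanishes on the pair \<open>f\<close>, \<open>w\<close>. The constrained subspace
  thus reduces the form: the component of a test function along \<open>F\<close> contributes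
  nothing, and the constrained minimizer satisfies the unconstrained eigenvalue equation. The vector
  \<open>w0\<close> ensures that there is something to minimize over.\<close>

theorem minimizer_exists:
  assumes q: "q \<in> Linfty G" and F: "finite F" "orthonormal F"
    and eig: "\<And>f. f \<in> F \<Longrightarrow> \<exists>l. real_eig G q l f"
    and w0: "w0 \<in> orth_compl F" "w0 \<noteq> 0"
  obtains M u where "u \<in> orth_compl F" "ip G u u = 1" "real_eig G q M u"
    "\<And>w. w \<in> orth_compl F \<Longrightarrow> M * ip G w w \<le> qform G q w w"
proof -
  interpret i: sym_form V "ip G" by (rule sym_form_ip)
  interpret h: sym_form V "qform G q" by (rule sym_form_qform[OF q])
  let ?W = "orth_compl F"
  have FV: "F \<subseteq> V" using F(2) by (simp add: orthonormal_def)
  have W: "subspace ?W" "?W \<subseteq> V" using subspace_orth_compl[OF FV] by (auto simp: orth_compl_def)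
  define S where "S = {qform G q w w |w. w \<in> ?W \<and> ip G w w = 1}"
  have normal: "(1 / sqrt (ip G w w)) *\<^sub>R w \<in> ?W \<and> ip G ((1 / sqrt (ip G w w)) *\<^sub>R w) ((1 / sqrt (ip G w w)) *\<^sub>R w) = 1"
    if "w \<in> ?W" "w \<noteq> 0" for w
    using that W normalize by (blast intro: subspace_scale)
  have S_ne: "S \<noteq> {}" using normal[OF w0] unfolding S_def by blast
  obtain K where K: "K > 0" "\<And>u. u \<in> V \<Longrightarrow> dirichlet G u u - K * ip G u u \<le> qform G q u u"
    using qform_lower_bound[OF q] by blast
  have S_bdd: "bdd_below S"
  proof (rule bdd_belowI)
    fix y assume "y \<in> S"
    then obtain w where "w \<in> ?W" "ip G w w = 1" "y = qform G q w w" by (auto simp: S_def)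
    then show "- K \<le> y" using K(2)[of w] dirichlet_nonneg[of w] W(2) by auto
  qed
  define M where "M = Inf S"
  have psd: "M * ip G w w \<le> qform G q w w" if w: "w \<in> ?W" for w
  proof (cases "w = 0")
    case True then show ?thesis by (simp add: i.zero_left h.zero_left i.zero_in)
  next
    case False
    have wV: "w \<in> V" using w W(2) by blast
    have pos: "ip G w w > 0" using ip_eq_0[OF wV] ip_nonneg[of w] False by linarith
    have "qform G q ((1 / sqrt (ip G w w)) *\<^sub>R w) ((1 / sqrt (ip G w w)) *\<^sub>R w) \<in> S"
      using normal[OF w False] unfolding S_def by blast
    then have "M \<le> qform G q ((1 / sqrt (ip G w w)) *\<^sub>R w) ((1 / sqrt (ip G w w)) *\<^sub>R w)"
      unfolding M_def by (rule cInf_lower[OF _ S_bdd])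
    also have "\<dots> = qform G q w w / ip G w w"
      using wV pos by (simp add: h.scale_left h.scale_right h.scale_in)
    finally show ?thesis using pos by (simp add: le_divide_eq)
  qed
  have "\<exists>w. w \<in> ?W \<and> ip G w w = 1 \<and> qform G q w w < M + 1 / real (Suc n)" for n
  proof -
    have "Inf S < M + 1 / real (Suc n)" by (simp add: M_def)
    from cInf_lessD[OF S_ne this] show ?thesis by (auto simp: S_def)
  qed
  then obtain U where U: "\<And>n. U n \<in> ?W" "\<And>n. ip G (U n) (U n) = 1"
      "\<And>n. qform G q (U n) (U n) < M + 1 / real (Suc n)" by metis
  have UV: "U n \<in> V" for n using U(1) W(2) by blast
  have bd: "qform G q (U n) (U n) \<le> M + 1" for n
    using U(3)[of n] by (rule order_trans[OF less_imp_le]) simp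
  obtain r u where r: "strict_mono r" and lim: "edgewise_limit G (\<lambda>n. U (r n)) u"
    by (rule compact_embedding[OF q UV eq_refl[OF U(2)] bd])
  have UrV: "U (r n) \<in> V" for n by (rule UV)
  have conv: "(\<lambda>n. qform G q (U n) (U n) - M * ip G (U n) (U n)) \<longlonglongrightarrow> 0"
  proof (rule Lim_null_comparison)
    show "\<forall>\<^sub>F n in sequentially. norm (qform G q (U n) (U n) - M * ip G (U n) (U n)) \<le> 1 / real (Suc n)"
      using U(3) psd[OF U(1)] by (auto simp: U(2) less_imp_le abs_le_iff algebra_simps)
    show "(\<lambda>n. 1 / real (Suc n)) \<longlonglongrightarrow> 0" using LIMSEQ_inverse_real_of_nat by (simp add: inverse_eq_divide)
  qed
  have re: "real_eig G q M u"
  proof (rule minimizing_sequence_real_eig[OF q W psd U(1) lim])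
    show "(\<lambda>n. qform G q (U (r n)) (U (r n)) - M * ip G (U (r n)) (U (r n))) \<longlonglongrightarrow> 0"
      using LIMSEQ_subseq_LIMSEQ[OF conv r] by (simp add: o_def)
    fix \<phi> assume \<phi>: "\<phi> \<in> V"
    define \<phi>1 where "\<phi>1 = (\<Sum>f\<in>F. ip G \<phi> f *\<^sub>R f)"
    have p: "\<phi> - \<phi>1 \<in> ?W" unfolding \<phi>1_def by (rule orth_projection[OF F \<phi>])
    have "qform G q w \<phi> - M * ip G w \<phi> = qform G q w (\<phi> - \<phi>1) - M * ip G w (\<phi> - \<phi>1)" if w: "w \<in> ?W" for w
    proof -
      have wV: "w \<in> V" using w W(2) by blast
      have fV: "ip G \<phi> f *\<^sub>R f \<in> V" if "f \<in> F" for f using FV that i.scale_in by blast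
      have \<phi>1V: "\<phi>1 \<in> V" unfolding \<phi>1_def by (rule i.sum_in[OF fV])
      have z: "qform G q f w = 0 \<and> ip G f w = 0" if f: "f \<in> F" for f
      proof -
        have "ip G f w = 0" using w f i.comm[OF wV, of f] FV by (auto simp: orth_compl_def)
        moreover obtain l where "real_eig G q l f" using eig[OF f] by blast
        ultimately show ?thesis using real_eig_weak[OF q _ wV] by simp
      qed
      have "qform G q \<phi>1 w = 0"
        unfolding \<phi>1_def using z FV by (subst h.sum_left[OF fV wV]) (auto simp: h.scale_left wV subset_iff)
      moreover have "ip G \<phi>1 w = 0"
        unfolding \<phi>1_def using z FV by (subst i.sum_left[OF fV wV]) (auto simp: i.scale_left wV subset_iff)
      ultimately show ?thesis
        using h.diff_right[OF \<phi> \<phi>1V wV] i.diff_right[OF \<phi> \<phi>1V wV] h.comm[OF \<phi>1V wV] i.comm[OF \<phi>1V wV] by simp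
    qed
    then show "\<exists>\<phi>0\<in>?W. \<forall>w\<in>?W. qform G q w \<phi> - M * ip G w \<phi> = qform G q w \<phi>0 - M * ip G w \<phi>0"
      using p by blast
  qed
  have uV: "u \<in> V" by (rule real_eig_C1[OF q re])
  show ?thesis
  proof (rule that[OF _ _ re psd])
    \<comment> \<open>Uniform convergence preserves the norm, so the limit is not the zero
      function.\<close>
    show "ip G u u = 1"
      using LIMSEQ_unique[OF edgewise_limit_ip_self[OF UrV lim]] by (simp add: U(2))
    have "ip G u f = 0" if f: "f \<in> F" for f
    proof -
      have "f \<in> V" using FV f by blast
      moreover have "ip G (U n) f = 0" for n using U(1) f by (auto simp: orth_compl_def)
      ultimately show ?thesis using LIMSEQ_unique[OF edgewise_limit_ip[OF UrV lim]] by simp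
    qed
    then show "u \<in> ?W" using uV by (simp add: orth_compl_def)
  qed
qed

end

section \<open>Simplicity of the lowest eigenvalue\<close>

context compact_graph
begin

text \<open>Lets functions be given by formulas on the edges and then cut off to satisfy the
  convention off the graph. One-sided derivatives within the interval do not notice the cut.\<close>

lemma C1_extend_by_zero:
  assumes "\<And>e. e \<in> edges G \<Longrightarrow> continuous_on {0..len G e} (w' e)"
    and "\<And>e x. e \<in> edges G \<Longrightarrow> x \<in> {0..len G e} \<Longrightarrow> (w e has_real_derivative w' e x) (at x within {0..len G e})"
    and "\<And>v a b. v \<in> verts G \<Longrightarrow> a \<in> v \<Longrightarrow> b \<in> v \<Longrightarrow> end_val G w a = end_val G w b"
  defines "u \<equiv> (\<lambda>e x. if (e, x) \<in> edge_points G then w e x else 0)"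
  shows "u \<in> V" "\<And>e x. e \<in> edges G \<Longrightarrow> x \<in> {0..len G e} \<Longrightarrow> ederiv G u e x = w' e x"
proof -
  have d: "(u e has_real_derivative w' e x) (at x within {0..len G e})"
    if e: "e \<in> edges G" "x \<in> {0..len G e}" for e x
    by (rule has_field_derivative_transform_within[OF assms(2)[OF e], of 1])
      (use e in \<open>auto simp: u_def edge_points_def\<close>)
  have ev: "end_val G u a = end_val G w a" if "fst a \<in> edges G" for a
    using len_pos[OF that] that by (auto simp: end_val_def u_def edge_points_def)
  show "u \<in> V"
  proof (rule C1_I[where u' = w'])
    show "u e x = 0" if "(e, x) \<notin> edge_points G" for e x using that by (simp add: u_def)
    show "end_val G u a = end_val G u b" if v: "v \<in> verts G" "a \<in> v" "b \<in> v" for v a b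
      unfolding ev[OF vert_edge[OF v(1,2)]] ev[OF vert_edge[OF v(1,3)]] by (rule assms(3)[OF v])
  qed (rule assms(1) d; assumption)+
  show "ederiv G u e x = w' e x" if "e \<in> edges G" "x \<in> {0..len G e}" for e x
    by (rule ederiv_eqI[where u = u, OF that d[OF that]])
qed

text \<open>\<open>|u|\<close> is the limit of the \<open>C\<^sup>1\<close> functions \<open>sqrt (u\<^sup>2 + s\<^sup>2)\<close>, whose Dirichlet integral is at
  most that of \<open>u\<close>.\<close>

lemma abs_real_eig:
  assumes q: "q \<in> Linfty G" and psd: "\<And>w. w \<in> V \<Longrightarrow> M * ip G w w \<le> qform G q w w"
    and u: "real_eig G q M u"
  shows "real_eig G q M (\<lambda>e x. \<bar>u e x\<bar>)"
proof -
  have uV: "u \<in> V" by (rule real_eig_C1[OF q u])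
  define s where "s n = 1 / real (Suc n)" for n
  have s: "s n > 0" for n by (simp add: s_def)
  have s0: "s \<longlonglongrightarrow> 0"
    unfolding s_def using LIMSEQ_inverse_real_of_nat by (simp add: inverse_eq_divide)
  define R where "R n e x = sqrt ((u e x)\<^sup>2 + (s n)\<^sup>2)" for n e x
  have pos: "(u e x)\<^sup>2 + (s n)\<^sup>2 > 0" for n e x
    using s[of n] by (simp add: add_nonneg_pos)
  then have Rpos: "R n e x > 0" for n e x by (simp add: R_def)
  define U where "U n = (\<lambda>e x. if (e, x) \<in> edge_points G then R n e x else 0)" for n
  define R' where "R' n e x = u e x * ederiv G u e x / R n e x" for n e x
  have R'c: "continuous_on {0..len G e} (R' n e)" if "e \<in> edges G" for n e
    unfolding R'_def R_def using pos
    by (intro continuous_intros C1_continuous_edge[OF uV that] C1_ederiv_continuous[OF uV that])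
      (use s[of n] in simp)
  have R'd: "(R n e has_real_derivative R' n e x) (at x within {0..len G e})"
    if e: "e \<in> edges G" "x \<in> {0..len G e}" for n e x
  proof -
    have "((\<lambda>x. (u e x)\<^sup>2 + (s n)\<^sup>2) has_real_derivative 2 * u e x * ederiv G u e x) (at x within {0..len G e})"
      by (rule derivative_eq_intros C1_ederiv[OF uV e] refl | simp)+
    from DERIV_chain2[OF DERIV_real_sqrt[OF pos] this]
    have "((\<lambda>x. sqrt ((u e x)\<^sup>2 + (s n)\<^sup>2)) has_real_derivative
        inverse (sqrt ((u e x)\<^sup>2 + (s n)\<^sup>2)) / 2 * (2 * u e x * ederiv G u e x)) (at x within {0..len G e})" .
    moreover have "R n e = (\<lambda>x. sqrt ((u e x)\<^sup>2 + (s n)\<^sup>2))" by (simp add: R_def fun_eq_iff)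
    moreover have "inverse (sqrt ((u e x)\<^sup>2 + (s n)\<^sup>2)) / 2 * (2 * u e x * ederiv G u e x) = R' n e x"
      unfolding R_def[symmetric] R'_def using Rpos[of n e x] by (simp add: field_simps)
    ultimately show ?thesis by simp
  qed
  have Rv: "end_val G (R n) a = end_val G (R n) b" if "v \<in> verts G" "a \<in> v" "b \<in> v" for n v a b
    using C1_vertex[OF uV that] by (simp add: end_val_def R_def)
  have UV: "U n \<in> V" for n
    unfolding U_def
    by (rule C1_extend_by_zero(1)[where w' = "R' n"]) (rule R'c R'd Rv; assumption)+
  have Ud: "ederiv G (U n) e x = R' n e x" if e: "e \<in> edges G" "x \<in> {0..len G e}" for n e x
    unfolding U_def
    by (rule C1_extend_by_zero(2)[where w' = "R' n", OF _ _ _ e]) (rule R'c R'd Rv; assumption)+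
  have lim: "edgewise_limit G U (\<lambda>e x. \<bar>u e x\<bar>)"
    unfolding edgewise_limit_def
  proof (intro conjI allI impI ballI)
    show "\<bar>u e x\<bar> = 0" if "(e, x) \<notin> edge_points G" for e x using C1_zero[OF uV that] by simp
    fix e assume e: "e \<in> edges G"
    show "uniform_limit {0..len G e} (\<lambda>n. U n e) (\<lambda>x. \<bar>u e x\<bar>) sequentially"
      unfolding uniform_limit_iff
    proof (intro allI impI)
      fix r :: real assume "r > 0"
      then have "\<forall>\<^sub>F n in sequentially. s n < r" by (rule order_tendstoD(2)[OF s0])
      then show "\<forall>\<^sub>F n in sequentially. \<forall>x\<in>{0..len G e}. dist (U n e x) \<bar>u e x\<bar> < r"
      proof eventually_elim
        case (elim n)
        show ?case
        proof
          fix x assume x: "x \<in> {0..len G e}"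
          have "U n e x = R n e x" using e x by (simp add: U_def edge_points_def)
          moreover have "\<bar>u e x\<bar> \<le> R n e x" unfolding R_def by (rule real_sqrt_ge_abs1)
          moreover have "R n e x \<le> \<bar>u e x\<bar> + s n"
            unfolding R_def using s[of n] by (intro real_le_lsqrt) (auto simp: power2_sum)
          ultimately show "dist (U n e x) \<bar>u e x\<bar> < r" using elim by (simp add: dist_real_def)
        qed
      qed
    qed
  qed
  \<comment> \<open>The Dirichlet part does not increase, and the square of the regularized function
    exceeds that of \<open>u\<close> by exactly \<open>(s n)\<^sup>2\<close>, so the remaining part
    changes by a multiple of \<open>(s n)\<^sup>2\<close>. Since \<open>u\<close> itself attains the
    minimum, this sequence is minimizing.\<close>
  have le: "qform G q (U n) (U n) - M * ip G (U n) (U n) \<le> (s n)\<^sup>2 * graph_integral G (\<lambda>e x. q e x - M)" for n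
  proof -
    have "dirichlet G (U n) (U n) \<le> dirichlet G u u"
      unfolding dirichlet_def
    proof (rule graph_integral_mono_AE)
      fix e assume e: "e \<in> edges G"
      show "AE x in lebesgue_on {0..len G e}. ederiv G (U n) e x * ederiv G (U n) e x \<le> ederiv G u e x * ederiv G u e x"
      proof (intro AE_I2)
        fix x assume "x \<in> space (lebesgue_on {0..len G e})"
        then have x: "x \<in> {0..len G e}" by simp
        have "(u e x)\<^sup>2 \<le> (R n e x)\<^sup>2" using pos[of e x n] by (simp add: R_def)
        then have "(u e x / R n e x)\<^sup>2 \<le> 1" using Rpos[of n e x] by (simp add: power_divide)
        then have "(u e x / R n e x)\<^sup>2 * (ederiv G u e x)\<^sup>2 \<le> 1 * (ederiv G u e x)\<^sup>2"
          by (intro mult_right_mono) auto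
        then show "ederiv G (U n) e x * ederiv G (U n) e x \<le> ederiv G u e x * ederiv G u e x"
          unfolding Ud[OF e x] R'_def by (simp add: power2_eq_square mult_ac)
      qed
    qed (intro Linfty_mult ederiv_Linfty UV uV)+
    moreover have "weighted_ip G q (U n) (U n) - M * ip G (U n) (U n) =
        (weighted_ip G q u u - M * ip G u u) + (s n)\<^sup>2 * graph_integral G (\<lambda>e x. q e x - M)"
    proof -
      have *: "weighted_ip G q w w - M * ip G w w = graph_integral G (\<lambda>e x. (q e x - M) * (w e x * w e x))"
        if "w \<in> V" for w
        unfolding weighted_ip_def ip_def graph_integral_cmult[symmetric] left_diff_distrib
        by (rule graph_integral_diff[symmetric]) (intro Linfty_mult Linfty_const q C1_Linfty that)+
      have "graph_integral G (\<lambda>e x. (q e x - M) * (U n e x * U n e x)) =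
          graph_integral G (\<lambda>e x. (q e x - M) * (u e x * u e x) + (s n)\<^sup>2 * (q e x - M))"
      proof (rule graph_integral_cong)
        fix e x assume e: "e \<in> edges G" "x \<in> {0..len G e}"
        have "U n e x * U n e x = (R n e x)\<^sup>2" using e by (simp add: U_def edge_points_def power2_eq_square)
        also have "\<dots> = u e x * u e x + (s n)\<^sup>2" using pos[of e x n] by (simp add: R_def power2_eq_square)
        finally show "(q e x - M) * (U n e x * U n e x) = (q e x - M) * (u e x * u e x) + (s n)\<^sup>2 * (q e x - M)"
          by (simp add: algebra_simps)
      qed
      also have "\<dots> = graph_integral G (\<lambda>e x. (q e x - M) * (u e x * u e x)) + (s n)\<^sup>2 * graph_integral G (\<lambda>e x. q e x - M)"
        unfolding graph_integral_cmult[symmetric]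
        by (rule graph_integral_add) (intro Linfty_mult Linfty_diff Linfty_const q C1_Linfty uV)+
      finally show ?thesis using *[OF UV] *[OF uV] by simp
    qed
    moreover have "qform G q u u - M * ip G u u = 0" using real_eig_weak[OF q u uV] by simp
    ultimately show ?thesis by (simp add: qform_def)
  qed
  show ?thesis
  proof (rule minimizing_sequence_real_eig[OF q subspace_C1 order_refl psd UV lim])
    show "(\<lambda>n. qform G q (U n) (U n) - M * ip G (U n) (U n)) \<longlonglongrightarrow> 0"
    proof (rule tendsto_sandwich[OF _ _ tendsto_const])
      show "\<forall>\<^sub>F n in sequentially. 0 \<le> qform G q (U n) (U n) - M * ip G (U n) (U n)"
        using psd[OF UV] by simp
      show "\<forall>\<^sub>F n in sequentially. qform G q (U n) (U n) - M * ip G (U n) (U n) \<le> (s n)\<^sup>2 * graph_integral G (\<lambda>e x. q e x - M)"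
        using le by simp
      have "(\<lambda>n. (s n)\<^sup>2 * graph_integral G (\<lambda>e x. q e x - M)) \<longlonglongrightarrow> 0\<^sup>2 * graph_integral G (\<lambda>e x. q e x - M)"
        by (intro tendsto_intros s0)
      then show "(\<lambda>n. (s n)\<^sup>2 * graph_integral G (\<lambda>e x. q e x - M)) \<longlonglongrightarrow> 0" by simp
    qed
  next
    fix \<phi> assume "\<phi> \<in> V"
    then show "\<exists>\<phi>0\<in>V. \<forall>w\<in>V. qform G q w \<phi> - M * ip G w \<phi> = qform G q w \<phi>0 - M * ip G w \<phi>0"
      by (intro bexI[of _ \<phi>]) auto
  qed
qed

section \<open>Connectedness and the absence of zeros\<close>

lemma glue_edge_points: "(p, p') \<in> glue G \<Longrightarrow> p \<in> edge_points G \<and> p' \<in> edge_points G"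
  unfolding glue_def by blast

text \<open>The edges with and without the property give unions of whole edges that are saturated
  for the gluing, so their images in the quotient are open and disjoint and cover it. Connectedness
  forces one of them to be empty.\<close>

lemma connected_edge_induct:
  assumes conn: "connected_space (graph_space G)" and e0: "e0 \<in> edges G" "Z e0"
    and glued: "\<And>p p'. (p, p') \<in> glue G \<Longrightarrow> Z (fst p) \<Longrightarrow> Z (fst p')" and e: "e \<in> edges G"
  shows "Z e"
proof (rule ccontr)
  assume "\<not> Z e"
  define I where "I f = {0..len G f}" for f
  define S where "S Q = Sigma {f \<in> edges G. Q f} I" for Q
  define E where "E Q = (\<lambda>p. glue G `` {p}) ` S Q" for Q
  have sub: "S Q \<subseteq> edge_points G" for Q by (auto simp: S_def I_def edge_points_def)
  have glue_refl: "p \<in> edge_points G \<Longrightarrow> (p, p) \<in> glue G" for p by (simp add: glue_def)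
  have glue_sym: "(p, p') \<in> glue G \<Longrightarrow> (p', p) \<in> glue G" for p p' unfolding glue_def by blast
  have glue_in: "(p, p') \<in> glue G \<Longrightarrow> p' \<in> edge_points G" for p p' by (auto simp: glue_def)
  have op: "openin (graph_space G) (E Q)"
    if Q: "\<And>p p'. (p, p') \<in> glue G \<Longrightarrow> Q (fst p) \<Longrightarrow> Q (fst p')" for Q
    unfolding openin_graph_space
  proof
    show "E Q \<subseteq> edge_points G // glue G" using sub by (auto simp: E_def quotient_def)
    have "{p \<in> edge_points G. glue G `` {p} \<in> E Q} = S Q"
    proof (intro equalityI subsetI)
      fix p assume "p \<in> {p \<in> edge_points G. glue G `` {p} \<in> E Q}"
      then obtain p' where p: "p \<in> edge_points G" "p' \<in> S Q" "glue G `` {p} = glue G `` {p'}"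
        by (auto simp: E_def)
      then have "(p', p) \<in> glue G" using glue_refl[OF p(1)] by blast
      moreover have "Q (fst p')" using p(2) by (auto simp: S_def)
      ultimately have "Q (fst p)" by (rule Q)
      then show "p \<in> S Q" using p(1) by (auto simp: S_def I_def edge_points_def)
    qed (use sub in \<open>auto simp: E_def\<close>)
    moreover have "openin (edges_topology G) (S Q)"
      unfolding edges_topology_def openin_sum_topology
    proof (intro conjI ballI)
      fix f assume f: "f \<in> edges G"
      have "{x. (f, x) \<in> S Q} = (if Q f then {0..len G f} else {})"
        using f by (auto simp: S_def I_def)
      then show "openin (top_of_set {0..len G f}) {x. (f, x) \<in> S Q}" by simp
    qed (auto simp: S_def I_def)
    ultimately show "openin (edges_topology G) {p \<in> edge_points G. glue G `` {p} \<in> E Q}" by simp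
  qed
  have 1: "openin (graph_space G) (E Z)" by (rule op) (rule glued)
  \<comment> \<open>Gluing is symmetric, so the negated property passes across glued points as
    well.\<close>
  have 2: "openin (graph_space G) (E (\<lambda>f. \<not> Z f))"
    by (rule op) (use glued glue_sym in blast)
  have "topspace (graph_space G) \<subseteq> edge_points G // glue G"
    using openin_graph_space[of G "topspace (graph_space G)"] by simp
  also have "\<dots> \<subseteq> E Z \<union> E (\<lambda>f. \<not> Z f)"
    by (auto simp: quotient_def E_def S_def I_def edge_points_def)
  finally have 3: "topspace (graph_space G) \<subseteq> E Z \<union> E (\<lambda>f. \<not> Z f)" .
  have 4: "E Z \<inter> E (\<lambda>f. \<not> Z f) = {}"
  proof (rule ccontr)
    assume "E Z \<inter> E (\<lambda>f. \<not> Z f) \<noteq> {}"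
    then obtain p p' where p: "p \<in> S Z" "p' \<in> S (\<lambda>f. \<not> Z f)" "glue G `` {p} = glue G `` {p'}"
      by (auto simp: E_def)
    then have "(p, p') \<in> glue G" using glue_refl[of p'] sub by blast
    then show False using glued p by (auto simp: S_def)
  qed
  have "(e0, 0) \<in> S Z" "(e, 0) \<in> S (\<lambda>f. \<not> Z f)"
    using e0 e \<open>\<not> Z e\<close> len_pos by (auto simp: S_def I_def less_imp_le)
  then have "E Z \<noteq> {}" "E (\<lambda>f. \<not> Z f) \<noteq> {}" unfolding E_def by blast+
  with 1 2 3 4 conn show False unfolding connected_space_def by blast
qed

text \<open>A zero is a minimum. Inside an edge this makes the derivative vanish; at a vertex all
  slopes into the edges are non-negative and sum to zero by the Kirchhoff condition, so each of them
  vanishes. Uniqueness for the initial value problem then kills the whole edge, and glued points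
  carry the zero to neighbouring edges.\<close>

lemma nonneg_real_eig_zero:
  assumes q: "q \<in> Linfty G" and conn: "connected_space (graph_space G)"
    and u: "real_eig G q M u" and nonneg: "\<And>e x. 0 \<le> u e x"
    and e0: "e0 \<in> edges G" "x0 \<in> {0..len G e0}" "u e0 x0 = 0"
  shows "u = 0"
proof -
  have uV: "u \<in> V" by (rule real_eig_C1[OF q u])
  obtain u' where
    der: "\<And>e x. e \<in> edges G \<Longrightarrow> x \<in> {0..len G e} \<Longrightarrow> (u e has_real_derivative u' e x) (at x within {0..len G e})"
    and int: "\<And>e x. e \<in> edges G \<Longrightarrow> x \<in> {0..len G e} \<Longrightarrow>
      u' e x = u' e 0 + (LINT y|lebesgue_on {0..x}. (q e y - M) * u e y)"
    and kir: "\<And>v. v \<in> verts G \<Longrightarrow> (\<Sum>a\<in>v. end_slope G u' a) = 0"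
    by (rule real_eig_classical[OF q u]) (rule that; assumption)
  obtain K where K: "K > 0" "\<And>e. e \<in> edges G \<Longrightarrow> AE x in lebesgue_on {0..len G e}. \<bar>q e x - M\<bar> \<le> K"
    using Linfty_bound[OF Linfty_diff[OF q Linfty_const]] by blast
  have edge_zero: "u e y = 0" if e: "e \<in> edges G" and x: "x \<in> {0..len G e}" "u e x = 0" "u' e x = 0"
    and y: "y \<in> {0..len G e}" for e x y
  proof (rule ode_unique_zero[OF der[OF e] int[OF e] _ _ K(1) x y])
    show "integrable (lebesgue_on {0..len G e}) (\<lambda>y. (q e y - M) * u e y)"
      by (intro integrable_ess_bounded ess_bounded_intros Linfty_D[OF q e] Linfty_D[OF C1_Linfty[OF uV] e])
    show "AE x in lebesgue_on {0..len G e}. \<bar>(q e x - M) * u e x\<bar> \<le> K * \<bar>u e x\<bar>"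
      using K(2)[OF e] by eventually_elim (auto simp: abs_mult intro: mult_right_mono)
  qed
  have slope_nonneg: "0 \<le> end_slope G u' a" if a: "fst a \<in> edges G" "end_val G u a = 0" for a
  proof (rule ccontr)
    obtain e b where [simp]: "a = (e, b)" by (cases a)
    have e: "e \<in> edges G" using a by simp
    note L = len_pos[OF e]
    assume neg: "\<not> 0 \<le> end_slope G u' a"
    show False
    proof (cases b)
      case True
      then have "u' e (len G e) > 0" "u e (len G e) = 0" using neg a by (auto simp: end_slope_def end_val_def)
      then obtain d where d: "d > 0" "\<And>h. h > 0 \<Longrightarrow> len G e - h \<in> {0..len G e} \<Longrightarrow> h < d \<Longrightarrow> u e (len G e - h) < u e (len G e)"
        using has_real_derivative_pos_inc_left[OF der[OF e, of "len G e"]] L by auto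
      have "u e (len G e - min (d/2) (len G e)) < u e (len G e)" using d(1) L by (intro d(2)) auto
      then show False using \<open>u e (len G e) = 0\<close> nonneg by (simp add: not_less[symmetric])
    next
      case False
      then have "u' e 0 < 0" "u e 0 = 0" using neg a by (auto simp: end_slope_def end_val_def)
      then obtain d where d: "d > 0" "\<And>h. h > 0 \<Longrightarrow> 0 + h \<in> {0..len G e} \<Longrightarrow> h < d \<Longrightarrow> u e (0 + h) < u e 0"
        using has_real_derivative_neg_dec_right[OF der[OF e, of 0]] L by auto
      have "u e (0 + min (d/2) (len G e)) < u e 0" using d(1) L by (intro d(2)) auto
      then show False using \<open>u e 0 = 0\<close> nonneg by (simp add: not_less[symmetric])
    qed
  qed
  have slope_zero: "end_slope G u' a = 0" if a: "fst a \<in> edges G" "end_val G u a = 0" for a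
  proof -
    have "a \<in> edges G \<times> UNIV" using a by (simp add: mem_Times_iff)
    then obtain v where v: "v \<in> verts G" "a \<in> v"
      using partition_verts by (auto simp: partition_on_def)
    have fin: "finite v"
      using v(1) partition_verts finite_edges by (intro finite_subset[of v "edges G \<times> UNIV"]) (auto simp: partition_on_def)
    have "0 \<le> end_slope G u' b" if b: "b \<in> v" for b
      using slope_nonneg[OF vert_edge[OF v(1) b]] C1_vertex[OF uV v(1) b v(2)] a(2) by simp
    then show ?thesis using kir[OF v(1)] sum_nonneg_eq_0_iff[OF fin, of "end_slope G u'"] v(2) by auto
  qed
  have point: "u e y = 0" if e: "e \<in> edges G" and x: "x \<in> {0..len G e}" "u e x = 0" and y: "y \<in> {0..len G e}" for e x y
  proof -
    have "u' e x = 0"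
    proof (cases "x = 0 \<or> x = len G e")
      case True
      then show ?thesis
        using slope_zero[of "(e, False)"] slope_zero[of "(e, True)"] e x by (auto simp: end_val_def end_slope_def)
    next
      case False
      then have xi: "x \<in> {0<..<len G e}" using x by auto
      then have "(u e has_real_derivative u' e x) (at x)"
        using der[OF e x(1)] at_within_interior[of x "{0..len G e}"] by simp
      then show ?thesis
        by (rule DERIV_local_min[of _ _ _ 1]) (use x nonneg in auto)
    qed
    then show ?thesis using edge_zero[OF e x _ y] by simp
  qed
  have "\<forall>y\<in>{0..len G e}. u e y = 0" if "e \<in> edges G" for e
  proof (rule connected_edge_induct[where Z = "\<lambda>e. \<forall>y\<in>{0..len G e}. u e y = 0", OF conn e0(1) _ _ that])
    show "\<forall>y\<in>{0..len G e0}. u e0 y = 0" using point[OF e0] by blast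
    fix p p' assume pp: "(p, p') \<in> glue G" and z: "\<forall>y\<in>{0..len G (fst p)}. u (fst p) y = 0"
    have p: "fst p \<in> edges G" "snd p \<in> {0..len G (fst p)}" and p': "fst p' \<in> edges G" "snd p' \<in> {0..len G (fst p')}"
      using glue_edge_points[OF pp] by (auto simp: edge_points_def)
    have "u (fst p') (snd p') = u (fst p) (snd p)"
    proof (cases "p = p'")
      case False
      then obtain v a b where v: "v \<in> verts G" "a \<in> v" "b \<in> v" "p = endpoint G a" "p' = endpoint G b"
        using pp by (auto simp: glue_def)
      then show ?thesis using C1_vertex[OF uV v(1-3)] by (simp add: end_val_def endpoint_def)
    qed simp
    then have "u (fst p') (snd p') = 0" using z p by simp
    then show "\<forall>y\<in>{0..len G (fst p')}. u (fst p') y = 0" using point[OF p'] by blast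
  qed
  then have "u e x = 0" for e x
    using C1_zero[OF uV, of e x] by (cases "(e, x) \<in> edge_points G") (auto simp: edge_points_def)
  then show ?thesis by (simp add: fun_eq_iff)
qed

lemma real_eig_combination:
  assumes q: "q \<in> Linfty G" and u: "real_eig G q M u" and w: "real_eig G q M w"
  shows "real_eig G q M (s *\<^sub>R u + t *\<^sub>R w)"
proof -
  interpret i: sym_form V "ip G" by (rule sym_form_ip)
  interpret h: sym_form V "qform G q" by (rule sym_form_qform[OF q])
  show ?thesis
    using u w unfolding real_eig_iff_weak[OF q]
    by (auto simp: i.add_left h.add_left i.scale_left h.scale_left i.add_in i.scale_in algebra_simps)
qed

text \<open>Subtracting from \<open>w\<close> the multiple of \<open>u\<close> that agrees with it
  at one point where \<open>u\<close> is nonzero gives an eigenfunction \<open>z\<close> with a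
  zero. Its absolute value is a non-negative eigenfunction with a zero, hence trivial.\<close>

theorem ground_state_simple:
  assumes q: "q \<in> Linfty G" and conn: "connected_space (graph_space G)"
    and psd: "\<And>w. w \<in> V \<Longrightarrow> M * ip G w w \<le> qform G q w w"
    and u: "real_eig G q M u" "u \<noteq> 0" and w: "real_eig G q M w"
  obtains c where "w = c *\<^sub>R u"
proof -
  have uV: "u \<in> V" by (rule real_eig_C1[OF q u(1)])
  obtain e x where "u e x \<noteq> 0" using u(2) by (auto simp: fun_eq_iff)
  then have e: "e \<in> edges G" "x \<in> {0..len G e}"
    using C1_zero[OF uV, of e x] by (auto simp: edge_points_def)
  define z where "z = 1 *\<^sub>R w + (- (w e x / u e x)) *\<^sub>R u"
  have z: "real_eig G q M z" unfolding z_def by (rule real_eig_combination[OF q w u(1)])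
  have "(\<lambda>e x. \<bar>z e x\<bar>) = 0"
  proof (rule nonneg_real_eig_zero[OF q conn abs_real_eig[OF q psd z] _ e])
    show "\<bar>z e x\<bar> = 0" using \<open>u e x \<noteq> 0\<close> by (simp add: z_def)
  qed simp_all
  then have z0: "z e x = 0" for e x by (simp add: fun_eq_iff)
  have "w = (w e x / u e x) *\<^sub>R u"
  proof (intro ext)
    fix f y
    show "w f y = ((w e x / u e x) *\<^sub>R u) f y" using z0[of f y] by (simp add: z_def)
  qed
  then show ?thesis by (rule that)
qed

end

section \<open>Counting eigenvalues\<close>

context compact_graph
begin

lemma real_eig_orthogonal:
  assumes q: "q \<in> Linfty G" and f: "real_eig G q l f" and g: "real_eig G q m g" and "l \<noteq> m"
  shows "ip G f g = 0"
proof -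
  interpret i: sym_form V "ip G" by (rule sym_form_ip)
  interpret h: sym_form V "qform G q" by (rule sym_form_qform[OF q])
  have V: "f \<in> V" "g \<in> V" using real_eig_C1[OF q] f g by blast+
  have "l * ip G f g = m * ip G f g"
    using real_eig_weak[OF q f V(2)] real_eig_weak[OF q g V(1)]
    unfolding h.comm[OF V] i.comm[OF V] by linarith
  then show ?thesis using \<open>l \<noteq> m\<close> by simp
qed

lemma ip_one_nonzero: "ip G u u = 1 \<Longrightarrow> u \<noteq> 0"
  using sym_form.zero_left[OF sym_form_ip sym_form.zero_in[OF sym_form_ip]] by force

lemma real_eig_eigenvalue_unique:
  assumes q: "q \<in> Linfty G" and f: "real_eig G q l f" "real_eig G q m f" "f \<noteq> 0"
  shows "l = m"
proof (rule ccontr)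
  assume "l \<noteq> m"
  then have "ip G f f = 0" by (rule real_eig_orthogonal[OF q f(1,2)])
  then show False using ip_eq_0[OF real_eig_C1[OF q f(1)]] f(3) by blast
qed

section \<open>Discreteness of the spectrum\<close>

lemma no_bounded_orthonormal_sequence:
  fixes U :: "nat \<Rightarrow> 'e \<Rightarrow> real \<Rightarrow> real"
  assumes q: "q \<in> Linfty G" and U: "\<And>n. U n \<in> V" and B: "\<And>n. qform G q (U n) (U n) \<le> B"
    and on: "\<And>m n. ip G (U m) (U n) = (if m = n then 1 else 0)"
  shows False
proof -
  have ip1: "ip G (U n) (U n) \<le> 1" for n by (simp add: on)
  obtain r u where r: "strict_mono (r :: nat \<Rightarrow> nat)" and lim: "edgewise_limit G (\<lambda>n. U (r n)) u"
    by (rule compact_embedding[OF q U ip1 B])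
  have UrV: "U (r n) \<in> V" for n by (rule U)
  \<comment> \<open>The limit is orthogonal to every member of the subsequence, hence to its own
    limit, while its norm is 1.\<close>
  have "ip G u (U (r m)) = 0" for m
  proof -
    have "(\<lambda>n. ip G (U (r n)) (U (r m))) \<longlonglongrightarrow> ip G u (U (r m))"
      by (rule edgewise_limit_ip[OF UrV lim UrV])
    moreover have "(\<lambda>n. ip G (U (r n)) (U (r m))) \<longlonglongrightarrow> 0"
    proof (rule tendsto_eventually)
      show "\<forall>\<^sub>F n in sequentially. ip G (U (r n)) (U (r m)) = 0"
        using eventually_gt_at_top[of m] by eventually_elim (use r in \<open>auto simp: on strict_mono_eq\<close>)
    qed
    ultimately show ?thesis by (rule LIMSEQ_unique)
  qed
  moreover have "(\<lambda>n. ip G u (U (r n))) \<longlonglongrightarrow> ip G u u"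
  proof -
    \<comment> \<open>Here \<open>u\<close> is known only to be continuous, so it cannot serve as a
      partner in \<open>edgewise_limit_ip\<close>; it is used as a bounded weight instead.\<close>
    have "u \<in> Linfty G"
      unfolding Linfty_iff by (intro ballI ess_bounded_continuous edgewise_limit_continuous[OF UrV lim])
    from edgewise_limit_integral[OF UrV lim this] show ?thesis by (simp add: ip_def)
  qed
  ultimately have "ip G u u = 0" using LIMSEQ_unique[of "\<lambda>_. 0" 0 "ip G u u"] by simp
  moreover have "ip G u u = 1"
    using LIMSEQ_unique[OF edgewise_limit_ip_self[OF UrV lim]] by (simp add: on)
  ultimately show False by simp
qed

definition eig_system :: "('e \<Rightarrow> real \<Rightarrow> real) \<Rightarrow> real \<Rightarrow> ('e \<Rightarrow> real \<Rightarrow> real) set \<Rightarrow> bool" where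
  "eig_system q \<mu> F \<longleftrightarrow> finite F \<and> orthonormal F \<and> (\<forall>f\<in>F. \<exists>l\<le>\<mu>. real_eig G q l f)"

text \<open>If every finite system could be enlarged, repeated choice would produce an infinite
  orthonormal sequence of eigenfunctions whose form values stay below \<open>\<mu>\<close>, against
  compactness.\<close>

lemma eig_system_maximal:
  assumes q: "q \<in> Linfty G"
  obtains F where "eig_system q \<mu> F"
    "\<And>u l. u \<in> orth_compl F \<Longrightarrow> real_eig G q l u \<Longrightarrow> l \<le> \<mu> \<Longrightarrow> ip G u u \<noteq> 1"
proof (rule ccontr)
  assume neg: "\<not> thesis"
  note max = that
  define P where "P F u \<longleftrightarrow> u \<in> orth_compl F \<and> (\<exists>l\<le>\<mu>. real_eig G q l u) \<and> ip G u u = 1" for F u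
  have ex: "\<exists>u. P F u" if "eig_system q \<mu> F" for F
    using neg max[OF that] unfolding P_def by blast
  define new where "new F = (SOME u. P F u)" for F
  have new: "P F (new F)" if "eig_system q \<mu> F" for F
    unfolding new_def by (rule someI_ex[OF ex[OF that]])
  define S where "S = rec_nat {} (\<lambda>_ F. insert (new F) F)"
  have S_simps: "S 0 = {}" "S (Suc n) = insert (new (S n)) (S n)" for n by (simp_all add: S_def)
  define U where "U n = new (S n)" for n
  interpret i: sym_form V "ip G" by (rule sym_form_ip)
  have S: "eig_system q \<mu> (S n)" for n
  proof (induction n)
    case 0
    then show ?case by (simp add: S_simps eig_system_def orthonormal_def)
  next
    case (Suc n)
    from new[OF Suc] have n: "new (S n) \<in> V" "\<forall>f\<in>S n. ip G (new (S n)) f = 0"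
      "\<exists>l\<le>\<mu>. real_eig G q l (new (S n))" "ip G (new (S n)) (new (S n)) = 1"
      by (auto simp: P_def orth_compl_def)
    have on: "S n \<subseteq> V" "\<forall>f\<in>S n. \<forall>g\<in>S n. ip G f g = (if f = g then 1 else 0)"
      using Suc by (auto simp: eig_system_def orthonormal_def)
    have sym: "\<forall>f\<in>S n. ip G f (new (S n)) = 0"
    proof
      fix f assume f: "f \<in> S n"
      then have "f \<in> V" using on(1) by blast
      from i.comm[OF this n(1)] show "ip G f (new (S n)) = 0" using n(2) f by simp
    qed
    have notin: "new (S n) \<notin> S n" using n(2,4) by auto
    show ?case
      using Suc n on sym notin unfolding eig_system_def orthonormal_def S_simps by auto
  qed
  have PU: "P (S n) (U n)" for n unfolding U_def by (rule new[OF S])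
  have UV: "U n \<in> V" for n using PU[of n] by (simp add: P_def orth_compl_def)
  have U_in: "U m \<in> S n" if "m < n" for m n
    using that by (induction n) (auto simp: S_simps U_def less_Suc_eq)
  show False
  proof (rule no_bounded_orthonormal_sequence[OF q UV])
    show "qform G q (U n) (U n) \<le> \<mu>" for n
    proof -
      obtain l where "l \<le> \<mu>" "real_eig G q l (U n)" "ip G (U n) (U n) = 1" using PU[of n] by (auto simp: P_def)
      then show ?thesis using real_eig_weak[OF q _ UV] by simp
    qed
    show "ip G (U m) (U n) = (if m = n then 1 else 0)" for m n
    proof (cases m n rule: linorder_cases)
      case less
      then show ?thesis using PU[of n] U_in[OF less] i.comm[OF UV UV] by (auto simp: P_def orth_compl_def)
    next
      case equal
      then show ?thesis using PU[of n] by (simp add: P_def)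
    next
      case greater
      then show ?thesis using PU[of m] U_in[OF greater] by (auto simp: P_def orth_compl_def)
    qed
  qed
qed

text \<open>For a maximal system, components of an eigenfunction along members with another
  eigenvalue vanish by orthogonality, and a nonzero residue orthogonal to the system could be
  normalized and added to it. One finite set therefore spans all eigenspaces up to
  \<open>\<mu>\<close> simultaneously.\<close>

lemma finite_spectrum:
  assumes q: "q \<in> Linfty G"
  obtains F where "finite F" "F \<subseteq> V" "0 \<notin> F"
    "\<And>l u. real_eig G q l u \<Longrightarrow> l \<le> \<mu> \<Longrightarrow> u \<in> span {f \<in> F. real_eig G q l f}"
proof -
  interpret i: sym_form V "ip G" by (rule sym_form_ip)
  obtain F where F: "eig_system q \<mu> F" and
    max: "\<And>u l. u \<in> orth_compl F \<Longrightarrow> real_eig G q l u \<Longrightarrow> l \<le> \<mu> \<Longrightarrow> ip G u u \<noteq> 1"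
    using eig_system_maximal[OF q] by blast
  have fin: "finite F" and on: "orthonormal F" and eig: "\<And>f. f \<in> F \<Longrightarrow> \<exists>l\<le>\<mu>. real_eig G q l f"
    using F by (auto simp: eig_system_def)
  have FV: "F \<subseteq> V" using on by (simp add: orthonormal_def)
  have "0 \<notin> F" using on i.zero_left[OF i.zero_in] by (auto simp: orthonormal_def)
  moreover have "u \<in> span {f \<in> F. real_eig G q l f}" if u: "real_eig G q l u" "l \<le> \<mu>" for l u
  proof -
    have uV: "u \<in> V" by (rule real_eig_C1[OF q u(1)])
    let ?E = "{f \<in> F. real_eig G q l f}"
    define p where "p = (\<Sum>f\<in>?E. ip G u f *\<^sub>R f)"
    have p_eq: "(\<Sum>f\<in>F. ip G u f *\<^sub>R f) = p"
      unfolding p_def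
    proof (rule sum.mono_neutral_right[OF fin])
      show "\<forall>f\<in>F - ?E. ip G u f *\<^sub>R f = 0"
      proof
        fix f assume "f \<in> F - ?E"
        then obtain m where "real_eig G q m f" "m \<noteq> l" using eig by blast
        then show "ip G u f *\<^sub>R f = 0" using real_eig_orthogonal[OF q u(1)] by simp
      qed
    qed simp
    have comb: "real_eig G q l v \<Longrightarrow> real_eig G q l w \<Longrightarrow> real_eig G q l (v + c *\<^sub>R w)" for v w c
      using real_eig_combination[OF q, of l v w 1 c] by simp
    have "real_eig G q l (u - (\<Sum>f\<in>E. ip G u f *\<^sub>R f))" if "finite E" "E \<subseteq> ?E" for E
      using that
    proof (induction E rule: finite_induct)
      case (insert f E)
      have "real_eig G q l ((u - (\<Sum>f\<in>E. ip G u f *\<^sub>R f)) + (- ip G u f) *\<^sub>R f)"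
        by (intro comb insert.IH) (use insert.prems in blast)+
      moreover have "u - (\<Sum>f\<in>insert f E. ip G u f *\<^sub>R f) =
          (u - (\<Sum>f\<in>E. ip G u f *\<^sub>R f)) + (- ip G u f) *\<^sub>R f"
        unfolding sum.insert[OF insert.hyps(1,2)] by (simp add: fun_eq_iff)
      ultimately show ?case by metis
    qed (use u in simp)
    from this[of ?E] have ep: "real_eig G q l (u - p)" using fin by (simp add: p_def)
    have oc: "u - p \<in> orth_compl F" using orth_projection[OF fin on uV] by (simp add: p_eq)
    have "u - p = 0"
    proof (rule ccontr)
      assume ne: "u - p \<noteq> 0"
      define z where "z = (1 / sqrt (ip G (u - p) (u - p))) *\<^sub>R (u - p)"
      have "ip G z z = 1" unfolding z_def by (rule normalize[OF real_eig_C1[OF q ep] ne])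
      moreover have "z \<in> orth_compl F" unfolding z_def by (rule subspace_scale[OF subspace_orth_compl[OF FV] oc])
      moreover have "real_eig G q l z"
        unfolding z_def using real_eig_combination[OF q ep ep, of _ 0] by simp
      ultimately show False using max u(2) by blast
    qed
    then have "u = p" by simp
    moreover have "p \<in> span ?E" unfolding p_def by (intro span_sum span_scale span_base)
    ultimately show ?thesis by simp
  qed
  ultimately show ?thesis using fin FV that by blast
qed

section \<open>Complex eigenspaces, multiplicities and the eigenvalue count\<close>

lemma complexify_span:
  fixes u :: "'e \<Rightarrow> real \<Rightarrow> real"
  assumes "u \<in> span F"
  shows "complexify u \<in> cfun.span (complexify ` F)"
  using assms
proof (induction rule: span_induct_alt)
  case base
  have "complexify (0 :: 'e \<Rightarrow> real \<Rightarrow> real) = 0" by (simp add: complexify_def fun_eq_iff)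
  then show ?case using cfun.span_zero by metis
next
  case (step c x y)
  have "complexify (c *\<^sub>R x + y) = cscale (complex_of_real c) (complexify x) + complexify y"
    by (simp add: complexify_def cscale_def fun_eq_iff)
  then show ?case using step by (metis cfun.span_add cfun.span_scale cfun.span_base imageI)
qed

lemma eigenspace_subset_span:
  assumes "\<And>u. real_eig G q l u \<Longrightarrow> u \<in> span F"
  shows "eigenspace G q l \<subseteq> cfun.span (complexify ` F)"
proof
  fix w assume w: "w \<in> eigenspace G q l"
  have "w = complexify (\<lambda>e x. Re (w e x)) + cscale \<i> (complexify (\<lambda>e x. Im (w e x)))"
    by (simp add: complexify_def cscale_def fun_eq_iff complex_eq_iff)
  also have "\<dots> \<in> cfun.span (complexify ` F)"
    using assms eigenspace_Re[OF w] eigenspace_Im[OF w]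
    by (intro cfun.span_add cfun.span_scale complexify_span) auto
  finally show "w \<in> cfun.span (complexify ` F)" .
qed

lemma eigenspace_nonzero_real:
  assumes "w \<in> eigenspace G q l" "w \<noteq> 0"
  obtains u where "real_eig G q l u" "u \<noteq> 0"
proof -
  have "(\<lambda>e x. Re (w e x)) \<noteq> 0 \<or> (\<lambda>e x. Im (w e x)) \<noteq> 0"
    using assms(2) by (auto simp: fun_eq_iff complex_eq_iff)
  then show ?thesis using that eigenspace_Re[OF assms(1)] eigenspace_Im[OF assms(1)] by blast
qed

lemma complexify_eq_0: "complexify u = 0 \<longleftrightarrow> u = 0"
  by (simp add: complexify_def fun_eq_iff)

text \<open>Every eigenvalue up to \<open>\<mu>\<close> has an eigenfunction among finitely many
  nonzero functions, and a nonzero function belongs to only one eigenvalue, so the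
  \<open>SOME\<close> recovers it.\<close>

lemma finite_eigenvalues:
  assumes q: "q \<in> Linfty G"
  shows "finite {l. l \<le> \<mu> \<and> (\<exists>w\<in>eigenspace G q l. w \<noteq> 0)}"
proof -
  obtain F where F: "finite F" "F \<subseteq> V" "0 \<notin> F"
    "\<And>l u. real_eig G q l u \<Longrightarrow> l \<le> \<mu> \<Longrightarrow> u \<in> span {f \<in> F. real_eig G q l f}"
    using finite_spectrum[OF q] by blast
  have "{l. l \<le> \<mu> \<and> (\<exists>w\<in>eigenspace G q l. w \<noteq> 0)} \<subseteq> (\<lambda>f. SOME l. real_eig G q l f) ` F"
  proof
    fix l assume "l \<in> {l. l \<le> \<mu> \<and> (\<exists>w\<in>eigenspace G q l. w \<noteq> 0)}"
    then obtain w where w: "l \<le> \<mu>" "w \<in> eigenspace G q l" "w \<noteq> 0" by blast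
    obtain u where u: "real_eig G q l u" "u \<noteq> 0" by (rule eigenspace_nonzero_real[OF w(2,3)])
    have "{f \<in> F. real_eig G q l f} \<noteq> {}"
    proof
      assume "{f \<in> F. real_eig G q l f} = {}"
      then have "u \<in> span {}" using F(4)[OF u(1) w(1)] by metis
      then show False using u(2) by simp
    qed
    then obtain f where f: "f \<in> F" "real_eig G q l f" by blast
    then have "f \<noteq> 0" using F(3) by auto
    have "(SOME l. real_eig G q l f) = l"
    proof (rule some_equality)
      show "m = l" if "real_eig G q m f" for m
        by (rule real_eig_eigenvalue_unique[OF q that f(2) \<open>f \<noteq> 0\<close>])
    qed (rule f(2))
    then show "l \<in> (\<lambda>f. SOME l. real_eig G q l f) ` F" using f(1) by (metis image_eqI)
  qed
  then show ?thesis using F(1) by (rule finite_subset[OF _ finite_imageI])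
qed

text \<open>\<open>cfun.dim\<close> is the cardinality of a basis and would be 0 by default for an
  infinite one. The finite spanning set from \<open>finite_spectrum\<close> rules this out.\<close>

lemma multiplicity_ge:
  assumes q: "q \<in> Linfty G" and B: "B \<subseteq> eigenspace G q l" "cfun.independent B"
  shows "card B \<le> eig_multiplicity G q l"
proof -
  obtain F where F: "finite F" "\<And>u. real_eig G q l u \<Longrightarrow> u \<in> span {f \<in> F. real_eig G q l f}"
    using finite_spectrum[OF q, of l] by (metis order_refl)
  have sub: "eigenspace G q l \<subseteq> cfun.span (complexify ` {f \<in> F. real_eig G q l f})"
    by (rule eigenspace_subset_span) (rule F(2))
  obtain C where C: "C \<subseteq> eigenspace G q l" "cfun.independent C" "eigenspace G q l \<subseteq> cfun.span C"
      "card C = cfun.dim (eigenspace G q l)"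
    using cfun.basis_exists by blast
  have "finite C"
    using cfun.independent_span_bound[OF _ C(2), of "complexify ` {f \<in> F. real_eig G q l f}"] C(1) sub F(1) by auto
  then have "card B \<le> card C"
    using cfun.independent_span_bound[OF _ B(2), of C] B(1) C(3) by auto
  then show ?thesis by (simp add: C(4) eig_multiplicity_def)
qed

text \<open>Passing to a subset of the summation range is legitimate only because the range is
  finite; a sum over an infinite set would be 0.\<close>

lemma eigenvalue_count_ge:
  assumes q: "q \<in> Linfty G" and A: "finite A" "\<And>l. l \<in> A \<Longrightarrow> l \<le> \<mu> \<and> (\<exists>w\<in>eigenspace G q l. w \<noteq> 0)"
  shows "(\<Sum>l\<in>A. eig_multiplicity G q l) \<le> eigenvalue_count G q \<mu>"
  unfolding eigenvalue_count_def by (rule sum_mono2[OF finite_eigenvalues[OF q]]) (use A in auto)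

lemma eigenvalue_count_ge_1:
  assumes q: "q \<in> Linfty G" and u: "real_eig G q l u" "u \<noteq> 0" "l \<le> \<mu>"
  shows "1 \<le> eigenvalue_count G q \<mu>"
proof -
  have w: "complexify u \<in> eigenspace G q l" "complexify u \<noteq> 0"
    using u by (auto simp: real_eig_def complexify_eq_0)
  have "card {complexify u} \<le> eig_multiplicity G q l"
    by (rule multiplicity_ge[OF q]) (use w in auto)
  also have "\<dots> \<le> eigenvalue_count G q \<mu>"
    using eigenvalue_count_ge[OF q, of "{l}" \<mu>] w u(3) by auto
  finally show ?thesis by simp
qed

text \<open>If one real function is a complex multiple of another, it is already the multiple by the
  real part of the coefficient, which orthogonality excludes.\<close>

lemma complexify_independent_pair:
  assumes f: "f \<in> V" "f \<noteq> 0" and g: "g \<in> V" "g \<noteq> 0" and fg: "ip G f g = 0"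
  shows "cfun.independent {complexify f, complexify g}" "complexify f \<noteq> complexify g"
proof -
  interpret i: sym_form V "ip G" by (rule sym_form_ip)
  have ff: "ip G f f \<noteq> 0" using ip_eq_0[OF f(1)] f(2) by blast
  have "complexify f \<notin> cfun.span {complexify g}"
  proof
    assume "complexify f \<in> cfun.span {complexify g}"
    then obtain c where "complexify f = cscale c (complexify g)"
      by (auto simp: cfun.span_singleton)
    then have "f e x = Re c * g e x" for e x
      by (simp add: complexify_def cscale_def fun_eq_iff complex_eq_iff)
    then have "f = Re c *\<^sub>R g" by (simp add: fun_eq_iff)
    then have "ip G f f = Re c * ip G f g" using i.scale_right[OF g(1) f(1)] by metis
    then show False using ff fg by simp
  qed
  then show "cfun.independent {complexify f, complexify g}" "complexify f \<noteq> complexify g"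
    using g(2) by (auto simp: cfun.independent_insert complexify_eq_0 intro: cfun.span_base)
qed

lemma eigenvalue_count_ge_2:
  assumes q: "q \<in> Linfty G" and f: "real_eig G q l f" "f \<noteq> 0" "l \<le> \<mu>"
    and g: "real_eig G q m g" "g \<noteq> 0" "m \<le> \<mu>" and fg: "ip G f g = 0"
  shows "2 \<le> eigenvalue_count G q \<mu>"
proof -
  have V: "f \<in> V" "g \<in> V" using real_eig_C1[OF q] f g by blast+
  have w: "complexify f \<in> eigenspace G q l" "complexify f \<noteq> 0" "complexify g \<in> eigenspace G q m" "complexify g \<noteq> 0"
    using f g by (auto simp: real_eig_def complexify_eq_0)
  show ?thesis
  proof (cases "l = m")
    case True
    note ind = complexify_independent_pair[OF V(1) f(2) V(2) g(2) fg]
    have "card {complexify f, complexify g} \<le> eig_multiplicity G q l"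
      by (rule multiplicity_ge[OF q _ ind(1)]) (use w True in auto)
    also have "\<dots> \<le> eigenvalue_count G q \<mu>"
      using eigenvalue_count_ge[OF q, of "{l}" \<mu>] w f(3) by auto
    finally show ?thesis using ind(2) by simp
  next
    case False
    have "card {complexify f} \<le> eig_multiplicity G q l" "card {complexify g} \<le> eig_multiplicity G q m"
      by (rule multiplicity_ge[OF q]; use w in auto)+
    moreover have "(\<Sum>l\<in>{l, m}. eig_multiplicity G q l) \<le> eigenvalue_count G q \<mu>"
      by (rule eigenvalue_count_ge[OF q]) (use w f g in auto)
    ultimately show ?thesis using False by simp
  qed
qed

lemma eigenvalue_count_pos:
  assumes "1 \<le> eigenvalue_count G q \<mu>"
  obtains l u where "l \<le> \<mu>" "real_eig G q l u" "u \<noteq> 0"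
proof -
  have "{l. l \<le> \<mu> \<and> (\<exists>w\<in>eigenspace G q l. w \<noteq> 0)} \<noteq> {}"
    using assms unfolding eigenvalue_count_def by (metis sum.empty not_one_le_zero)
  then obtain l w where "l \<le> \<mu>" "w \<in> eigenspace G q l" "w \<noteq> 0" by blast
  then show ?thesis using that eigenspace_nonzero_real by metis
qed

text \<open>A count of two arises either from two distinct eigenvalues, whose eigenfunctions are
  orthogonal, or from one multiple eigenvalue. In the latter case one Gram-Schmidt step yields the
  second function.\<close>

lemma eigenvalue_count_two:
  assumes q: "q \<in> Linfty G" and "2 \<le> eigenvalue_count G q \<mu>"
  obtains l f m g where "l \<le> \<mu>" "real_eig G q l f" "f \<noteq> 0" "m \<le> \<mu>" "real_eig G q m g" "g \<noteq> 0" "ip G f g = 0"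
proof -
  interpret i: sym_form V "ip G" by (rule sym_form_ip)
  let ?A = "{l. l \<le> \<mu> \<and> (\<exists>w\<in>eigenspace G q l. w \<noteq> 0)}"
  obtain l f where f: "l \<le> \<mu>" "real_eig G q l f" "f \<noteq> 0"
    using eigenvalue_count_pos[of q \<mu>] assms(2) by auto
  have fV: "f \<in> V" by (rule real_eig_C1[OF q f(2)])
  have lA: "l \<in> ?A" using f by (auto simp: real_eig_def complexify_eq_0 intro!: bexI[of _ "complexify f"])
  show ?thesis
  proof (cases "?A = {l}")
    case False
    then obtain m w where m: "m \<noteq> l" "m \<le> \<mu>" "w \<in> eigenspace G q m" "w \<noteq> 0" using lA by blast
    obtain g where g: "real_eig G q m g" "g \<noteq> 0" by (rule eigenspace_nonzero_real[OF m(3,4)])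
    show ?thesis by (rule that[OF f m(2) g]) (use real_eig_orthogonal[OF q f(2) g(1)] m(1) in auto)
  next
    case True
    then have mult: "2 \<le> eig_multiplicity G q l" using assms(2) by (simp add: eigenvalue_count_def)
    have "\<exists>u. real_eig G q l u \<and> u \<notin> span {f}"
    proof (rule ccontr)
      assume "\<nexists>u. real_eig G q l u \<and> u \<notin> span {f}"
      then have "eigenspace G q l \<subseteq> cfun.span (complexify ` {f})" by (intro eigenspace_subset_span) blast
      from cfun.dim_le_card[OF this] show False using mult by (simp add: eig_multiplicity_def)
    qed
    then obtain u where u: "real_eig G q l u" "u \<notin> span {f}" by blast
    have uV: "u \<in> V" by (rule real_eig_C1[OF q u(1)])
    have ff: "ip G f f \<noteq> 0" using ip_eq_0[OF fV] f(3) by blast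
    define g where "g = 1 *\<^sub>R u + (- (ip G f u / ip G f f)) *\<^sub>R f"
    have g: "real_eig G q l g" unfolding g_def by (rule real_eig_combination[OF q u(1) f(2)])
    have "g \<noteq> 0"
    proof
      assume "g = 0"
      then have "u = (ip G f u / ip G f f) *\<^sub>R f" by (simp add: g_def)
      then have "u \<in> span {f}" by (metis span_base span_scale singletonI)
      then show False using u(2) by simp
    qed
    moreover have "ip G f g = 0"
      unfolding g_def using ff by (simp add: i.add_right[OF _ _ fV] i.scale_in uV fV i.scale_right[OF fV fV] del: scaleR_minus_left)
    ultimately show ?thesis using that[OF f f(1) g] by blast
  qed
qed

section \<open>Variational bounds for the first two eigenvalues\<close>

lemma one_in_C1: "(\<lambda>e x. if (e, x) \<in> edge_points G then 1 else 0) \<in> V"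
  by (rule C1_extend_by_zero(1)[where w' = "\<lambda>_ _. 0"]) (auto simp: end_val_def)

text \<open>The unconstrained minimum is an eigenvalue, and no eigenvalue lies below it, so the
  infimum defining \<open>eigval\<close> is attained there.\<close>

theorem first_eigenvalue:
  assumes q: "q \<in> Linfty G" and ne: "edges G \<noteq> {}"
  obtains u where "real_eig G q (eigval G q 1) u" "ip G u u = 1"
    "\<And>w. w \<in> V \<Longrightarrow> eigval G q 1 * ip G w w \<le> qform G q w w"
proof -
  obtain e where e: "e \<in> edges G" using ne by blast
  have "(e, 0) \<in> edge_points G" using len_pos[OF e] e by (simp add: edge_points_def)
  then have nz: "(\<lambda>e x. if (e, x) \<in> edge_points G then 1 else 0) \<noteq> (0 :: 'e \<Rightarrow> real \<Rightarrow> real)"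
    by (auto simp: fun_eq_iff)
  obtain M u where u: "ip G u u = 1" "real_eig G q M u" and psd: "\<And>w. w \<in> V \<Longrightarrow> M * ip G w w \<le> qform G q w w"
  proof (rule minimizer_exists[OF q _ _ _ _ nz, of "{}"])
    show "(\<lambda>e x. if (e, x) \<in> edge_points G then 1 else 0) \<in> orth_compl {}"
      using one_in_C1 by (simp add: orth_compl_def)
  qed (auto simp: orthonormal_def orth_compl_def)
  have uV: "u \<in> V" by (rule real_eig_C1[OF q u(2)])
  have "u \<noteq> 0" by (rule ip_one_nonzero[OF u(1)])
  have "eigval G q 1 = M"
    unfolding eigval_def
  proof (rule cInf_eq_minimum)
    show "M \<in> {\<mu>. 1 \<le> eigenvalue_count G q \<mu>}"
      using eigenvalue_count_ge_1[OF q u(2) \<open>u \<noteq> 0\<close>] by simp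
    fix \<mu> assume "\<mu> \<in> {\<mu>. 1 \<le> eigenvalue_count G q \<mu>}"
    then obtain l w where w: "l \<le> \<mu>" "real_eig G q l w" "w \<noteq> 0"
      using eigenvalue_count_pos by blast
    have wV: "w \<in> V" by (rule real_eig_C1[OF q w(2)])
    have "ip G w w > 0" using ip_eq_0[OF wV] ip_nonneg[of w] w(3) by force
    moreover have "M * ip G w w \<le> l * ip G w w" using psd[OF wV] real_eig_weak[OF q w(2) wV] by simp
    ultimately show "M \<le> \<mu>" using w(1) by simp
  qed
  then show ?thesis using that u psd by blast
qed

text \<open>One linear condition on a plane has a nonzero solution, here with coefficients
  \<open>ip G g h\<close> and \<open>- ip G f h\<close>. This dimension count is what all min-max
  comparisons below rest on.\<close>

lemma exists_orthogonal_in_plane: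
  assumes f: "f \<in> V" "f \<noteq> 0" and g: "g \<in> V" "g \<noteq> 0" and fg: "ip G f g = 0" and h: "h \<in> V"
  obtains s t where "ip G (s *\<^sub>R f + t *\<^sub>R g) h = 0" "0 < ip G (s *\<^sub>R f + t *\<^sub>R g) (s *\<^sub>R f + t *\<^sub>R g)"
proof -
  interpret i: sym_form V "ip G" by (rule sym_form_ip)
  have ff: "ip G f f > 0" using ip_eq_0[OF f(1)] ip_nonneg[of f] f(2) by force
  have gg: "ip G g g > 0" using ip_eq_0[OF g(1)] ip_nonneg[of g] g(2) by force
  have sq: "ip G (s *\<^sub>R f + t *\<^sub>R g) (s *\<^sub>R f + t *\<^sub>R g) = s\<^sup>2 * ip G f f + t\<^sup>2 * ip G g g" for s t
    using i.square_combination[OF f(1) g(1)] fg by simp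
  have lin: "ip G (s *\<^sub>R f + t *\<^sub>R g) h = s * ip G f h + t * ip G g h" for s t
    using f g h by (simp add: i.add_left i.scale_left i.scale_in)
  show ?thesis
  proof (cases "ip G f h = 0")
    case True
    then show ?thesis using that[of 1 0] sq[of 1 0] lin[of 1 0] ff by simp
  next
    case False
    have "0 < (ip G g h)\<^sup>2 * ip G f f + (- ip G f h)\<^sup>2 * ip G g g"
      using False ff gg by (intro add_nonneg_pos) auto
    then show ?thesis using that[of "ip G g h" "- ip G f h"] sq[of "ip G g h" "- ip G f h"] lin[of "ip G g h" "- ip G f h"]
      by simp
  qed
qed

text \<open>It suffices that the space is not spanned by \<open>u\<close>. If the constant function
  and the bump were both multiples of \<open>u\<close>, then \<open>u\<close> would not vanish at
  the start of the edge, where the bump does, so the bump would be zero; but it is positive at the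
  midpoint.\<close>

lemma exists_orthogonal:
  assumes ne: "edges G \<noteq> {}" and u: "u \<in> V" "ip G u u = 1"
  obtains w where "w \<in> orth_compl {u}" "w \<noteq> 0"
proof -
  interpret i: sym_form V "ip G" by (rule sym_form_ip)
  obtain e where e: "e \<in> edges G" using ne by blast
  note L = len_pos[OF e]
  define one :: "'e \<Rightarrow> real \<Rightarrow> real" where "one = (\<lambda>e x. if (e, x) \<in> edge_points G then 1 else 0)"
  \<comment> \<open>A parabola vanishing at both ends of \<open>e\<close> is continuous at the
    vertices however the ends are glued.\<close>
  define bump where "bump = (\<lambda>f x. if (f, x) \<in> edge_points G then (if f = e then x * (len G e - x) else 0) else 0)"
  have oneV: "one \<in> V" unfolding one_def by (rule one_in_C1)
  have bumpV: "bump \<in> V"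
    unfolding bump_def
  proof (rule C1_extend_by_zero(1)[where w' = "\<lambda>f x. if f = e then len G e - 2 * x else 0"])
    fix f x
    show "((\<lambda>x. if f = e then x * (len G e - x) else 0) has_real_derivative (if f = e then len G e - 2 * x else 0)) (at x within {0..len G f})"
      by (cases "f = e") (auto intro!: derivative_eq_intros)
    show "continuous_on {0..len G f} (\<lambda>x. if f = e then len G e - 2 * x else 0)"
      by (cases "f = e") (auto intro!: continuous_intros)
  qed (auto simp: end_val_def)
  have on: "orthonormal {u}" using u by (simp add: orthonormal_def)
  have proj: "w - ip G w u *\<^sub>R u \<in> orth_compl {u}" if "w \<in> V" for w
    using orth_projection[OF _ on that] by simp
  show ?thesis
  proof (cases "one - ip G one u *\<^sub>R u = 0")
    case False
    then show ?thesis using that[OF proj[OF oneV]] by blast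
  next
    case True
    then have one: "one = ip G one u *\<^sub>R u" by simp
    show ?thesis
    proof (cases "bump - ip G bump u *\<^sub>R u = 0")
      case False
      then show ?thesis using that[OF proj[OF bumpV]] by blast
    next
      case True
      then have bump: "bump = ip G bump u *\<^sub>R u" by simp
      have pts: "(e, 0) \<in> edge_points G" "(e, len G e / 2) \<in> edge_points G" using e L by (auto simp: edge_points_def)
      have "one e 0 = ip G one u * u e 0" "bump e 0 = ip G bump u * u e 0"
        "bump e (len G e / 2) = ip G bump u * u e (len G e / 2)"
        using arg_cong[OF one, of "\<lambda>h. h e 0"] arg_cong[OF bump, of "\<lambda>h. h e 0"]
          arg_cong[OF bump, of "\<lambda>h. h e (len G e / 2)"] by simp_all
      then show ?thesis using pts L by (auto simp: one_def bump_def)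
    qed
  qed
qed

text \<open>The minimum \<open>M\<close> over the complement of \<open>u\<close> gives, together
  with \<open>u\<close>, two eigenvalues up to \<open>M\<close>. Conversely two orthogonal
  eigenfunctions with eigenvalues at most \<open>\<mu>\<close> span a plane on which the Rayleigh
  quotient is at most \<open>\<mu>\<close>, and this plane meets the complement of
  \<open>u\<close>.\<close>

theorem second_eigenvalue:
  assumes q: "q \<in> Linfty G" and ne: "edges G \<noteq> {}"
    and u: "real_eig G q (eigval G q 1) u" "ip G u u = 1"
  obtains w where "w \<in> V" "ip G w u = 0" "ip G w w = 1" "real_eig G q (eigval G q 2) w"
    "\<And>w. w \<in> V \<Longrightarrow> ip G w u = 0 \<Longrightarrow> eigval G q 2 * ip G w w \<le> qform G q w w"
    "eigval G q 1 \<le> eigval G q 2"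
proof -
  interpret i: sym_form V "ip G" by (rule sym_form_ip)
  interpret h: sym_form V "qform G q" by (rule sym_form_qform[OF q])
  have uV: "u \<in> V" by (rule real_eig_C1[OF q u(1)])
  have on: "orthonormal {u}" using u uV by (simp add: orthonormal_def)
  obtain w0 where w0: "w0 \<in> orth_compl {u}" "w0 \<noteq> 0" by (rule exists_orthogonal[OF ne uV u(2)])
  have eig: "\<exists>l. real_eig G q l f" if "f \<in> {u}" for f using that u(1) by blast
  obtain M w where w: "w \<in> orth_compl {u}" "ip G w w = 1" "real_eig G q M w"
    and psd: "\<And>w. w \<in> orth_compl {u} \<Longrightarrow> M * ip G w w \<le> qform G q w w"
    by (rule minimizer_exists[OF q _ on eig w0]) simp_all
  have wV: "w \<in> V" and wu: "ip G w u = 0" using w(1) by (auto simp: orth_compl_def)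
  have nz: "u \<noteq> 0" "w \<noteq> 0" using ip_one_nonzero u(2) w(2) by blast+
  obtain u0 where psd1: "\<And>w. w \<in> V \<Longrightarrow> eigval G q 1 * ip G w w \<le> qform G q w w"
    using first_eigenvalue[OF q ne] by blast
  have le: "eigval G q 1 \<le> M" using psd1[OF wV] real_eig_weak[OF q w(3) wV] w(2) by simp
  have "eigval G q 2 = M"
    unfolding eigval_def[of G q 2]
  proof (rule cInf_eq_minimum)
    show "M \<in> {\<mu>. 2 \<le> eigenvalue_count G q \<mu>}"
      using eigenvalue_count_ge_2[OF q u(1) nz(1) le w(3) nz(2) order_refl] wu i.comm[OF uV wV] by simp
    fix \<mu> assume "\<mu> \<in> {\<mu>. 2 \<le> eigenvalue_count G q \<mu>}"
    then have "2 \<le> eigenvalue_count G q \<mu>" by simp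
    then obtain l f m g where f: "l \<le> \<mu>" "real_eig G q l f" "f \<noteq> 0"
      and g: "m \<le> \<mu>" "real_eig G q m g" "g \<noteq> 0" and fg: "ip G f g = 0"
      by (rule eigenvalue_count_two[OF q])
    have V: "f \<in> V" "g \<in> V" using real_eig_C1[OF q] f g by blast+
    obtain s t where st: "ip G (s *\<^sub>R f + t *\<^sub>R g) u = 0" "0 < ip G (s *\<^sub>R f + t *\<^sub>R g) (s *\<^sub>R f + t *\<^sub>R g)"
      by (rule exists_orthogonal_in_plane[OF V(1) f(3) V(2) g(3) fg uV])
    let ?z = "s *\<^sub>R f + t *\<^sub>R g"
    have zV: "?z \<in> V" using V by (intro i.add_in i.scale_in)
    have "M * ip G ?z ?z \<le> qform G q ?z ?z" using psd[of ?z] zV st(1) by (simp add: orth_compl_def)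
    also have "\<dots> = s\<^sup>2 * (l * ip G f f) + t\<^sup>2 * (m * ip G g g)"
      unfolding h.square_combination[OF V] using real_eig_weak[OF q f(2)] real_eig_weak[OF q g(2)] V fg by simp
    also have "\<dots> \<le> s\<^sup>2 * (\<mu> * ip G f f) + t\<^sup>2 * (\<mu> * ip G g g)"
      using f g by (intro add_mono mult_left_mono mult_right_mono ip_nonneg) auto
    also have "\<dots> = \<mu> * ip G ?z ?z"
      unfolding i.square_combination[OF V] using fg by (simp add: algebra_simps)
    finally show "M \<le> \<mu>" using st(2) by simp
  qed
  then show ?thesis
    using that[OF wV wu w(2)] w(3) psd le by (simp add: orth_compl_def)
qed

text \<open>The plane of the first two eigenfunctions contains a nonzero vector orthogonal to
  \<open>h\<close>. The constraint \<open>h\<close> need not be an eigenfunction of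
  \<open>q\<close>: for a perturbed potential it can be the unperturbed ground state.\<close>

theorem eigval_2_ge:
  assumes q: "q \<in> Linfty G" and ne: "edges G \<noteq> {}" and h: "h \<in> V"
    and bound: "\<And>w. w \<in> V \<Longrightarrow> ip G w h = 0 \<Longrightarrow> \<mu> * ip G w w \<le> qform G q w w"
  shows "\<mu> \<le> eigval G q 2"
proof -
  interpret i: sym_form V "ip G" by (rule sym_form_ip)
  interpret b: sym_form V "qform G q" by (rule sym_form_qform[OF q])
  obtain u where u: "real_eig G q (eigval G q 1) u" "ip G u u = 1"
    using first_eigenvalue[OF q ne] by blast
  obtain w where w: "w \<in> V" "ip G w u = 0" "ip G w w = 1" "real_eig G q (eigval G q 2) w"
    and le: "eigval G q 1 \<le> eigval G q 2"
    using second_eigenvalue[OF q ne u] by blast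
  have uV: "u \<in> V" by (rule real_eig_C1[OF q u(1)])
  have nz: "u \<noteq> 0" "w \<noteq> 0" using ip_one_nonzero u(2) w(3) by blast+
  have uw: "ip G u w = 0" using w(2) i.comm[OF uV w(1)] by simp
  obtain s t where st: "ip G (s *\<^sub>R u + t *\<^sub>R w) h = 0" "0 < ip G (s *\<^sub>R u + t *\<^sub>R w) (s *\<^sub>R u + t *\<^sub>R w)"
    by (rule exists_orthogonal_in_plane[OF uV nz(1) w(1) nz(2) uw h])
  let ?z = "s *\<^sub>R u + t *\<^sub>R w"
  have zV: "?z \<in> V" using uV w(1) by (intro i.add_in i.scale_in)
  have "\<mu> * ip G ?z ?z \<le> qform G q ?z ?z" by (rule bound[OF zV st(1)])
  also have "\<dots> = s\<^sup>2 * eigval G q 1 + t\<^sup>2 * eigval G q 2"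
    unfolding b.square_combination[OF uV w(1)]
    using real_eig_weak[OF q u(1)] real_eig_weak[OF q w(4)] uV w u(2) uw by simp
  also have "\<dots> \<le> s\<^sup>2 * eigval G q 2 + t\<^sup>2 * eigval G q 2"
    using le by (intro add_right_mono mult_left_mono) auto
  also have "\<dots> = eigval G q 2 * ip G ?z ?z"
    unfolding i.square_combination[OF uV w(1)] using uw u(2) w(3) by (simp add: algebra_simps)
  finally show ?thesis using st(2) by simp
qed

text \<open>Any trial plane meets the complement of the true ground state, where the form is at
  least the second eigenvalue times the squared norm.\<close>

theorem eigval_2_le:
  assumes q: "q \<in> Linfty G" and ne: "edges G \<noteq> {}"
    and f: "f \<in> V" "f \<noteq> 0" and g: "g \<in> V" "g \<noteq> 0" and fg: "ip G f g = 0"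
    and bound: "\<And>s t. qform G q (s *\<^sub>R f + t *\<^sub>R g) (s *\<^sub>R f + t *\<^sub>R g) \<le> \<mu> * ip G (s *\<^sub>R f + t *\<^sub>R g) (s *\<^sub>R f + t *\<^sub>R g)"
  shows "eigval G q 2 \<le> \<mu>"
proof -
  interpret i: sym_form V "ip G" by (rule sym_form_ip)
  obtain u where u: "real_eig G q (eigval G q 1) u" "ip G u u = 1"
    using first_eigenvalue[OF q ne] by blast
  have psd: "\<And>w. w \<in> V \<Longrightarrow> ip G w u = 0 \<Longrightarrow> eigval G q 2 * ip G w w \<le> qform G q w w"
    using second_eigenvalue[OF q ne u] by blast
  obtain s t where st: "ip G (s *\<^sub>R f + t *\<^sub>R g) u = 0" "0 < ip G (s *\<^sub>R f + t *\<^sub>R g) (s *\<^sub>R f + t *\<^sub>R g)"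
    by (rule exists_orthogonal_in_plane[OF f g fg real_eig_C1[OF q u(1)]])
  have "s *\<^sub>R f + t *\<^sub>R g \<in> V" using f g by (intro i.add_in i.scale_in)
  from psd[OF this st(1)] bound[of s t] have
    "eigval G q 2 * ip G (s *\<^sub>R f + t *\<^sub>R g) (s *\<^sub>R f + t *\<^sub>R g) \<le> \<mu> * ip G (s *\<^sub>R f + t *\<^sub>R g) (s *\<^sub>R f + t *\<^sub>R g)"
    by linarith
  then show ?thesis using st(2) by simp
qed

theorem eigval_1_le:
  assumes q: "q \<in> Linfty G" and ne: "edges G \<noteq> {}" and f: "f \<in> V" "ip G f f = 1"
  shows "eigval G q 1 \<le> qform G q f f"
  using first_eigenvalue[OF q ne] f by (metis mult.right_neutral)

theorem eigval_1_ge: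
  assumes q: "q \<in> Linfty G" and ne: "edges G \<noteq> {}"
    and bound: "\<And>w. w \<in> V \<Longrightarrow> \<mu> * ip G w w \<le> qform G q w w"
  shows "\<mu> \<le> eigval G q 1"
proof -
  obtain u where u: "real_eig G q (eigval G q 1) u" "ip G u u = 1"
    using first_eigenvalue[OF q ne] by blast
  have uV: "u \<in> V" by (rule real_eig_C1[OF q u(1)])
  show ?thesis using bound[OF uV] real_eig_weak[OF q u(1) uV] u(2) by simp
qed

end

section \<open>Symmetric matrices\<close>

lemma sym_matrix_inner:
  fixes A :: "real ^ 'n ^ 'n"
  assumes "transpose A = A"
  shows "x \<bullet> (A *v y) = y \<bullet> (A *v x)"
proof -
  have "x \<bullet> (A *v y) = (x v* A) \<bullet> y" by (rule dot_lmul_matrix[symmetric])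
  also have "x v* A = A *v x" using vector_transpose_matrix[of x A] assms by simp
  finally show ?thesis by (simp add: inner_commute)
qed

lemma sym_form_matrix:
  fixes A :: "real ^ 'n ^ 'n"
  assumes "transpose A = A"
  shows "sym_form UNIV (\<lambda>x y. x \<bullet> (A *v y))"
proof
  show "subspace (UNIV :: (real ^ 'n) set)" by simp
  show "x \<bullet> (A *v y) = y \<bullet> (A *v x)" for x y by (rule sym_matrix_inner[OF assms])
qed (simp_all add: inner_add_left)

lemma sym_form_inner: "sym_form UNIV (\<lambda>x y :: 'a::real_inner. x \<bullet> y)"
  by unfold_locales (rule subspace_UNIV inner_commute inner_add_left inner_scaleR_left)+

text \<open>The minimizer \<open>v\<close> of the Rayleigh quotient is in the kernel of the semidefinite form
  \<open>x \<bullet> (A *v y) - m * (x \<bullet> y)\<close> by Cauchy--Schwarz.\<close>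

lemma sym_matrix_lowest_eigenvalue:
  fixes A :: "real ^ 'n ^ 'n"
  assumes A: "transpose A = A"
  obtains m v where "v \<noteq> 0" "A *v v = m *\<^sub>R v" "\<And>x. m * (x \<bullet> x) \<le> x \<bullet> (A *v x)"
proof -
  have cont: "continuous_on (sphere 0 1) (\<lambda>x. x \<bullet> (A *v x))"
    by (intro continuous_intros linear_continuous_on) (simp add: matrix_vector_mul_bounded_linear)
  have "sphere (0 :: real ^ 'n) 1 \<noteq> {}" by simp
  then obtain v where v: "v \<in> sphere 0 1" "\<And>x. x \<in> sphere 0 1 \<Longrightarrow> v \<bullet> (A *v v) \<le> x \<bullet> (A *v x)"
    using continuous_attains_inf[OF compact_sphere _ cont] by blast
  define m where "m = v \<bullet> (A *v v)"
  have vv: "v \<bullet> v = 1" using v(1) by (simp add: dot_square_norm)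
  have low: "m * (x \<bullet> x) \<le> x \<bullet> (A *v x)" for x
  proof (cases "x = 0")
    case False
    have "m \<le> (x /\<^sub>R norm x) \<bullet> (A *v (x /\<^sub>R norm x))"
      unfolding m_def using False by (intro v(2)) simp
    also have "\<dots> = (x \<bullet> (A *v x)) / (norm x)\<^sup>2"
      by (simp add: matrix_vector_mult_scaleR power2_eq_square divide_inverse)
    finally show ?thesis using False by (simp add: le_divide_eq dot_square_norm)
  qed simp
  interpret b: sym_form UNIV "\<lambda>x y. x \<bullet> (A *v y) + (- m) * (x \<bullet> y)"
    by (rule sym_form_combination[OF sym_form_matrix[OF A] sym_form_inner])
  have "x \<bullet> (A *v v - m *\<^sub>R v) = 0" for x
  proof -
    have "(v \<bullet> (A *v x) + (- m) * (v \<bullet> x))\<^sup>2 \<le>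
        (v \<bullet> (A *v v) + (- m) * (v \<bullet> v)) * (x \<bullet> (A *v x) + (- m) * (x \<bullet> x))"
      by (rule b.cauchy_schwarz[OF subspace_UNIV]) (use low in auto)
    then have "v \<bullet> (A *v x) = m * (v \<bullet> x)" by (simp add: vv m_def)
    then show ?thesis using sym_matrix_inner[OF A, of v x] by (simp add: inner_diff_right inner_commute)
  qed
  then have "A *v v = m *\<^sub>R v" by (metis eq_iff_diff_eq_0 inner_eq_zero_iff)
  moreover have "v \<noteq> 0" using vv by auto
  ultimately show ?thesis using that low by blast
qed

text \<open>By polarization the vanishing of the quadratic form passes to the bilinear form.\<close>

lemma sym_matrix_zero:
  fixes A :: "real ^ 'n ^ 'n"
  assumes A: "transpose A = A" and z: "\<And>x. x \<bullet> (A *v x) = 0"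
  shows "A = 0"
proof -
  interpret b: sym_form UNIV "\<lambda>x y. x \<bullet> (A *v y)" by (rule sym_form_matrix[OF A])
  have "x \<bullet> (A *v y) = 0" for x y using b.square_add[of x y] z by simp
  then have "A *v y = 0 *v y" for y by (metis inner_eq_zero_iff matrix_vector_mult_0)
  then show ?thesis by (simp add: matrix_eq)
qed

section \<open>First order perturbation of the gap\<close>

text \<open>The cross term is split with weight \<open>s = 2 K t / g\<close>, so that half of the spectral gap \<open>g\<close> absorbs
  its \<open>Y\<close>-part and the \<open>X\<close>-part is of second order in \<open>t\<close>.\<close>

lemma perturbed_form_bound:
  fixes X Y :: real
  assumes "0 \<le> X" "0 \<le> Y" and g: "0 < g" and K: "0 < K" and t: "0 < t" "4 * K * t \<le> g" and "\<bar>\<sigma>\<bar> \<le> K"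
    and "\<sigma> * X \<le> pxx" "(l + g) * Y \<le> hyy" "2 * \<bar>pxy\<bar> \<le> K * ((2 * K * t / g) * X + Y / (2 * K * t / g))"
    and "\<bar>pyy\<bar> \<le> K * Y"
  shows "(l + t * \<sigma> - 2 * K\<^sup>2 / g * t\<^sup>2) * (X + Y) \<le> l * X + hyy + t * (pxx + 2 * pxy + pyy)"
proof -
  define c where "c = 2 * K\<^sup>2 / g * t\<^sup>2"
  have c: "0 \<le> c" using g by (simp add: c_def)
  have "t * (K * (Y / (2 * K * t / g))) = g / 2 * Y" using K t g by simp
  moreover have "t * (K * ((2 * K * t / g) * X)) = c * X" by (simp add: c_def power2_eq_square)
  ultimately have "t * (K * ((2 * K * t / g) * X + Y / (2 * K * t / g))) = c * X + g / 2 * Y"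
    by (simp only: distrib_left)
  moreover have "t * (- (2 * pxy)) \<le> t * (K * ((2 * K * t / g) * X + Y / (2 * K * t / g)))"
    using assms by (intro mult_left_mono) auto
  ultimately have 1: "- (t * (2 * pxy)) \<le> c * X + g / 2 * Y" by simp
  have 2: "t * (\<sigma> * X) \<le> t * pxx" using assms by (intro mult_left_mono) auto
  have 3: "t * (- (K * Y)) \<le> t * pyy" using assms by (intro mult_left_mono) auto
  \<comment> \<open>The other half of the gap pays for \<open>P\<close> on the \<open>Y\<close>-part
    and for the shift \<open>t * \<sigma>\<close> there; this is where
    \<open>4 * K * t \<le> g\<close> enters.\<close>
  have "t * (K + \<sigma>) \<le> t * (2 * K)" using assms by (intro mult_left_mono) auto
  also have "\<dots> \<le> g / 2" using t(2) by (simp add: algebra_simps)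
  finally have "t * (K + \<sigma>) \<le> g / 2 + c" using c by simp
  then have "(t * (K + \<sigma>)) * Y \<le> (g / 2 + c) * Y" using assms(2) by (rule mult_right_mono)
  with 1 2 3 assms(9) show ?thesis
    unfolding c_def[symmetric] by (simp add: algebra_simps)
qed

text \<open>Division by \<open>t\<close> leaves \<open>D + C * t\<close>, which tends to
  \<open>D\<close> from the right.\<close>

lemma nonneg_of_eventually_first_order:
  fixes D C :: real
  assumes "\<forall>\<^sub>F t in at_right 0. 0 \<le> t * D + C * t\<^sup>2"
  shows "0 \<le> D"
proof (rule tendsto_lowerbound)
  have "((\<lambda>t. D + C * t) \<longlongrightarrow> D + C * 0) (at_right 0)" by (intro tendsto_intros)
  then show "((\<lambda>t. D + C * t) \<longlongrightarrow> D) (at_right 0)" by simp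
  show "\<forall>\<^sub>F t in at_right 0. 0 \<le> D + C * t"
    using assms eventually_at_right_less[of 0]
  proof eventually_elim
    case (elim t)
    have "t * D + C * t\<^sup>2 = t * (D + C * t)" by (simp add: power2_eq_square algebra_simps)
    then show ?case using elim by (simp add: zero_le_mult_iff)
  qed
qed simp

text \<open>The class of admissible potentials is deliberately absent: the first order analysis
  concerns the single potential \<open>q\<close>, and the class enters only with the optimality
  conditions.\<close>

locale gap_setting = compact_graph G for G :: "'e metric_graph" +
  fixes q u1 :: "'e \<Rightarrow> real \<Rightarrow> real" and u2 :: "'n::finite \<Rightarrow> 'e \<Rightarrow> real \<Rightarrow> real"
  assumes conn: "connected_space (graph_space G)"
    and q: "q \<in> Linfty G"
    and u1_eig: "complexify u1 \<in> eigenspace G q (eigval G q 1)"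
    and u1_normal: "graph_integral G (\<lambda>e x. (u1 e x)\<^sup>2) = 1"
    and u2_basis: "orthonormal_basis_of_eigenspace G q (eigval G q 2) u2"
begin

abbreviation "l1 \<equiv> eigval G q 1"
abbreviation "l2 \<equiv> eigval G q 2"

abbreviation perturbed :: "('e \<Rightarrow> real \<Rightarrow> real) \<Rightarrow> real \<Rightarrow> 'e \<Rightarrow> real \<Rightarrow> real" where
  "perturbed P t \<equiv> (\<lambda>e x. q e x + t * P e x)"

sublocale i: sym_form V "ip G" by (rule sym_form_ip)
sublocale h: sym_form V "qform G q" by (rule sym_form_qform[OF q])

lemma edges_ne: "edges G \<noteq> {}"
  using u1_normal by (auto simp: graph_integral_def)

lemma u1: "real_eig G q l1 u1"
  using u1_eig by (simp add: real_eig_def)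

lemma u1_V: "u1 \<in> V" by (rule real_eig_C1[OF q u1])

lemma ip_u1: "ip G u1 u1 = 1"
  using u1_normal by (simp add: ip_def power2_eq_square)

lemma psd1: "w \<in> V \<Longrightarrow> l1 * ip G w w \<le> qform G q w w"
  by (rule first_eigenvalue[OF q edges_ne]) blast

lemma psd2: "w \<in> V \<Longrightarrow> ip G w u1 = 0 \<Longrightarrow> l2 * ip G w w \<le> qform G q w w"
  by (rule second_eigenvalue[OF q edges_ne u1 ip_u1]) blast

text \<open>If the two eigenvalues coincided, simplicity would make the second eigenfunction a
  multiple of \<open>u1\<close>, although it is orthogonal to \<open>u1\<close> and
  normalized.\<close>

lemma gap_pos: "l1 < l2"
proof (rule ccontr)
  assume neg: "\<not> l1 < l2"
  obtain w where w: "w \<in> V" "ip G w u1 = 0" "ip G w w = 1" "real_eig G q l2 w" and "l1 \<le> l2"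
    by (rule second_eigenvalue[OF q edges_ne u1 ip_u1]) (rule that; assumption)
  then have "real_eig G q l1 w" using neg by simp
  then obtain c where "w = c *\<^sub>R u1"
    using ground_state_simple[OF q conn psd1 u1 ip_one_nonzero[OF ip_u1]] by blast
  then have "ip G w w = c * ip G w u1" using i.scale_right[OF u1_V w(1)] by metis
  then show False using w by simp
qed

section \<open>Coordinates on the eigenspace of the second eigenvalue\<close>

lemma u2: "real_eig G q l2 (u2 j)"
proof -
  have "complexify (u2 j) \<in> cfun.span (range (\<lambda>j. complexify (u2 j)))"
    by (intro cfun.span_base) simp
  then show ?thesis using u2_basis by (simp add: orthonormal_basis_of_eigenspace_def real_eig_def)
qed

lemma u2_V: "u2 j \<in> V" by (rule real_eig_C1[OF q u2])

lemma ip_u2: "ip G (u2 j) (u2 k) = (if j = k then 1 else 0)"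
  using u2_basis by (simp add: orthonormal_basis_of_eigenspace_def ip_def)

lemma u2_inj: "inj u2"
proof (rule injI)
  fix j k assume "u2 j = u2 k"
  then have "ip G (u2 j) (u2 k) = 1" by (simp add: ip_u2)
  then show "j = k" by (metis ip_u2 zero_neq_one)
qed

lemma ip_u1_u2: "ip G u1 (u2 j) = 0"
  using real_eig_orthogonal[OF q u1 u2] gap_pos by auto

text \<open>Taking real parts of the coefficients converts the complex span in the basis hypothesis
  into the real span used by the variational arguments.\<close>

lemma span_Re:
  assumes "w \<in> cfun.span (complexify ` F)"
  shows "(\<lambda>e x. Re (w e x)) \<in> span (F :: ('e \<Rightarrow> real \<Rightarrow> real) set)"
  using assms
proof (induction rule: cfun.span_induct_alt)
  case base
  have "(\<lambda>(e :: 'e) (x :: real). Re ((0 :: 'e \<Rightarrow> real \<Rightarrow> complex) e x)) = 0" by (simp add: fun_eq_iff)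
  then show ?case using span_zero by metis
next
  case (step c w y)
  then obtain f where f: "f \<in> F" "w = complexify f" by blast
  have "(\<lambda>e x. Re ((cscale c w + y) e x)) = Re c *\<^sub>R f + (\<lambda>e x. Re (y e x))"
    by (simp add: f(2) cscale_def complexify_def fun_eq_iff)
  then show ?case using step f(1) by (metis span_add span_scale span_base)
qed

lemma real_eig_l2_span:
  assumes "real_eig G q l2 u"
  shows "u \<in> span (range u2)"
proof -
  have "complexify u \<in> cfun.span (complexify ` range u2)"
    using assms u2_basis by (simp add: real_eig_def orthonormal_basis_of_eigenspace_def image_image)
  from span_Re[OF this] show ?thesis by (simp add: complexify_def)
qed

text \<open>Identifies coordinate vectors with the real eigenspace of \<open>l2\<close>;
  orthonormality of \<open>u2\<close> makes the identification isometric.\<close>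

definition comb :: "real ^ 'n \<Rightarrow> 'e \<Rightarrow> real \<Rightarrow> real" where
  "comb c = (\<Sum>j\<in>UNIV. (c $ j) *\<^sub>R u2 j)"

lemma comb_V: "comb c \<in> V"
  unfolding comb_def by (intro i.sum_in i.scale_in u2_V)

lemma form_comb_left:
  assumes "sym_form V b" "v \<in> V"
  shows "b (comb c) v = (\<Sum>j\<in>UNIV. c $ j * b (u2 j) v)"
proof -
  interpret b: sym_form V b by fact
  have "b (comb c) v = (\<Sum>j\<in>UNIV. b ((c $ j) *\<^sub>R u2 j) v)"
    unfolding comb_def by (rule b.sum_left[OF b.scale_in[OF u2_V] assms(2)])
  then show ?thesis by (simp add: b.scale_left[OF u2_V assms(2)])
qed

lemma form_comb:
  assumes "sym_form V b"
  shows "b (comb c) (comb d) = (\<Sum>j\<in>UNIV. \<Sum>k\<in>UNIV. c $ j * (d $ k * b (u2 j) (u2 k)))"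
proof -
  interpret b: sym_form V b by fact
  have "b (u2 j) (comb d) = (\<Sum>k\<in>UNIV. d $ k * b (u2 j) (u2 k))" for j
    using form_comb_left[OF assms u2_V, of d j] b.comm[OF u2_V comb_V] b.comm[OF u2_V u2_V] by simp
  then show ?thesis by (simp add: form_comb_left[OF assms comb_V] sum_distrib_left)
qed

lemma ip_comb: "ip G (comb c) (comb c) = c \<bullet> c"
  by (simp add: form_comb[OF sym_form_ip] ip_u2 inner_vec_def if_distrib cong: if_cong)

lemma qform_comb_left: "v \<in> V \<Longrightarrow> qform G q (comb c) v = l2 * ip G (comb c) v"
  by (simp add: form_comb_left[OF sym_form_qform[OF q]] form_comb_left[OF sym_form_ip]
      real_eig_weak[OF q u2] sum_distrib_left mult_ac)

lemma comb_eig: "real_eig G q l2 (comb c)"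
  unfolding real_eig_iff_weak[OF q] using comb_V qform_comb_left by blast

lemma ip_comb_u1: "ip G (comb c) u1 = 0"
  using form_comb_left[OF sym_form_ip u1_V] ip_u1_u2 i.comm[OF u2_V u1_V] by simp

lemma pert_matrix_entry:
  assumes P: "P \<in> Linfty G"
  shows "pert_matrix G u1 u2 P $ j $ k =
    weighted_ip G P (u2 j) (u2 k) - (if j = k then 1 else 0) * weighted_ip G P u1 u1"
proof -
  have "graph_integral G (\<lambda>e x. P e x * (u2 j e x * u2 k e x - (if j = k then 1 else 0) * (u1 e x)\<^sup>2)) =
      graph_integral G (\<lambda>e x. P e x * (u2 j e x * u2 k e x) - (if j = k then 1 else 0) * (P e x * (u1 e x * u1 e x)))"
    by (rule graph_integral_cong) (simp add: algebra_simps power2_eq_square)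
  also have "\<dots> = weighted_ip G P (u2 j) (u2 k) - (if j = k then 1 else 0) * weighted_ip G P u1 u1"
    unfolding weighted_ip_def graph_integral_cmult[symmetric]
    by (rule graph_integral_diff) (intro Linfty_mult Linfty_const P C1_Linfty u2_V u1_V)+
  finally show ?thesis by (simp add: pert_matrix_def)
qed

lemma pert_matrix_sym:
  assumes "P \<in> Linfty G"
  shows "transpose (pert_matrix G u1 u2 P) = pert_matrix G u1 u2 P"
  using sym_form.comm[OF sym_form_weighted_ip[OF assms] u2_V u2_V]
  by (simp add: vec_eq_iff transpose_def pert_matrix_entry[OF assms])

text \<open>For a unit vector \<open>c\<close> the right-hand side is the first order coefficient of
  the gap seen by the trial function \<open>comb c\<close>. This is the link between the matrix and
  perturbation theory.\<close>

lemma pert_matrix_quadratic: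
  assumes P: "P \<in> Linfty G"
  shows "c \<bullet> (pert_matrix G u1 u2 P *v c) =
    weighted_ip G P (comb c) (comb c) - weighted_ip G P u1 u1 * (c \<bullet> c)"
proof -
  let ?s = "weighted_ip G P u1 u1"
  have "c \<bullet> (pert_matrix G u1 u2 P *v c) =
      (\<Sum>j\<in>UNIV. \<Sum>k\<in>UNIV. c $ j * (c $ k * weighted_ip G P (u2 j) (u2 k)) - (if j = k then ?s * (c $ j * c $ k) else 0))"
    unfolding inner_vec_def matrix_vector_mult_def
    by (simp add: pert_matrix_entry[OF P] sum_distrib_left)
      (intro sum.cong refl, auto simp: algebra_simps)
  also have "\<dots> = weighted_ip G P (comb c) (comb c) - ?s * (c \<bullet> c)"
    by (simp add: sum_subtractf form_comb[OF sym_form_weighted_ip[OF P]] inner_vec_def sum_distrib_left)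
  finally show ?thesis .
qed

lemma pert_matrix_uminus:
  assumes P: "P \<in> Linfty G"
  shows "pert_matrix G u1 u2 (\<lambda>e x. - P e x) = - pert_matrix G u1 u2 P"
proof -
  have "pert_matrix G u1 u2 (\<lambda>e x. - P e x) $ j $ k = - pert_matrix G u1 u2 P $ j $ k" for j k
    unfolding pert_matrix_def
    using graph_integral_cmult[of G "-1" "\<lambda>e x. P e x * (u2 j e x * u2 k e x - (if j = k then 1 else 0) * (u1 e x)\<^sup>2)"]
    by simp
  then show ?thesis by (simp add: vec_eq_iff)
qed

text \<open>A minimizer on the complement of \<open>u1\<close> and the eigenspace is an
  eigenfunction with eigenvalue at least \<open>l2\<close>. Equality would place it in the span of
  \<open>u2\<close>, to which it is orthogonal.\<close>

lemma spectral_gap_above_l2: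
  obtains m where "l2 < m" "\<And>w. w \<in> orth_compl (insert u1 (range u2)) \<Longrightarrow> m * ip G w w \<le> qform G q w w"
proof -
  let ?F = "insert u1 (range u2)"
  have ne: "u1 \<noteq> u2 j" for j using ip_u1 ip_u1_u2[of j] by auto
  have u21: "ip G (u2 j) u1 = 0" for j using ip_u1_u2 i.comm[OF u2_V u1_V] by simp
  have on: "orthonormal ?F"
    unfolding orthonormal_def using u1_V u2_V
    by (auto simp: ip_u1 ip_u2 ip_u1_u2 u21 ne ne[symmetric] inj_eq[OF u2_inj])
  have eig: "\<exists>l. real_eig G q l f" if "f \<in> ?F" for f using that u1 u2 by blast
  show ?thesis
  proof (cases "\<exists>w0\<in>orth_compl ?F. w0 \<noteq> 0")
    case False
    \<comment> \<open>In this branch the complement contains only 0, so any number above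
      \<open>l2\<close> serves.\<close>
    then have "(l2 + 1) * ip G w w \<le> qform G q w w" if "w \<in> orth_compl ?F" for w
      using that i.zero_left[OF i.zero_in] h.zero_left[OF h.zero_in] by force
    then show ?thesis using that[of "l2 + 1"] by simp
  next
    case True
    then obtain w0 where w0: "w0 \<in> orth_compl ?F" "w0 \<noteq> 0" by blast
    obtain M u where u: "u \<in> orth_compl ?F" "ip G u u = 1" "real_eig G q M u"
      and psd: "\<And>w. w \<in> orth_compl ?F \<Longrightarrow> M * ip G w w \<le> qform G q w w"
      by (rule minimizer_exists[OF q _ on eig w0]) simp_all
    have uV: "u \<in> V" and u_u1: "ip G u u1 = 0" and u_u2: "\<And>j. ip G u (u2 j) = 0"
      using u(1) by (auto simp: orth_compl_def)
    have "l2 \<le> M" using psd2[OF uV u_u1] real_eig_weak[OF q u(3) uV] u(2) by simp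
    moreover have "M \<noteq> l2"
    proof
      assume "M = l2"
      then have "u \<in> span (range u2)" using real_eig_l2_span u(3) by simp
      moreover have "subspace {v \<in> V. ip G u v = 0}"
        by (intro subspaceI) (auto simp: i.zero_in i.zero_right uV i.add_in i.add_right i.scale_in i.scale_right)
      moreover have "range u2 \<subseteq> {v \<in> V. ip G u v = 0}" using u_u2 u2_V by auto
      ultimately have "ip G u u = 0" using span_minimal by blast
      then show False using u(2) by simp
    qed
    ultimately have "l2 < M" by simp
    then show ?thesis using psd by (rule that)
  qed
qed

section \<open>Estimates for the perturbed form and the perturbed gap\<close>

lemma perturbed_Linfty: "P \<in> Linfty G \<Longrightarrow> perturbed P t \<in> Linfty G"
  by (intro Linfty_add Linfty_cmult q)

lemma qform_perturbed:
  assumes P: "P \<in> Linfty G" and uv: "u \<in> V" "v \<in> V"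
  shows "qform G (perturbed P t) u v = qform G q u v + t * weighted_ip G P u v"
proof -
  have "weighted_ip G (perturbed P t) u v = graph_integral G (\<lambda>e x. q e x * (u e x * v e x) + t * (P e x * (u e x * v e x)))"
    unfolding weighted_ip_def by (rule graph_integral_cong) (simp add: algebra_simps)
  also have "\<dots> = weighted_ip G q u v + t * weighted_ip G P u v"
    unfolding weighted_ip_def graph_integral_cmult[symmetric]
    by (rule graph_integral_add) (intro Linfty_mult Linfty_const q P C1_Linfty uv)+
  finally show ?thesis by (simp add: qform_def)
qed

text \<open>The same constant has to dominate both the perturbation and the first order coefficient,
  as \<open>perturbed_form_bound\<close> requires; \<open>R\<close> stands for the latter.\<close>

lemma Linfty_bound_above:
  assumes "P \<in> Linfty G"
  obtains K where "K > 0" "R \<le> K" "\<And>e. e \<in> edges G \<Longrightarrow> AE x in lebesgue_on {0..len G e}. \<bar>P e x\<bar> \<le> K"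
proof -
  obtain K where K: "K > 0" "\<And>e. e \<in> edges G \<Longrightarrow> AE x in lebesgue_on {0..len G e}. \<bar>P e x\<bar> \<le> K"
    using Linfty_bound[OF assms] by blast
  show ?thesis
  proof (rule that[of "max K R"])
    fix e assume "e \<in> edges G"
    from K(2)[OF this] show "AE x in lebesgue_on {0..len G e}. \<bar>P e x\<bar> \<le> max K R"
      by eventually_elim auto
  qed (use K(1) in auto)
qed

context
  fixes P K g t
  assumes P: "P \<in> Linfty G" and K: "K > 0" "\<And>e. e \<in> edges G \<Longrightarrow> AE x in lebesgue_on {0..len G e}. \<bar>P e x\<bar> \<le> K"
    and g: "0 < g" and t: "0 < t" "4 * K * t \<le> g"
begin

text \<open>Here \<open>x\<close> is the component in an eigenspace for \<open>l\<close> and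
  \<open>y\<close> the rest, at least \<open>g\<close> above it. The unperturbed form and the inner
  product have no cross term, so the two components are coupled only through
  \<open>P\<close>.\<close>

lemma perturbed_lower:
  assumes xy: "x \<in> V" "y \<in> V" "ip G x y = 0" "qform G q x y = 0"
    and hx: "qform G q x x = l * ip G x x" and hy: "(l + g) * ip G y y \<le> qform G q y y"
    and s: "\<bar>\<sigma>\<bar> \<le> K" "\<sigma> * ip G x x \<le> weighted_ip G P x x"
  shows "(l + t * \<sigma> - 2 * K\<^sup>2 / g * t\<^sup>2) * ip G (x + y) (x + y) \<le> qform G (perturbed P t) (x + y) (x + y)"
proof -
  interpret p: sym_form V "weighted_ip G P" by (rule sym_form_weighted_ip[OF P])
  have "(l + t * \<sigma> - 2 * K\<^sup>2 / g * t\<^sup>2) * (ip G x x + ip G y y) \<le>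
      l * ip G x x + qform G q y y + t * (weighted_ip G P x x + 2 * weighted_ip G P x y + weighted_ip G P y y)"
    by (rule perturbed_form_bound[OF ip_nonneg ip_nonneg g K(1) t s hy
          weighted_ip_bound[OF P K(2) xy(1,2)] weighted_ip_abs_le[OF P K(2) xy(2)]])
      (use g K t in auto)
  then show ?thesis
    using i.add_in[OF xy(1,2)] by (simp add: qform_perturbed[OF P] i.square_add h.square_add p.square_add xy hx)
qed

text \<open>Negating all forms reverses the inequality: \<open>perturbed_form_bound\<close> is
  applied with \<open>- l\<close> and \<open>- \<sigma>\<close>, and a \<open>y\<close> lying
  \<open>g\<close> below \<open>l\<close> becomes one lying \<open>g\<close> above
  \<open>- l\<close>.\<close>

lemma perturbed_upper:
  assumes xy: "x \<in> V" "y \<in> V" "ip G x y = 0" "qform G q x y = 0"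
    and hx: "qform G q x x = l * ip G x x" and hy: "qform G q y y \<le> (l - g) * ip G y y"
    and s: "\<bar>\<sigma>\<bar> \<le> K" "weighted_ip G P x x \<le> \<sigma> * ip G x x"
  shows "qform G (perturbed P t) (x + y) (x + y) \<le> (l + t * \<sigma> + 2 * K\<^sup>2 / g * t\<^sup>2) * ip G (x + y) (x + y)"
proof -
  interpret p: sym_form V "weighted_ip G P" by (rule sym_form_weighted_ip[OF P])
  have b: "2 * \<bar>- weighted_ip G P x y\<bar> \<le> K * (2 * K * t / g * ip G x x + ip G y y / (2 * K * t / g))"
    using weighted_ip_bound[OF P K(2) xy(1,2), of "2 * K * t / g"] g K t by simp
  have "(- l + t * (- \<sigma>) - 2 * K\<^sup>2 / g * t\<^sup>2) * (ip G x x + ip G y y) \<le>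
      - l * ip G x x + (- qform G q y y) + t * (- weighted_ip G P x x + 2 * (- weighted_ip G P x y) + - weighted_ip G P y y)"
    by (rule perturbed_form_bound[OF ip_nonneg ip_nonneg g K(1) t _ _ _ b])
      (use s hy weighted_ip_abs_le[OF P K(2) xy(2)] in \<open>auto simp: algebra_simps\<close>)
  then show ?thesis
    using i.add_in[OF xy(1,2)]
    by (simp add: qform_perturbed[OF P] i.square_add h.square_add p.square_add xy hx algebra_simps)
qed

end

lemma eventually_small:
  assumes "(0::real) < r"
  shows "\<forall>\<^sub>F t in at_right 0. 0 < t \<and> t < r"
  unfolding eventually_at_right_field using assms by blast

text \<open>The trial plane spanned by \<open>w\<close> and \<open>u1\<close> bounds the second
  eigenvalue from above, and splitting off \<open>u1\<close> bounds the first from below. The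
  separation is \<open>g = l2 - l1\<close> both times, so each estimate costs
  \<open>2 * K\<^sup>2 / g * t\<^sup>2\<close>, and \<open>g / (4 * K)\<close> limits the range of
  \<open>t\<close> in which they hold.\<close>

lemma gap_perturbed_le:
  assumes P: "P \<in> Linfty G" and w: "real_eig G q l2 w" "ip G w w = 1"
  obtains C where "\<forall>\<^sub>F t in at_right 0. gap G (perturbed P t) \<le>
    gap G q + t * (weighted_ip G P w w - weighted_ip G P u1 u1) + C * t\<^sup>2"
proof -
  define \<sigma> where "\<sigma> = weighted_ip G P w w"
  define \<sigma>1 where "\<sigma>1 = weighted_ip G P u1 u1"
  define g where "g = l2 - l1"
  have g: "0 < g" using gap_pos by (simp add: g_def)
  interpret p: sym_form V "weighted_ip G P" by (rule sym_form_weighted_ip[OF P])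
  obtain K where K: "K > 0" "max \<bar>\<sigma>\<bar> \<bar>\<sigma>1\<bar> \<le> K" "\<And>e. e \<in> edges G \<Longrightarrow> AE x in lebesgue_on {0..len G e}. \<bar>P e x\<bar> \<le> K"
    using Linfty_bound_above[OF P] by blast
  have wV: "w \<in> V" by (rule real_eig_C1[OF q w(1)])
  have wu: "ip G w u1 = 0" using real_eig_orthogonal[OF q w(1) u1] gap_pos by auto
  have "\<forall>\<^sub>F t in at_right 0. gap G (perturbed P t) \<le> gap G q + t * (\<sigma> - \<sigma>1) + 2 * (2 * K\<^sup>2 / g) * t\<^sup>2"
    using eventually_small[of "g / (4 * K)"]
  proof (rule eventually_mono)
    show "0 < g / (4 * K)" using g K(1) by simp
    fix t assume "0 < t \<and> t < g / (4 * K)"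
    then have t: "0 < t" "4 * K * t \<le> g" using K(1) by (auto simp: less_divide_eq mult_ac)
    note setting = P K(1,3) g t
    have "eigval G (perturbed P t) 2 \<le> l2 + t * \<sigma> + 2 * K\<^sup>2 / g * t\<^sup>2"
    proof (rule eigval_2_le[OF perturbed_Linfty[OF P] edges_ne wV ip_one_nonzero[OF w(2)] u1_V ip_one_nonzero[OF ip_u1] wu])
      fix r s
      show "qform G (perturbed P t) (r *\<^sub>R w + s *\<^sub>R u1) (r *\<^sub>R w + s *\<^sub>R u1)
          \<le> (l2 + t * \<sigma> + 2 * K\<^sup>2 / g * t\<^sup>2) * ip G (r *\<^sub>R w + s *\<^sub>R u1) (r *\<^sub>R w + s *\<^sub>R u1)"
      proof (rule perturbed_upper[OF setting])
        show "r *\<^sub>R w \<in> V" "s *\<^sub>R u1 \<in> V" by (rule i.scale_in[OF wV] i.scale_in[OF u1_V])+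
        show "ip G (r *\<^sub>R w) (s *\<^sub>R u1) = 0" "qform G q (r *\<^sub>R w) (s *\<^sub>R u1) = 0"
          using wu real_eig_weak[OF q w(1) u1_V]
          by (simp_all add: i.scale_left i.scale_right h.scale_left h.scale_right i.scale_in wV u1_V)
        show "qform G q (r *\<^sub>R w) (r *\<^sub>R w) = l2 * ip G (r *\<^sub>R w) (r *\<^sub>R w)"
          using real_eig_weak[OF q w(1) wV]
          by (simp add: i.scale_left i.scale_right h.scale_left h.scale_right i.scale_in wV)
        show "qform G q (s *\<^sub>R u1) (s *\<^sub>R u1) \<le> (l2 - g) * ip G (s *\<^sub>R u1) (s *\<^sub>R u1)"
          using real_eig_weak[OF q u1 u1_V]
          by (simp add: i.scale_left i.scale_right h.scale_left h.scale_right i.scale_in u1_V g_def)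
        show "\<bar>\<sigma>\<bar> \<le> K" using K(2) by simp
        show "weighted_ip G P (r *\<^sub>R w) (r *\<^sub>R w) \<le> \<sigma> * ip G (r *\<^sub>R w) (r *\<^sub>R w)"
          using w(2) by (simp add: i.scale_left i.scale_right p.scale_left p.scale_right i.scale_in wV \<sigma>_def)
      qed
    qed
    moreover have "l1 + t * \<sigma>1 - 2 * K\<^sup>2 / g * t\<^sup>2 \<le> eigval G (perturbed P t) 1"
    proof (rule eigval_1_ge[OF perturbed_Linfty[OF P] edges_ne])
      fix v assume vV: "v \<in> V"
      define x where "x = ip G v u1 *\<^sub>R u1"
      define y where "y = v - x"
      have xV: "x \<in> V" unfolding x_def by (rule i.scale_in[OF u1_V])
      have yV: "y \<in> V" unfolding y_def by (rule i.diff_in[OF vV xV])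
      have "ip G y u1 = ip G v u1 - ip G x u1" unfolding y_def by (rule i.diff_left[OF vV xV u1_V])
      then have yu: "ip G y u1 = 0" by (simp add: x_def i.scale_left u1_V ip_u1)
      then have u1y: "ip G u1 y = 0" using i.comm[OF u1_V yV] by simp
      have v_eq: "v = x + y" by (simp add: y_def)
      show "(l1 + t * \<sigma>1 - 2 * K\<^sup>2 / g * t\<^sup>2) * ip G v v \<le> qform G (perturbed P t) v v"
        unfolding v_eq
      proof (rule perturbed_lower[OF setting xV yV])
        show "ip G x y = 0" "qform G q x y = 0"
          unfolding x_def using u1y real_eig_weak[OF q u1 yV] by (simp_all add: i.scale_left h.scale_left u1_V yV)
        show "qform G q x x = l1 * ip G x x"
          unfolding x_def using real_eig_weak[OF q u1 u1_V]
          by (simp add: i.scale_left i.scale_right h.scale_left h.scale_right i.scale_in u1_V)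
        show "(l1 + g) * ip G y y \<le> qform G q y y" using psd2[OF yV yu] by (simp add: g_def)
        show "\<bar>\<sigma>1\<bar> \<le> K" using K(2) by simp
        show "\<sigma>1 * ip G x x \<le> weighted_ip G P x x"
          unfolding x_def using ip_u1
          by (simp add: i.scale_left i.scale_right p.scale_left p.scale_right i.scale_in u1_V \<sigma>1_def)
      qed
    qed
    ultimately show "gap G (perturbed P t) \<le> gap G q + t * (\<sigma> - \<sigma>1) + 2 * (2 * K\<^sup>2 / g) * t\<^sup>2"
      unfolding gap_def by (simp add: algebra_simps)
  qed
  then show ?thesis unfolding \<sigma>_def \<sigma>1_def by (rule that)
qed

text \<open>The trial function \<open>u1\<close> gives an exact linear upper bound for the first
  eigenvalue, so only the lower bound for the second has a quadratic error. There \<open>u1\<close>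
  acts as the constraint in \<open>eigval_2_ge\<close>, and the separation needed is the one above
  \<open>l2\<close>. The hypothesis holds uniformly on the eigenspace, so no direction has to be
  singled out as \<open>t\<close> varies.\<close>

lemma gap_perturbed_ge:
  assumes P: "P \<in> Linfty G"
    and pos: "\<And>c. (weighted_ip G P u1 u1 + \<delta>) * (c \<bullet> c) \<le> weighted_ip G P (comb c) (comb c)"
  obtains C where "\<forall>\<^sub>F t in at_right 0. gap G q + t * \<delta> - C * t\<^sup>2 \<le> gap G (perturbed P t)"
proof -
  define \<sigma> where "\<sigma> = weighted_ip G P u1 u1"
  obtain m where m: "l2 < m" "\<And>w. w \<in> orth_compl (insert u1 (range u2)) \<Longrightarrow> m * ip G w w \<le> qform G q w w"
    by (rule spectral_gap_above_l2) (rule that; assumption)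
  define g where "g = m - l2"
  have g: "0 < g" using m(1) by (simp add: g_def)
  obtain K where K: "K > 0" "\<bar>\<sigma> + \<delta>\<bar> \<le> K" "\<And>e. e \<in> edges G \<Longrightarrow> AE x in lebesgue_on {0..len G e}. \<bar>P e x\<bar> \<le> K"
    using Linfty_bound_above[OF P] by blast
  have "\<forall>\<^sub>F t in at_right 0. gap G q + t * \<delta> - (2 * K\<^sup>2 / g) * t\<^sup>2 \<le> gap G (perturbed P t)"
    using eventually_small[of "g / (4 * K)"]
  proof (rule eventually_mono)
    show "0 < g / (4 * K)" using g K(1) by simp
    fix t assume "0 < t \<and> t < g / (4 * K)"
    then have t: "0 < t" "4 * K * t \<le> g" using K(1) by (auto simp: less_divide_eq mult_ac)
    note setting = P K(1,3) g t
    have "eigval G (perturbed P t) 1 \<le> qform G (perturbed P t) u1 u1"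
      by (rule eigval_1_le[OF perturbed_Linfty[OF P] edges_ne u1_V ip_u1])
    also have "\<dots> = l1 + t * \<sigma>"
      using real_eig_weak[OF q u1 u1_V] by (simp add: qform_perturbed[OF P u1_V u1_V] ip_u1 \<sigma>_def)
    finally have 1: "eigval G (perturbed P t) 1 \<le> l1 + t * \<sigma>" .
    have "l2 + t * (\<sigma> + \<delta>) - 2 * K\<^sup>2 / g * t\<^sup>2 \<le> eigval G (perturbed P t) 2"
    proof (rule eigval_2_ge[OF perturbed_Linfty[OF P] edges_ne u1_V])
      fix v assume v: "v \<in> V" "ip G v u1 = 0"
      define c where "c = (\<chi> j. ip G v (u2 j))"
      define y where "y = v - comb c"
      have yV: "y \<in> V" unfolding y_def by (rule i.diff_in[OF v(1) comb_V])
      have "ip G y u1 = 0" unfolding y_def using i.diff_left[OF v(1) comb_V u1_V] v(2) ip_comb_u1 by simp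
      moreover have yu2: "ip G y (u2 j) = 0" for j
      proof -
        have "ip G (comb c) (u2 j) = ip G v (u2 j)"
          by (simp add: form_comb_left[OF sym_form_ip u2_V] ip_u2 c_def if_distrib cong: if_cong)
        then show ?thesis unfolding y_def using i.diff_left[OF v(1) comb_V u2_V] by simp
      qed
      ultimately have y: "y \<in> orth_compl (insert u1 (range u2))" using yV by (auto simp: orth_compl_def)
      have v_eq: "v = comb c + y" by (simp add: y_def)
      show "(l2 + t * (\<sigma> + \<delta>) - 2 * K\<^sup>2 / g * t\<^sup>2) * ip G v v \<le> qform G (perturbed P t) v v"
        unfolding v_eq
      proof (rule perturbed_lower[OF setting comb_V yV])
        show 0: "ip G (comb c) y = 0"
          using form_comb_left[OF sym_form_ip yV] yu2 i.comm[OF u2_V yV] by simp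
        show "qform G q (comb c) y = 0" using qform_comb_left[OF yV] 0 by simp
        show "qform G q (comb c) (comb c) = l2 * ip G (comb c) (comb c)" by (rule qform_comb_left[OF comb_V])
        show "(l2 + g) * ip G y y \<le> qform G q y y" using m(2)[OF y] by (simp add: g_def)
        show "\<bar>\<sigma> + \<delta>\<bar> \<le> K" by (rule K(2))
        show "(\<sigma> + \<delta>) * ip G (comb c) (comb c) \<le> weighted_ip G P (comb c) (comb c)"
          using pos[of c] by (simp add: ip_comb \<sigma>_def)
      qed
    qed
    with 1 show "gap G q + t * \<delta> - (2 * K\<^sup>2 / g) * t\<^sup>2 \<le> gap G (perturbed P t)"
      unfolding gap_def by (simp add: algebra_simps)
  qed
  then show ?thesis by (rule that)
qed

section \<open>Optimality conditions for minimizing and maximizing potentials\<close>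

lemma minimizing_psd:
  assumes min: "minimizing_potential G C q" and P: "P \<in> Linfty G" and adm: "positively_admissible C q P"
  shows "pos_semidef (pert_matrix G u1 u2 P)"
  unfolding pos_semidef_def
proof (intro conjI allI)
  show "transpose (pert_matrix G u1 u2 P) = pert_matrix G u1 u2 P" by (rule pert_matrix_sym[OF P])
  fix c
  show "0 \<le> c \<bullet> (pert_matrix G u1 u2 P *v c)"
  proof (cases "c = 0")
    case False
    \<comment> \<open>The upper bound for the gap needs a normalized trial function; homogeneity of
      the quadratic form returns to \<open>c\<close> at the end.\<close>
    define d where "d = c /\<^sub>R norm c"
    have dd: "d \<bullet> d = 1" using False by (simp add: d_def dot_square_norm power2_eq_square)
    obtain B where B: "\<forall>\<^sub>F t in at_right 0. gap G (perturbed P t) \<le>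
        gap G q + t * (weighted_ip G P (comb d) (comb d) - weighted_ip G P u1 u1) + B * t\<^sup>2"
      by (rule gap_perturbed_le[OF P comb_eig[of d]]) (simp_all add: ip_comb dd)
    have "\<forall>\<^sub>F t in at_right 0. perturbed P t \<in> C" using adm by (simp add: positively_admissible_def)
    with B have "\<forall>\<^sub>F t in at_right 0. 0 \<le> t * (weighted_ip G P (comb d) (comb d) - weighted_ip G P u1 u1) + B * t\<^sup>2"
    proof eventually_elim
      case (elim t)
      have "gap G q \<le> gap G (perturbed P t)" using min elim(2) by (simp add: minimizing_potential_def)
      then show ?case using elim(1) by linarith
    qed
    then have "0 \<le> weighted_ip G P (comb d) (comb d) - weighted_ip G P u1 u1"
      by (rule nonneg_of_eventually_first_order)
    then have "0 \<le> d \<bullet> (pert_matrix G u1 u2 P *v d)"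
      by (simp add: pert_matrix_quadratic[OF P] dd)
    then have "0 \<le> (norm c *\<^sub>R d) \<bullet> (pert_matrix G u1 u2 P *v (norm c *\<^sub>R d))"
      by (simp add: matrix_vector_mult_scaleR)
    moreover have "norm c *\<^sub>R d = c" using False by (simp add: d_def)
    ultimately show ?thesis by metis
  qed simp
qed

text \<open>The lowest eigenvalue \<open>m\<close> of the matrix bounds its quadratic form from
  below, so the gap changes at least at rate \<open>m\<close> to first order. A maximizer cannot
  allow a positive rate.\<close>

lemma maximizing_lowest_eigenvalue_nonpos:
  assumes max: "maximizing_potential G C q" and P: "P \<in> Linfty G" and adm: "positively_admissible C q P"
  shows "\<exists>m\<le>0. \<exists>v. v \<noteq> 0 \<and> pert_matrix G u1 u2 P *v v = m *\<^sub>R v"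
proof -
  obtain m v where v: "v \<noteq> 0" "pert_matrix G u1 u2 P *v v = m *\<^sub>R v"
    and low: "\<And>x. m * (x \<bullet> x) \<le> x \<bullet> (pert_matrix G u1 u2 P *v x)"
    using sym_matrix_lowest_eigenvalue[OF pert_matrix_sym[OF P]] by metis
  have pos: "(weighted_ip G P u1 u1 + m) * (c \<bullet> c) \<le> weighted_ip G P (comb c) (comb c)" for c
    using low[of c] by (simp add: pert_matrix_quadratic[OF P] algebra_simps)
  obtain B where B: "\<forall>\<^sub>F t in at_right 0. gap G q + t * m - B * t\<^sup>2 \<le> gap G (perturbed P t)"
    by (rule gap_perturbed_ge[OF P pos])
  have "\<forall>\<^sub>F t in at_right 0. perturbed P t \<in> C" using adm by (simp add: positively_admissible_def)
  with B have "\<forall>\<^sub>F t in at_right 0. 0 \<le> t * (- m) + B * t\<^sup>2"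
  proof eventually_elim
    case (elim t)
    have "gap G (perturbed P t) \<le> gap G q" using max elim(2) by (simp add: maximizing_potential_def)
    then show ?case using elim(1) by simp
  qed
  then have "m \<le> 0" using nonneg_of_eventually_first_order[of "- m" B] by simp
  then show ?thesis using v by blast
qed

end

lemma pos_def_eigenvalue_pos:
  assumes "pos_def A" "v \<noteq> 0" "A *v v = m *\<^sub>R v"
  shows "0 < m"
proof -
  have "0 < v \<bullet> (m *\<^sub>R v)" using assms unfolding pos_def_def by metis
  then have "0 < m * (v \<bullet> v)" by simp
  then show ?thesis by (rule zero_less_mult_pos2) (use assms(2) in simp)
qed

theorem proposition2p13:
  fixes G :: "'e metric_graph"
    and C :: "('e \<Rightarrow> real \<Rightarrow> real) set"
    and q u1 :: "'e \<Rightarrow> real \<Rightarrow> real"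
    and u2 :: "'n::finite \<Rightarrow> 'e \<Rightarrow> real \<Rightarrow> real"
  assumes graph: "compact_metric_graph G"
    and connected: "connected_space (graph_space G)"
    and potentials: "C \<subseteq> Linfty G"
    and q: "q \<in> C"
    and mult: "eig_multiplicity G q (eigval G q 2) = CARD('n)"
    and u1: "complexify u1 \<in> eigenspace G q (eigval G q 1)"
    and u1_normalized: "graph_integral G (\<lambda>e x. (u1 e x)\<^sup>2) = 1"
    and u2: "orthonormal_basis_of_eigenspace G q (eigval G q 2) u2"
  shows "(minimizing_potential G C q \<longrightarrow>
            (\<forall>P\<in>Linfty G. positively_admissible C q P \<longrightarrow>
               pos_semidef (pert_matrix G u1 u2 P) \<and>
               (\<forall>k. 0 \<le> pert_matrix G u1 u2 P $ k $ k)) \<and>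
            (\<forall>P\<in>Linfty G. admissible C q P \<longrightarrow> pert_matrix G u1 u2 P = 0)) \<and>
         (maximizing_potential G C q \<longrightarrow>
            (\<forall>P\<in>Linfty G. positively_admissible C q P \<longrightarrow>
               \<not> pos_def (pert_matrix G u1 u2 P) \<and>
               (\<exists>\<mu>\<le>0. \<exists>v. v \<noteq> 0 \<and> pert_matrix G u1 u2 P *v v = \<mu> *\<^sub>R v)) \<and>
            (\<forall>P\<in>Linfty G. admissible C q P \<longrightarrow>
               \<not> pos_def (pert_matrix G u1 u2 P) \<and> \<not> pos_def (- pert_matrix G u1 u2 P)))"
proof -
  interpret gap_setting G q u1 u2
    by unfold_locales (use graph connected potentials q u1 u1_normalized u2 in auto)
  have psd: "pos_semidef (pert_matrix G u1 u2 P)"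
    if "minimizing_potential G C q" "P \<in> Linfty G" "positively_admissible C q P" for P
    by (rule minimizing_psd[OF that])
  have eig: "\<exists>\<mu>\<le>0. \<exists>v. v \<noteq> 0 \<and> pert_matrix G u1 u2 P *v v = \<mu> *\<^sub>R v"
    if "maximizing_potential G C q" "P \<in> Linfty G" "positively_admissible C q P" for P
    by (rule maximizing_lowest_eigenvalue_nonpos[OF that])
  have npd: "\<not> pos_def (pert_matrix G u1 u2 P)"
    if "maximizing_potential G C q" "P \<in> Linfty G" "positively_admissible C q P" for P
    using eig[OF that] pos_def_eigenvalue_pos by force
  have diag: "0 \<le> A $ k $ k" if "pos_semidef A" for A :: "real ^ 'n ^ 'n" and k
  proof -
    have "0 \<le> axis k 1 \<bullet> (A *v axis k 1)" using that by (simp add: pos_semidef_def)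
    then show ?thesis by (simp add: inner_axis' matrix_vector_mult_basis column_def)
  qed
  have zero: "pert_matrix G u1 u2 P = 0"
    if min: "minimizing_potential G C q" and P: "P \<in> Linfty G" and adm: "admissible C q P" for P
  proof (rule sym_matrix_zero[OF pert_matrix_sym[OF P]])
    fix x :: "real ^ 'n"
    have "0 \<le> x \<bullet> (pert_matrix G u1 u2 P *v x)"
      using psd[OF min P] adm by (simp add: admissible_def pos_semidef_def)
    \<comment> \<open>The perturbation \<open>- P\<close> is positively admissible too, and the
      matrix is odd in the perturbation, so its quadratic form is both non-negative and
      non-positive.\<close>
    moreover have "0 \<le> x \<bullet> (- pert_matrix G u1 u2 P *v x)"
      using psd[OF min Linfty_uminus[OF P]] adm
      by (simp add: admissible_def pos_semidef_def pert_matrix_uminus[OF P])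
    ultimately show "x \<bullet> (pert_matrix G u1 u2 P *v x) = 0"
      by (simp add: matrix_vector_mult_def sum_negf inner_vec_def)
  qed
  have npd_uminus: "\<not> pos_def (- pert_matrix G u1 u2 P)"
    if max: "maximizing_potential G C q" and P: "P \<in> Linfty G" and adm: "admissible C q P" for P
    using npd[OF max Linfty_uminus[OF P]] adm by (simp add: admissible_def pert_matrix_uminus[OF P])
  show ?thesis
    using psd diag zero eig npd npd_uminus by (simp add: admissible_def)
qed

end
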